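(* Let $\omega\in\mathbb R^d$ be nonresonant, let $\mathcal S:\mathbb T^d\to\mathbb R$ be smooth, put $\Sigma=\{\theta\in\mathbb T^d:\mathcal S(\theta)=0\}$, and assume $\Sigma\neq\varnothing$ and $\nabla\mathcal S(\theta)\ne0$ for all $\theta\in\Sigma$. Assume that either (a) $D_\omega\mathcal S(\theta)\neq0$ for all $\theta\in\Sigma$; or, more generally, (b) the tangency set $\mathcal C=\{\theta\in\Sigma:D_\omega\mathcal S(\theta)=0\}$ is finite and for each $\theta_*\in\mathcal C$ there is an integer $r\ge2$ with $D_\omega^\ell\mathcal S(\theta_* )=0$ for $1\le\ell<r$ and $D_\omega^r\mathcal S(\theta_* )\neq0$. Let $N_{\mathcal S,\omega}(L)=\#\{x\in[0,L]:\mathcal S(x\omega)=0\}$ (zeros counted without multiplicity). Then the limit $\rho_{\mathcal S,\omega}=\lim_{L\to\infty}N_{\mathcal S,\omega}(L)/L$ exists and $$\rho_{\mathcal S,\omega}=\frac1{(2\pi)^d}\int_{\mathbb T^d}\delta_0(\mathcal S(\theta))\,|D_\omega\mathcal S(\theta)|\,d\theta=\frac1{(2\pi)^d}\int_\Sigma\frac{|D_\omega\mathcal S(\theta)|}{|\nabla_\theta\mathcal S(\theta)|}\,d\sigma(\theta).$$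
   Context: $\mathbb T^d=\mathbb R^d/(2\pi\mathbb Z)^d$. Nonresonant: $\omega\cdot\ell\neq0$ for all $\ell\in\mathbb Z^d\setminus\{0\}$. $D_\omega=\omega\cdot\nabla_\theta$. $\sigma$ is the surface ($(d-1)$-dimensional Hausdorff) measure on $\Sigma$. The integral with the Dirac mass $\delta_0$ is understood as $\lim_{\eta\to0}\int_{\mathbb T^d}\chi_\eta(\mathcal S(\theta))|D_\omega\mathcal S(\theta)|\,d\theta$, where $\chi_\eta(s)=\eta^{-1}\chi(s/\eta)$, $\chi\in C_c^\infty((-1,1))$, $\chi\ge0$, $\int\chi=1$. *)

theory Defs
  imports "HOL-Analysis.Analysis"
begin

text \<open>
  A function on the torus $\mathbb{T}^d = \mathbb{R}^d / (2\pi\mathbb{Z})^d$ is represented by its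
  lift, a function on \<open>real^'d\<close> that is $2\pi$-periodic in each coordinate.  Points of the torus are
  represented by their unique representatives in the half-open cell $[0,2\pi)^d$, so that subsets
  of the torus and integrals over it become subsets of, and integrals over, that cell.
\<close>

definition int_vec :: "int^'d \<Rightarrow> real^'d" where
  "int_vec l = (\<chi> i. of_int (l $ i))"

definition torus_periodic :: "(real^'d \<Rightarrow> 'b) \<Rightarrow> bool" where
  "torus_periodic f \<longleftrightarrow> (\<forall>\<theta> l. f (\<theta> + (2 * pi) *\<^sub>R int_vec l) = f \<theta>)"

definition torus :: "(real^'d) set" where
  "torus = {\<theta>. \<forall>i. 0 \<le> \<theta> $ i \<and> \<theta> $ i < 2 * pi}"

definition nonresonant :: "real^'d \<Rightarrow> bool" where
  "nonresonant \<omega> \<longleftrightarrow> (\<forall>l. l \<noteq> 0 \<longrightarrow> \<omega> \<bullet> int_vec l \<noteq> 0)"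

primrec times_differentiable :: "nat \<Rightarrow> ('a::euclidean_space \<Rightarrow> real) \<Rightarrow> bool" where
  "times_differentiable 0 f \<longleftrightarrow> continuous_on UNIV f"
| "times_differentiable (Suc k) f \<longleftrightarrow>
     (\<forall>x. f differentiable (at x)) \<and>
     (\<forall>b\<in>Basis. times_differentiable k (\<lambda>x. frechet_derivative f (at x) b))"

definition smooth :: "('a::euclidean_space \<Rightarrow> real) \<Rightarrow> bool" where
  "smooth f \<longleftrightarrow> (\<forall>k. times_differentiable k f)"

definition gradient :: "('a::euclidean_space \<Rightarrow> real) \<Rightarrow> 'a \<Rightarrow> 'a" where
  "gradient f x = (\<Sum>b\<in>Basis. frechet_derivative f (at x) b *\<^sub>R b)"

definition dir_deriv :: "'a::euclidean_space \<Rightarrow> ('a \<Rightarrow> real) \<Rightarrow> 'a \<Rightarrow> real" where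
  "dir_deriv \<omega> f x = \<omega> \<bullet> gradient f x"

definition zero_surface :: "(real^'d \<Rightarrow> real) \<Rightarrow> (real^'d) set" where
  "zero_surface S = {\<theta> \<in> torus. S \<theta> = 0}"

definition tangency_set :: "real^'d \<Rightarrow> (real^'d \<Rightarrow> real) \<Rightarrow> (real^'d) set" where
  "tangency_set \<omega> S = {\<theta> \<in> zero_surface S. dir_deriv \<omega> S \<theta> = 0}"

definition orbit_zeros :: "(real^'d \<Rightarrow> real) \<Rightarrow> real^'d \<Rightarrow> real \<Rightarrow> real set" where
  "orbit_zeros S \<omega> L = {x \<in> {0..L}. S (x *\<^sub>R \<omega>) = 0}"

text \<open>
  Hausdorff measure of integer dimension \<open>n\<close>, with the usual normalisation: a covering set
  contributes the volume of the \<open>n\<close>-dimensional ball of the same diameter.  The empty set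
  contributes \<open>0\<close>; this is stated separately because \<open>0 ^ 0 = 1\<close>, so that for \<open>n = 0\<close> a nonempty
  set contributes \<open>1\<close> and the measure counts points.  The boundedness condition on the covering
  sets is needed because \<open>diameter\<close> is unspecified on unbounded sets.
\<close>

definition hausdorff_gauge :: "nat \<Rightarrow> 'a::metric_space set \<Rightarrow> ennreal" where
  "hausdorff_gauge n A =
     (if A = {} then 0 else ennreal (unit_ball_vol (real n) * (diameter A / 2) ^ n))"

definition hausdorff_content :: "nat \<Rightarrow> real \<Rightarrow> 'a::metric_space set \<Rightarrow> ennreal" where
  "hausdorff_content n \<delta> X =
     (INF A \<in> {A :: nat \<Rightarrow> 'a set.
                 (\<forall>i. bounded (A i) \<and> diameter (A i) \<le> \<delta>) \<and> X \<subseteq> (\<Union>i. A i)}.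
        \<Sum>i. hausdorff_gauge n (A i))"

definition hausdorff_outer :: "nat \<Rightarrow> 'a::metric_space set \<Rightarrow> ennreal" where
  "hausdorff_outer n X = (SUP \<delta> \<in> {0<..}. hausdorff_content n \<delta> X)"

text \<open>
  Hausdorff outer measure is a metric outer measure, hence countably additive on the Borel sets,
  so \<open>measure_of\<close> does not degenerate to the zero measure here.
\<close>

definition hausdorff_measure :: "nat \<Rightarrow> 'a::metric_space measure" where
  "hausdorff_measure n = measure_of UNIV (sets borel) (hausdorff_outer n)"

definition mollifier_profile :: "(real \<Rightarrow> real) \<Rightarrow> bool" where
  "mollifier_profile \<phi> \<longleftrightarrow>
     smooth \<phi> \<and> closure {s. \<phi> s \<noteq> 0} \<subseteq> {-1<..<1} \<and> (\<forall>s. 0 \<le> \<phi> s) \<and>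
     (LINT s|lborel. \<phi> s) = 1"

text \<open>
  \<open>has_delta_integral S g I\<close> expresses $\int_{\mathbb{T}^d} \delta_0(S(\theta))\, g(\theta)\, d\theta = I$:
  for every admissible profile the mollified integrals converge, always to the value \<open>I\<close>.
\<close>

definition has_delta_integral ::
  "(real^'d \<Rightarrow> real) \<Rightarrow> (real^'d \<Rightarrow> real) \<Rightarrow> real \<Rightarrow> bool" where
  "has_delta_integral S g I \<longleftrightarrow>
     (\<forall>\<phi>. mollifier_profile \<phi> \<longrightarrow>
        ((\<lambda>\<eta>. LINT \<theta>:torus|lborel. (1 / \<eta>) * \<phi> (S \<theta> / \<eta>) * g \<theta>) \<longlongrightarrow> I) (at_right 0))"

end

theory Submission
  imports Defs
begin

text \<open>
  For a small \<open>h > 0\<close> let \<open>n \<theta>\<close> be the number of zeros of \<open>S\<close> on the orbit segment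
  \<open>{\<theta> + x \<omega> | 0 \<le> x \<le> h}\<close>.  By compactness and the finite order of the tangencies, Rolle's
  theorem bounds \<open>n\<close> by a constant \<open>R\<close>; moreover \<open>n\<close> is locally constant off a closed null set, so
  that \<open>n\<close> can be approximated by continuous functions up to a small error near that set.  Each
  zero along the orbit of \<open>0\<close> is counted by the starting points of an interval of length \<open>h\<close>, hence
  equidistribution of the orbit identifies the density of zeros with the mean of \<open>n\<close> divided by \<open>h\<close>.

  The mean of \<open>n\<close> is evaluated twice.  Integrating \<open>\<chi>\<^sub>\<eta>(S) \<bar>D\<^sub>\<omega> S\<bar>\<close> along the segment gives a quantity
  that is bounded by \<open>R\<close> and equals \<open>n\<close> for small \<open>\<eta>\<close>, almost everywhere; averaging over the torus
  yields the integral with the Dirac mass.  On the other hand, the torus integral of \<open>n\<close> is the total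
  volume of the flow strips swept out by pieces of \<open>\<Sigma>\<close> in time \<open>h\<close>.  Near a transversal point,
  \<open>\<Sigma>\<close> is almost isometric to its projection along \<open>\<omega>\<close> to the tangent hyperplane, so the volume of a
  thin strip is almost \<open>h\<close> times the integral of \<open>\<bar>D\<^sub>\<omega> S\<bar> / \<bar>\<nabla>S\<bar>\<close> over its base.
\<close>

section \<open>Stable zeros and mollified counts on an interval\<close>

text \<open>The step \<open>h\<close> is so small that on each orbit segment either
  \<open>\<bar>S\<bar>\<close> stays above a fixed \<open>\<eta>0\<close> or one fixed iterated
  derivative along \<open>\<omega>\<close> has no zero. This bounds the number of zeros and their
  mollified count by the same \<open>R\<close>, uniformly in the starting point and the kernel, as
  dominated convergence requires. The count can jump only if a zero passes an end of the segment or
  the segment contains a tangency; such starting points are null, since every orbit meets the zero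
  set in a countable set and, for \<open>d \<ge> 2\<close>, countably many segments are null. The
  flux is computed without parametrizing \<Sigma>: by the isodiametric inequality, the normalisation
  of Hausdorff measure matches Lebesgue measure, so a projection that distorts distances by factors
  near 1 distorts measures by factors near 1. All errors go into one factor \<open>K > 1\<close>, on
  which the compared quantities do not depend. Kernels are described by an antiderivative running
  from 0 to 1, because the mollified count on a monotone piece is the increment of that
  antiderivative.\<close>

definition bump :: "real \<Rightarrow> (real \<Rightarrow> real) \<Rightarrow> bool" where
  "bump \<eta> k \<longleftrightarrow> continuous_on UNIV k \<and> (\<forall>s. 0 \<le> k s) \<and> (\<forall>s. \<eta> \<le> \<bar>s\<bar> \<longrightarrow> k s = 0) \<and>
     (\<exists>K. (\<forall>s. (K has_real_derivative k s) (at s)) \<and> (\<forall>s\<le>-\<eta>. K s = 0) \<and> (\<forall>s\<ge>\<eta>. K s = 1))"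

definition C1_deriv :: "(real \<Rightarrow> real) \<Rightarrow> (real \<Rightarrow> real) \<Rightarrow> bool" where
  "C1_deriv f f' \<longleftrightarrow> (\<forall>x. (f has_real_derivative f' x) (at x)) \<and> continuous_on UNIV f'"

lemma C1_deriv_D:
  assumes "C1_deriv f f'"
  shows "(f has_real_derivative f' x) (at x)" "continuous_on A f" "continuous_on A f'"
proof -
  show *: "(f has_real_derivative f' x) (at x)" for x using assms by (auto simp: C1_deriv_def)
  show "continuous_on A f" using * by (meson DERIV_isCont continuous_at_imp_continuous_on)
  show "continuous_on A f'" using assms continuous_on_subset unfolding C1_deriv_def by blast
qed

lemma C1_deriv_uminus: "C1_deriv f f' \<Longrightarrow> C1_deriv (\<lambda>x. - f x) (\<lambda>x. - f' x)"
  unfolding C1_deriv_def by (auto intro!: derivative_eq_intros continuous_intros)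

text \<open>The pieces of a monotone splitting end at zeros of the derivative, so the sign is weak
  on the closed interval while \<open>f'\<close> is nonzero only inside. A strict change of sign
  would force an interior zero.\<close>

lemma nonvanishing_sign:
  fixes f' :: "real \<Rightarrow> real"
  assumes "continuous_on UNIV f'" "\<And>x. a < x \<Longrightarrow> x < b \<Longrightarrow> f' x \<noteq> 0"
  shows "(\<forall>x\<in>{a..b}. 0 \<le> f' x) \<or> (\<forall>x\<in>{a..b}. f' x \<le> 0)"
proof (rule ccontr)
  assume "\<not> ?thesis"
  then obtain x y where xy: "x \<in> {a..b}" "y \<in> {a..b}" "f' x < 0" "f' y > 0" by force
  have "\<exists>z. z \<in> {a<..<b} \<and> f' z = 0"
  proof (cases "x \<le> y")
    case True
    have "\<exists>z\<ge>x. z \<le> y \<and> f' z = 0"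
      by (rule IVT') (use xy True assms(1) continuous_on_subset in auto)
    then obtain z where z: "x \<le> z" "z \<le> y" "f' z = 0" by auto
    then have "z \<noteq> x" "z \<noteq> y" using xy by auto
    then show ?thesis using z xy by (intro exI[of _ z]) auto
  next
    case False
    have "\<exists>z\<ge>y. z \<le> x \<and> f' z = 0"
      by (rule IVT2') (use xy False assms(1) continuous_on_subset in auto)
    then obtain z where z: "y \<le> z" "z \<le> x" "f' z = 0" by auto
    then have "z \<noteq> x" "z \<noteq> y" using xy by auto
    then show ?thesis using z xy by (intro exI[of _ z]) auto
  qed
  then show False using assms(2) by auto
qed

text \<open>\<open>K (f x)\<close> has derivative \<open>k (f x) * f' x\<close>. For a kernel as in
  \<open>bump\<close> and increasing \<open>f\<close> the integral is thus the rise of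
  \<open>K\<close> along \<open>f\<close>: it is 1 if \<open>f\<close> crosses the whole support of
  the kernel and never exceeds 1.\<close>

lemma integral_bump_mono:
  assumes f: "C1_deriv f f'" and ab: "a \<le> b"
    and K: "\<And>s. (K has_real_derivative k s) (at s)"
    and sgn: "\<forall>x\<in>{a..b}. 0 \<le> f' x"
  shows "((\<lambda>x. k (f x) * \<bar>f' x\<bar>) has_integral (K (f b) - K (f a))) {a..b}"
proof -
  have "((\<lambda>x. k (f x) * f' x) has_integral (K (f b) - K (f a))) {a..b}"
  proof (rule fundamental_theorem_of_calculus[OF ab])
    fix x
    have "((\<lambda>x. K (f x)) has_real_derivative k (f x) * f' x) (at x)"
      using DERIV_chain2[OF K C1_deriv_D(1)[OF f]] .
    then show "((\<lambda>x. K (f x)) has_vector_derivative k (f x) * f' x) (at x within {a..b})"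
      by (simp add: has_real_derivative_iff_has_vector_derivative has_vector_derivative_at_within)
  qed
  then show ?thesis
    by (rule has_integral_eq[rotated]) (use sgn in auto)
qed

lemma integral_bump_mono':
  assumes f: "C1_deriv f f'" and ab: "a \<le> b"
    and K: "\<And>s. (K has_real_derivative k s) (at s)"
    and sgn: "\<forall>x\<in>{a..b}. f' x \<le> 0"
  shows "((\<lambda>x. k (f x) * \<bar>f' x\<bar>) has_integral (K (f a) - K (f b))) {a..b}"
proof -
  \<comment> \<open>An antiderivative for the reflected kernel, so that the increasing case applies
    to \<open>- f\<close>.\<close>
  have K': "((\<lambda>s. - K (- s)) has_real_derivative k (- s)) (at s)" for s
    by (auto intro!: derivative_eq_intros DERIV_chain2[OF K])
  have "((\<lambda>x. k (- (- f x)) * \<bar>- f' x\<bar>) has_integral (- K (- (- f b)) - (- K (- (- f a))))) {a..b}"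
    by (rule integral_bump_mono[OF C1_deriv_uminus[OF f] ab, of "\<lambda>s. - K (- s)" "\<lambda>s. k (- s)"])
      (use K' sgn in auto)
  then show ?thesis by simp
qed

text \<open>Used with \<open>Z\<close> the zeros of a derivative: the interval is cut at these
  points into pieces of monotonicity. \<open>Q\<close> carries the number of pieces, which adds up
  under concatenation.\<close>

lemma interval_split_induct [consumes 2, case_names base step]:
  fixes Q :: "real \<Rightarrow> real \<Rightarrow> nat \<Rightarrow> bool"
  assumes "finite Z" "a \<le> b"
    and base: "\<And>a b. a \<le> b \<Longrightarrow> Z \<inter> {a<..<b} = {} \<Longrightarrow> Q a b 1"
    and step: "\<And>a b c i j. a \<le> b \<Longrightarrow> b \<le> c \<Longrightarrow> Q a b i \<Longrightarrow> Q b c j \<Longrightarrow> Q a c (i + j)"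
  shows "Q a b (card (Z \<inter> {a<..<b}) + 1)"
  using \<open>a \<le> b\<close>
proof (induction "card (Z \<inter> {a<..<b})" arbitrary: a b rule: less_induct)
  case less
  show ?case
  proof (cases "Z \<inter> {a<..<b} = {}")
    case True
    then show ?thesis using base[OF less.prems True] by simp
  next
    case False
    then obtain z where z: "z \<in> Z" "a < z" "z < b" by auto
    let ?A = "Z \<inter> {a<..<z}" and ?B = "Z \<inter> {z<..<b}"
    have eq: "Z \<inter> {a<..<b} = insert z (?A \<union> ?B)" using z by auto
    have fin: "finite ?A" "finite ?B" using \<open>finite Z\<close> by auto
    have c: "card (Z \<inter> {a<..<b}) = Suc (card ?A + card ?B)"
      unfolding eq using fin by (subst card_insert_disjoint) (auto simp: card_Un_disjoint disjoint_iff)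
    have "Q a z (card ?A + 1)" "Q z b (card ?B + 1)"
      using less.hyps[of a z] less.hyps[of z b] c z by auto
    from step[OF _ _ this] z show ?thesis unfolding c by simp
  qed
qed

lemma bump_le_1:
  assumes "(\<forall>s. (K has_real_derivative k s) (at s))" "\<forall>s. (0::real) \<le> k s" "\<forall>s\<le>-\<eta>. K s = 0" "\<forall>s\<ge>\<eta>. K s = 1"
  shows "0 \<le> K s" "K s \<le> 1"
proof -
  have mono: "x \<le> y \<Longrightarrow> K x \<le> K y" for x y
    using DERIV_nonneg_imp_nondecreasing[of x y K] assms(1,2) by blast
  have "K (min s (-\<eta>)) = 0" "K (max s \<eta>) = 1" using assms(3,4) by auto
  then show "0 \<le> K s" "K s \<le> 1" using mono[of "min s (-\<eta>)" s] mono[of s "max s \<eta>"] by auto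
qed

text \<open>The zeros of \<open>f'\<close> leave at most one more monotone piece than there are
  zeros, and each piece contributes an increment of \<open>K\<close>, which is at most 1.\<close>

lemma integral_bump_le:
  assumes f: "C1_deriv f f'" and ab: "a \<le> b" and k: "bump \<eta> k"
    and fin: "finite {x\<in>{a..b}. f' x = 0}"
  shows "(\<lambda>x. k (f x) * \<bar>f' x\<bar>) integrable_on {a..b}"
    "integral {a..b} (\<lambda>x. k (f x) * \<bar>f' x\<bar>) \<le> real (card {x\<in>{a..b}. f' x = 0} + 1)"
proof -
  obtain K where K: "\<forall>s. (K has_real_derivative k s) (at s)" "\<forall>s\<le>-\<eta>. K s = 0" "\<forall>s\<ge>\<eta>. K s = 1"
    and k0: "\<forall>s. 0 \<le> k s"
    using k by (auto simp: bump_def)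
  note K01 = bump_le_1[OF K(1) k0 K(2,3)]
  let ?Z = "{x\<in>{a..b}. f' x = 0}"
  let ?Q = "\<lambda>u v n. a \<le> u \<and> v \<le> b \<longrightarrow> (\<exists>I. ((\<lambda>x. k (f x) * \<bar>f' x\<bar>) has_integral I) {u..v} \<and> I \<le> real n)"
  have "?Q a b (card (?Z \<inter> {a<..<b}) + 1)"
    using fin ab
  proof (induction rule: interval_split_induct[where Q="?Q"])
    case (base u v)
    show ?case
    proof (intro impI)
      assume uv: "a \<le> u \<and> v \<le> b"
      have "f' x \<noteq> 0" if "u < x" "x < v" for x
      proof
        assume "f' x = 0"
        then have "x \<in> ?Z \<inter> {u<..<v}" using uv that by auto
        then show False using base by blast
      qed
      then have "(\<forall>x\<in>{u..v}. 0 \<le> f' x) \<or> (\<forall>x\<in>{u..v}. f' x \<le> 0)"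
        by (intro nonvanishing_sign C1_deriv_D[OF f])
      then show "\<exists>I. ((\<lambda>x. k (f x) * \<bar>f' x\<bar>) has_integral I) {u..v} \<and> I \<le> real 1"
      proof
        assume "\<forall>x\<in>{u..v}. 0 \<le> f' x"
        from integral_bump_mono[OF f base(1) K(1)[rule_format] this] show ?thesis
          using K01[of "f u"] K01[of "f v"] by (intro exI[of _ "K (f v) - K (f u)"]) auto
      next
        assume "\<forall>x\<in>{u..v}. f' x \<le> 0"
        from integral_bump_mono'[OF f base(1) K(1)[rule_format] this] show ?thesis
          using K01[of "f u"] K01[of "f v"] by (intro exI[of _ "K (f u) - K (f v)"]) auto
      qed
    qed
  next
    case (step u v w i j)
    show ?case
    proof (intro impI)
      assume uw: "a \<le> u \<and> w \<le> b"
      with step obtain I J where "((\<lambda>x. k (f x) * \<bar>f' x\<bar>) has_integral I) {u..v}" "I \<le> real i"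
        "((\<lambda>x. k (f x) * \<bar>f' x\<bar>) has_integral J) {v..w}" "J \<le> real j" by auto
      then show "\<exists>I. ((\<lambda>x. k (f x) * \<bar>f' x\<bar>) has_integral I) {u..w} \<and> I \<le> real (i + j)"
        using has_integral_combine[OF step(1,2)] by (intro exI[of _ "I + J"]) auto
    qed
  qed
  moreover have "card (?Z \<inter> {a<..<b}) \<le> card ?Z" using fin by (intro card_mono) auto
  ultimately obtain I where "((\<lambda>x. k (f x) * \<bar>f' x\<bar>) has_integral I) {a..b}" "I \<le> real (card ?Z + 1)"
    by force
  then show "(\<lambda>x. k (f x) * \<bar>f' x\<bar>) integrable_on {a..b}"
    "integral {a..b} (\<lambda>x. k (f x) * \<bar>f' x\<bar>) \<le> real (card {x\<in>{a..b}. f' x = 0} + 1)"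
    by (auto simp: integral_unique)
qed

text \<open>Between neighbouring zeros of \<open>f'\<close> Rolle's theorem allows at most one zero
  of \<open>f\<close>. A zero at a common end point of two pieces is counted twice, which the
  inequality tolerates.\<close>

lemma Rolle_count:
  assumes f: "C1_deriv f f'" and ab: "a \<le> b" and fin: "finite {x\<in>{a..b}. f' x = 0}"
  shows "finite {x\<in>{a..b}. f x = 0} \<and> card {x\<in>{a..b}. f x = 0} \<le> card {x\<in>{a..b}. f' x = 0} + 1"
proof -
  let ?Z = "{x\<in>{a..b}. f' x = 0}"
  let ?Q = "\<lambda>u v n. a \<le> u \<and> v \<le> b \<longrightarrow> finite {x\<in>{u..v}. f x = 0} \<and> card {x\<in>{u..v}. f x = 0} \<le> n"
  have "?Q a b (card (?Z \<inter> {a<..<b}) + 1)"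
    using fin ab
  proof (induction rule: interval_split_induct[where Q="?Q"])
    case (base u v)
    show ?case
    proof (intro impI)
      assume uv: "a \<le> u \<and> v \<le> b"
      have eq: "x = y" if "x \<in> {u..v}" "y \<in> {u..v}" "f x = 0" "f y = 0" for x y
      proof (rule ccontr)
        assume "x \<noteq> y"
        have "\<exists>z. z \<in> {u<..<v} \<and> f' z = 0" if "x < y" "x \<in> {u..v}" "y \<in> {u..v}" "f x = 0" "f y = 0" for x y
        proof -
          have "\<exists>z. x < z \<and> z < y \<and> (*) (f' z) = (\<lambda>v. 0)"
            by (rule Rolle_deriv[OF \<open>x < y\<close>, of f "\<lambda>z. (*) (f' z)"])
              (use that C1_deriv_D[OF f] in \<open>auto simp: has_field_derivative_def\<close>)
          then obtain z where "x < z" "z < y" "(*) (f' z) = (\<lambda>v. 0)" by blast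
          then have "f' z = 0" by (metis mult.right_neutral)
          then show ?thesis using \<open>x < z\<close> \<open>z < y\<close> that by (intro exI[of _ z]) auto
        qed
        from this[of x y] this[of y x] \<open>x \<noteq> y\<close> that
        obtain z where "z \<in> {u<..<v}" "f' z = 0" by (metis linorder_neqE_linordered_idom)
        then have "z \<in> ?Z \<inter> {u<..<v}" using uv by auto
        then show False using base by blast
      qed
      then have "{x\<in>{u..v}. f x = 0} = {} \<or> (\<exists>x. {x\<in>{u..v}. f x = 0} = {x})" by blast
      then show "finite {x\<in>{u..v}. f x = 0} \<and> card {x\<in>{u..v}. f x = 0} \<le> 1" 
        by (metis (lifting) card.empty card_1_singleton_iff finite.simps le_numeral_extra(4) One_nat_def zero_le)
    qed
  next
    case (step u v w i j)
    show ?case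
    proof (intro impI)
      assume uw: "a \<le> u \<and> w \<le> b"
      have eq: "{x\<in>{u..w}. f x = 0} = {x\<in>{u..v}. f x = 0} \<union> {x\<in>{v..w}. f x = 0}"
        using step(1,2) by auto
      show "finite {x\<in>{u..w}. f x = 0} \<and> card {x\<in>{u..w}. f x = 0} \<le> i + j"
        unfolding eq using step uw
        by (intro conjI order_trans[OF card_Un_le] add_mono) auto
    qed
  qed
  moreover have "card (?Z \<inter> {a<..<b}) \<le> card ?Z" using fin by (intro card_mono) auto
  ultimately show ?thesis by force
qed

text \<open>Downward induction on the order: \<open>F r\<close> has no zeros, and each step from a
  derivative to its primitive adds at most one by \<open>Rolle_count\<close>.\<close>

lemma finite_order_zero_count:
  fixes F :: "nat \<Rightarrow> real \<Rightarrow> real"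
  assumes F: "\<And>l. C1_deriv (F l) (F (Suc l))" and ab: "a \<le> b"
    and nz: "\<And>x. x \<in> {a..b} \<Longrightarrow> F r x \<noteq> 0" and "l \<le> r"
  shows "finite {x\<in>{a..b}. F l x = 0} \<and> card {x\<in>{a..b}. F l x = 0} \<le> r - l"
  using \<open>l \<le> r\<close>
proof (induction rule: inc_induct)
  case base
  have "{x\<in>{a..b}. F r x = 0} = {}" using nz by auto
  then show ?case by (metis card.empty finite.emptyI zero_le)
next
  case (step n)
  then have "card {x\<in>{a..b}. F n x = 0} \<le> card {x\<in>{a..b}. F (Suc n) x = 0} + 1"
    "finite {x\<in>{a..b}. F n x = 0}"
    using Rolle_count[OF F[of n] ab] by auto
  then show ?case using step by linarith
qed

text \<open>The number of zeros and the mollified count are tied together because both follow from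
  the same cutting of the interval. Perturbations \<open>g\<close> of \<open>f\<close> yield local
  constancy of the count; the choice \<open>g = f\<close> yields the exact mollified count for small
  \<open>\<eta>\<close>.\<close>

definition stable_within ::
    "(real \<Rightarrow> real) \<Rightarrow> (real \<Rightarrow> real) \<Rightarrow> real \<Rightarrow> real \<Rightarrow> real \<Rightarrow> bool" where
  "stable_within f f' a b c \<longleftrightarrow>
     (\<forall>g g'. C1_deriv g g' \<longrightarrow> (\<forall>x\<in>{a..b}. \<bar>g x - f x\<bar> < c \<and> \<bar>g' x - f' x\<bar> < c) \<longrightarrow>
        finite {x\<in>{a..b}. g x = 0} \<and> card {x\<in>{a..b}. g x = 0} = card {x\<in>{a..b}. f x = 0} \<and>
        (\<forall>\<eta> k. bump \<eta> k \<longrightarrow> \<eta> < c \<longrightarrow>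
          ((\<lambda>x. k (g x) * \<bar>g' x\<bar>) has_integral real (card {x\<in>{a..b}. f x = 0})) {a..b}))"

text \<open>Nonzero end values make the notion additive: the common end point of two adjacent
  intervals is never a zero counted on both sides.\<close>

definition stable_count :: "(real \<Rightarrow> real) \<Rightarrow> (real \<Rightarrow> real) \<Rightarrow> real \<Rightarrow> real \<Rightarrow> bool" where
  "stable_count f f' a b \<longleftrightarrow> f a \<noteq> 0 \<and> f b \<noteq> 0 \<and> (\<exists>c>0. stable_within f f' a b c)"

lemma stable_withinD:
  assumes "stable_within f f' a b c" "C1_deriv g g'"
    "\<forall>x\<in>{a..b}. \<bar>g x - f x\<bar> < c \<and> \<bar>g' x - f' x\<bar> < c"
  shows "finite {x\<in>{a..b}. g x = 0}" "card {x\<in>{a..b}. g x = 0} = card {x\<in>{a..b}. f x = 0}"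
    "\<And>\<eta> k. bump \<eta> k \<Longrightarrow> \<eta> < c \<Longrightarrow>
       ((\<lambda>x. k (g x) * \<bar>g' x\<bar>) has_integral real (card {x\<in>{a..b}. f x = 0})) {a..b}"
proof -
  note 2 = assms(1)[unfolded stable_within_def, THEN spec, THEN spec, THEN mp, OF assms(2), THEN mp, OF assms(3)]
  show "finite {x\<in>{a..b}. g x = 0}" "card {x\<in>{a..b}. g x = 0} = card {x\<in>{a..b}. f x = 0}"
    "\<And>\<eta> k. bump \<eta> k \<Longrightarrow> \<eta> < c \<Longrightarrow>
       ((\<lambda>x. k (g x) * \<bar>g' x\<bar>) has_integral real (card {x\<in>{a..b}. f x = 0})) {a..b}"
    by (fact 2[THEN conjunct1] 2[THEN conjunct2, THEN conjunct1]
      2[THEN conjunct2, THEN conjunct2, THEN spec, THEN spec, THEN mp, THEN mp])+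
qed

lemma stable_count_combine:
  assumes f: "C1_deriv f f'" and 1: "stable_count f f' a b" and 2: "stable_count f f' b c"
    and "a \<le> b" "b \<le> c"
  shows "stable_count f f' a c"
proof -
  obtain d e where d: "d > 0" "stable_within f f' a b d" and e: "e > 0" "stable_within f f' b c e"
    and nz: "f a \<noteq> 0" "f b \<noteq> 0" "f c \<noteq> 0" using 1 2 unfolding stable_count_def by blast
  \<comment> \<open>\<open>\<bar>f b\<bar>\<close> enters so that every admissible \<open>g\<close>
    is still nonzero at the joint \<open>b\<close>.\<close>
  define m where "m = Min {d, e, \<bar>f b\<bar>}"
  have m: "m > 0" "m \<le> d" "m \<le> e" "m \<le> \<bar>f b\<bar>" using d(1) e(1) nz by (auto simp: m_def)
  have card: "card {x\<in>{a..c}. g x = 0} = card {x\<in>{a..b}. g x = 0} + card {x\<in>{b..c}. g x = 0}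
      \<and> finite {x\<in>{a..c}. g x = 0}"
    if "g b \<noteq> 0" "finite {x\<in>{a..b}. g x = 0}" "finite {x\<in>{b..c}. g x = 0}" for g :: "real \<Rightarrow> real"
  proof -
    have "{x\<in>{a..c}. g x = 0} = {x\<in>{a..b}. g x = 0} \<union> {x\<in>{b..c}. g x = 0}" 
      using \<open>a \<le> b\<close> \<open>b \<le> c\<close> by auto
    moreover have "{x\<in>{a..b}. g x = 0} \<inter> {x\<in>{b..c}. g x = 0} = {}" using that(1)
    proof -
      have "{x\<in>{a..b}. g x = 0} \<inter> {x\<in>{b..c}. g x = 0} \<subseteq> {x. x = b \<and> g x = 0}" by auto
      then show ?thesis using that(1) by blast
    qed
    ultimately show ?thesis using that by (simp add: card_Un_disjoint)
  qed
  have "finite {x\<in>{a..b}. f x = 0}" "finite {x\<in>{b..c}. f x = 0}"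
    by (rule stable_withinD(1)[OF d(2) f]; use d(1) in simp)
      (rule stable_withinD(1)[OF e(2) f]; use e(1) in simp)
  then have cf: "card {x\<in>{a..c}. f x = 0} = card {x\<in>{a..b}. f x = 0} + card {x\<in>{b..c}. f x = 0}"
    using card[of f, OF nz(2)] by blast
  have "stable_within f f' a c m"
    unfolding stable_within_def
  proof (intro allI impI)
    fix g g' assume g: "C1_deriv g g'" and cl: "\<forall>x\<in>{a..c}. \<bar>g x - f x\<bar> < m \<and> \<bar>g' x - f' x\<bar> < m"
    have A: "\<forall>x\<in>{a..b}. \<bar>g x - f x\<bar> < d \<and> \<bar>g' x - f' x\<bar> < d" "\<forall>x\<in>{b..c}. \<bar>g x - f x\<bar> < e \<and> \<bar>g' x - f' x\<bar> < e"
    proof -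
      have cl': "\<bar>g x - f x\<bar> < m" "\<bar>g' x - f' x\<bar> < m" if "x \<in> {a..c}" for x
        using cl that by auto
      show "\<forall>x\<in>{a..b}. \<bar>g x - f x\<bar> < d \<and> \<bar>g' x - f' x\<bar> < d" "\<forall>x\<in>{b..c}. \<bar>g x - f x\<bar> < e \<and> \<bar>g' x - f' x\<bar> < e"
        using \<open>a \<le> b\<close> \<open>b \<le> c\<close>
        by (auto intro!: less_le_trans[OF cl'(1) m(2)] less_le_trans[OF cl'(2) m(2)]
            less_le_trans[OF cl'(1) m(3)] less_le_trans[OF cl'(2) m(3)])
    qed
    have "\<bar>g b - f b\<bar> < m" using cl \<open>a \<le> b\<close> \<open>b \<le> c\<close> by auto
    then have gb: "g b \<noteq> 0" using m by auto
    have G1: "finite {x\<in>{a..b}. g x = 0}" "card {x\<in>{a..b}. g x = 0} = card {x\<in>{a..b}. f x = 0}"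
      and G1': "\<And>\<eta> k. bump \<eta> k \<Longrightarrow> \<eta> < d \<Longrightarrow>
          ((\<lambda>x. k (g x) * \<bar>g' x\<bar>) has_integral real (card {x\<in>{a..b}. f x = 0})) {a..b}"
      using stable_withinD[OF d(2) g A(1)] .
    have G2: "finite {x\<in>{b..c}. g x = 0}" "card {x\<in>{b..c}. g x = 0} = card {x\<in>{b..c}. f x = 0}"
      and G2': "\<And>\<eta> k. bump \<eta> k \<Longrightarrow> \<eta> < e \<Longrightarrow>
          ((\<lambda>x. k (g x) * \<bar>g' x\<bar>) has_integral real (card {x\<in>{b..c}. f x = 0})) {b..c}"
      using stable_withinD[OF e(2) g A(2)] .
    show "finite {x\<in>{a..c}. g x = 0} \<and> card {x\<in>{a..c}. g x = 0} = card {x\<in>{a..c}. f x = 0} \<and>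
        (\<forall>\<eta> k. bump \<eta> k \<longrightarrow> \<eta> < m \<longrightarrow>
          ((\<lambda>x. k (g x) * \<bar>g' x\<bar>) has_integral real (card {x\<in>{a..c}. f x = 0})) {a..c})"
    proof (intro conjI allI impI)
      show "finite {x\<in>{a..c}. g x = 0}" "card {x\<in>{a..c}. g x = 0} = card {x\<in>{a..c}. f x = 0}"
        using card[of g, OF gb] G1 G2 cf by auto
      fix \<eta> k assume "bump \<eta> k" "\<eta> < m"
      then show "((\<lambda>x. k (g x) * \<bar>g' x\<bar>) has_integral real (card {x\<in>{a..c}. f x = 0})) {a..c}"
        unfolding cf of_nat_add
        by (intro has_integral_combine[OF \<open>a \<le> b\<close> \<open>b \<le> c\<close>] G1' G2') (use m in auto)
    qed
  qed
  then show ?thesis unfolding stable_count_def using nz m(1) by auto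
qed

lemma stable_count_nonzero:
  assumes f: "C1_deriv f f'" and nz: "\<And>x. x \<in> {a..b} \<Longrightarrow> f x \<noteq> 0" and "a \<le> b"
  shows "stable_count f f' a b"
proof -
  have "continuous_on {a..b} (\<lambda>x. \<bar>f x\<bar>)" using C1_deriv_D(2)[OF f] by (intro continuous_intros)
  then obtain x0 where x0: "x0 \<in> {a..b}" "\<And>x. x \<in> {a..b} \<Longrightarrow> \<bar>f x0\<bar> \<le> \<bar>f x\<bar>"
    using continuous_attains_inf[of "{a..b}" "\<lambda>x. \<bar>f x\<bar>"] \<open>a \<le> b\<close> by auto
  \<comment> \<open>Half of the minimum of \<open>\<bar>f\<bar>\<close> leaves
    \<open>\<bar>g\<bar> > m > \<eta>\<close>, so the kernel vanishes along all of
    \<open>g\<close>.\<close>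
  define m where "m = \<bar>f x0\<bar> / 2"
  have m: "m > 0" using nz x0(1) by (auto simp: m_def)
  have e: "{x\<in>{a..b}. f x = 0} = {}" using nz by auto
  have *: "finite {x\<in>{a..b}. g x = 0} \<and> card {x\<in>{a..b}. g x = 0} = card {x\<in>{a..b}. f x = 0} \<and>
        (\<forall>\<eta> k. bump \<eta> k \<longrightarrow> \<eta> < m \<longrightarrow>
          ((\<lambda>x. k (g x) * \<bar>g' x\<bar>) has_integral real (card {x\<in>{a..b}. f x = 0})) {a..b})" 
    if cl: "\<forall>x\<in>{a..b}. \<bar>g x - f x\<bar> < m \<and> \<bar>g' x - f' x\<bar> < m" for g g'
  proof -
    have gm: "m < \<bar>g x\<bar>" if "x \<in> {a..b}" for x
    proof -
      have "\<bar>g x - f x\<bar> < m" using cl that by blast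
      moreover have "2 * m \<le> \<bar>f x\<bar>" using x0(2)[OF that] by (simp add: m_def)
      ultimately show ?thesis by linarith
    qed
    have e': "{x\<in>{a..b}. g x = 0} = {}" using gm m by fastforce
    have "((\<lambda>x. k (g x) * \<bar>g' x\<bar>) has_integral 0) {a..b}" if "bump \<eta> k" "\<eta> < m" for \<eta> k
    proof (rule has_integral_is_0)
      fix x assume "x \<in> {a..b}"
      then have "\<eta> \<le> \<bar>g x\<bar>" using gm that by force
      then show "k (g x) * \<bar>g' x\<bar> = 0" using that(1) by (simp add: bump_def)
    qed
    then show ?thesis unfolding e e' by simp
  qed
  then have "stable_within f f' a b m" unfolding stable_within_def by blast
  then show ?thesis unfolding stable_count_def using nz[of a] nz[of b] \<open>a \<le> b\<close> m by auto
qed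

lemma stable_count_crossing_pos:
  assumes f: "C1_deriv f f'" and "a < b" and m: "m > 0" "\<And>x. x \<in> {a..b} \<Longrightarrow> m \<le> f' x"
    and fab: "f a < 0" "0 < f b"
  shows "stable_count f f' a b"
proof -
  \<comment> \<open>\<open>m\<close> keeps \<open>g'\<close> positive; the halved end values leave
    \<open>g a < - c\<close> and \<open>g b > c\<close>, so \<open>g\<close> crosses the whole
    support of a kernel of width \<open>\<eta> < c\<close>.\<close>
  define c where "c = Min {m, - f a / 2, f b / 2}"
  have c: "c > 0" "c \<le> m" "2 * c \<le> - f a" "2 * c \<le> f b" using m fab by (auto simp: c_def)
  have one: "\<exists>!x. x \<in> {a..b} \<and> g x = 0"
    if g: "C1_deriv g g'" and pos: "\<And>x. x \<in> {a..b} \<Longrightarrow> g' x > 0" and "g a < 0" "g b > 0" for g g'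
  proof -
    have inj: "x < y \<Longrightarrow> x \<in> {a..b} \<Longrightarrow> y \<in> {a..b} \<Longrightarrow> g x < g y" for x y
      by (rule DERIV_pos_imp_increasing[of x y g]) 
         (use C1_deriv_D(1)[OF g] pos in \<open>auto intro!: exI[of _ "g' _"]\<close>)
    have "\<exists>x\<ge>a. x \<le> b \<and> g x = 0"
      by (rule IVT') (use that \<open>a < b\<close> C1_deriv_D(2)[OF g] in auto)
    then obtain x where "x \<in> {a..b}" "g x = 0" by auto
    then show ?thesis using inj by (intro ex1I[of _ x]) (metis inj less_irrefl linorder_neqE_linordered_idom)+
  qed
  have card1: "{x\<in>{a..b}. g x = 0} = {z}" if "\<exists>!x. x \<in> {a..b} \<and> g x = 0" "z \<in> {a..b}" "g z = 0" for g :: "real \<Rightarrow> real" and z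
    using that by blast
  have "\<exists>!x. x \<in> {a..b} \<and> f x = 0" by (rule one[OF f less_le_trans[OF m(1) m(2)]]) (use fab in auto)
  then obtain y where "y \<in> {a..b}" "f y = 0" "\<exists>!x. x \<in> {a..b} \<and> f x = 0" by blast
  then have cf: "card {x\<in>{a..b}. f x = 0} = 1" using card1[of f y] by simp
  have *: "finite {x\<in>{a..b}. g x = 0} \<and> card {x\<in>{a..b}. g x = 0} = card {x\<in>{a..b}. f x = 0} \<and>
        (\<forall>\<eta> k. bump \<eta> k \<longrightarrow> \<eta> < c \<longrightarrow>
          ((\<lambda>x. k (g x) * \<bar>g' x\<bar>) has_integral real (card {x\<in>{a..b}. f x = 0})) {a..b})" 
    if g: "C1_deriv g g'" and cl: "\<forall>x\<in>{a..b}. \<bar>g x - f x\<bar> < c \<and> \<bar>g' x - f' x\<bar> < c" for g g'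
  proof -
    have pos: "g' x > 0" if "x \<in> {a..b}" for x
      using cl[rule_format, OF that] m(2)[OF that] c by linarith
    have ga: "g a < - c" using cl[rule_format, of a] \<open>a < b\<close> c by auto
    have gb: "g b > c" using cl[rule_format, of b] \<open>a < b\<close> c by auto
    have "\<exists>!x. x \<in> {a..b} \<and> g x = 0" using one[OF g pos] ga gb c by auto
    then obtain z where z: "{x\<in>{a..b}. g x = 0} = {z}" using card1[of g] by blast
    have "((\<lambda>x. k (g x) * \<bar>g' x\<bar>) has_integral 1) {a..b}" if k: "bump \<eta> k" "\<eta> < c" for \<eta> k
    proof -
      obtain K where K: "\<forall>s. (K has_real_derivative k s) (at s)" "\<forall>s\<le>-\<eta>. K s = 0" "\<forall>s\<ge>\<eta>. K s = 1"
        using k by (auto simp: bump_def)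
      have "((\<lambda>x. k (g x) * \<bar>g' x\<bar>) has_integral K (g b) - K (g a)) {a..b}"
        by (rule integral_bump_mono[OF g _ K(1)[rule_format]]) (use \<open>a < b\<close> pos in \<open>auto simp: less_imp_le\<close>)
      moreover have "K (g b) = 1" "K (g a) = 0" using K ga gb k by auto
      ultimately show ?thesis by simp
    qed
    then show ?thesis unfolding cf z by simp
  qed
  then have "stable_within f f' a b c" unfolding stable_within_def by blast
  then show ?thesis unfolding stable_count_def using fab c(1) by auto
qed

lemma bump_reflect: 
  assumes "bump \<eta> k" "\<eta> > 0" shows "bump \<eta> (\<lambda>s. k (- s))"
proof -
  obtain K where K: "\<forall>s. (K has_real_derivative k s) (at s)" "\<forall>s\<le>-\<eta>. K s = 0" "\<forall>s\<ge>\<eta>. K s = 1"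
    using assms by (auto simp: bump_def)
  \<comment> \<open>The constant 1 restores the normalisation from 0 to 1 after the
    reflection.\<close>
  have "((\<lambda>s. 1 - K (- s)) has_real_derivative k (- s)) (at s)" for s
    by (auto intro!: derivative_eq_intros DERIV_chain2[OF K(1)[rule_format]])
  moreover have "continuous_on UNIV (\<lambda>s. k (- s))"
    using assms(1) by (auto simp: bump_def intro!: continuous_on_compose2[of UNIV k] continuous_intros)
  ultimately show ?thesis using assms K unfolding bump_def
    by (intro conjI exI[of _ "\<lambda>s. 1 - K (- s)"]) auto
qed

lemma bump_pos: "bump \<eta> k \<Longrightarrow> \<eta> > 0"
  unfolding bump_def by (metis linorder_not_le neg_0_le_iff_le order_trans zero_neq_one)

lemma stable_count_uminus:
  assumes "stable_count (\<lambda>x. - f x) (\<lambda>x. - f' x) a b"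
  shows "stable_count f f' a b"
proof -
  obtain c where c: "c > 0" "stable_within (\<lambda>x. - f x) (\<lambda>x. - f' x) a b c" and nz: "f a \<noteq> 0" "f b \<noteq> 0"
    using assms unfolding stable_count_def by auto
  have "stable_within f f' a b c"
    unfolding stable_within_def
  proof (intro allI impI)
    fix g g' assume g: "C1_deriv g g'" and cl: "\<forall>x\<in>{a..b}. \<bar>g x - f x\<bar> < c \<and> \<bar>g' x - f' x\<bar> < c"
    have cl1: "\<forall>x\<in>{a..b}. \<bar>- g x - - f x\<bar> < c \<and> \<bar>- g' x - - f' x\<bar> < c"
      using cl by (simp add: abs_minus_commute)
    note D = stable_withinD[OF c(2) C1_deriv_uminus[OF g] cl1, unfolded neg_equal_0_iff_equal]
    have "((\<lambda>x. k (g x) * \<bar>g' x\<bar>) has_integral real (card {x\<in>{a..b}. f x = 0})) {a..b}"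
      if k: "bump \<eta> k" "\<eta> < c" for \<eta> k
    proof -
      have b: "bump \<eta> (\<lambda>s. k (- s))" using bump_reflect k bump_pos by blast
      show ?thesis using D(3)[OF b k(2)] by simp
    qed
    then show "finite {x\<in>{a..b}. g x = 0} \<and> card {x\<in>{a..b}. g x = 0} = card {x\<in>{a..b}. f x = 0} \<and>
        (\<forall>\<eta> k. bump \<eta> k \<longrightarrow> \<eta> < c \<longrightarrow>
          ((\<lambda>x. k (g x) * \<bar>g' x\<bar>) has_integral real (card {x\<in>{a..b}. f x = 0})) {a..b})"
      using D(1,2) by simp
  qed
  then show ?thesis using c nz unfolding stable_count_def by blast
qed

lemma stable_count_near_zero_pos:
  assumes f: "C1_deriv f f'" and z: "f z = 0" "f' z > 0" and r: "r > 0"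
  shows "\<exists>\<delta>>0. \<delta> \<le> r \<and> stable_count f f' (z - \<delta>) (z + \<delta>)"
proof -
  have "isCont f' z" using f by (simp add: C1_deriv_def continuous_on_eq_continuous_at)
  then have "\<exists>d>0. \<forall>x. dist x z < d \<longrightarrow> dist (f' x) (f' z) < f' z / 2"
    using z(2) unfolding continuous_at_eps_delta by (metis half_gt_zero)
  then obtain d where d: "d > 0" "\<And>x. dist x z < d \<Longrightarrow> dist (f' x) (f' z) < f' z / 2" by auto
  define \<delta> where "\<delta> = min (d/2) r"
  have \<delta>: "\<delta> > 0" "\<delta> < d" "\<delta> \<le> r" using d r by (auto simp: \<delta>_def)
  have low: "f' z / 2 \<le> f' x" if "x \<in> {z-\<delta>..z+\<delta>}" for x
  proof -
    have "dist x z < d" using that \<delta> by (auto simp: dist_real_def)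
    then have "dist (f' x) (f' z) < f' z / 2" by (rule d(2))
    then show ?thesis by (simp add: dist_real_def abs_if split: if_splits)
  qed
  have inc: "f x < f y" if "x < y" "x \<in> {z-\<delta>..z+\<delta>}" "y \<in> {z-\<delta>..z+\<delta>}" for x y
  proof (rule DERIV_pos_imp_increasing[OF that(1)])
    fix t assume "x \<le> t" "t \<le> y"
    then have "f' z / 2 \<le> f' t" using low that by auto
    then show "\<exists>y. (f has_real_derivative y) (at t) \<and> 0 < y"
      using C1_deriv_D(1)[OF f, of t] z(2) by (intro exI[of _ "f' t"]) auto
  qed
  have "stable_count f f' (z - \<delta>) (z + \<delta>)"
    by (rule stable_count_crossing_pos[OF f, where m="f' z / 2"])
      (use low inc[of "z-\<delta>" z] inc[of z "z+\<delta>"] \<delta> z in auto)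
  then show ?thesis using \<delta> by blast
qed

lemma stable_count_near_zero:
  assumes f: "C1_deriv f f'" and z: "f z = 0" "f' z \<noteq> 0" and r: "r > 0"
  shows "\<exists>\<delta>>0. \<delta> \<le> r \<and> stable_count f f' (z - \<delta>) (z + \<delta>)"
proof (cases "f' z > 0")
  case True
  then show ?thesis using stable_count_near_zero_pos[OF f z(1) _ r] by blast
next
  case False
  then show ?thesis
    using stable_count_near_zero_pos[OF C1_deriv_uminus[OF f], of z, OF _ _ r] z stable_count_uminus by force
qed

text \<open>Induction on the number of zeros: a simple zero is enclosed in a small stable interval,
  the two remaining intervals contain fewer zeros, and the three pieces are concatenated.\<close>

lemma stable_count_transversal:
  assumes f: "C1_deriv f f'" and "a \<le> b" "finite {x\<in>{a..b}. f x = 0}" "f a \<noteq> 0" "f b \<noteq> 0"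
    and "\<And>x. x \<in> {a..b} \<Longrightarrow> f x = 0 \<Longrightarrow> f' x \<noteq> 0"
  shows "stable_count f f' a b"
  using assms(2-)
proof (induction "card {x\<in>{a..b}. f x = 0}" arbitrary: a b rule: less_induct)
  case less
  show ?case
  proof (cases "{x\<in>{a..b}. f x = 0} = {}")
    case True
    then show ?thesis using stable_count_nonzero[OF f _ less.prems(1)] by blast
  next
    case False
    then obtain z where z: "a \<le> z" "z \<le> b" "f z = 0" by auto
    then have z': "a < z" "z < b" using less.prems by (metis order_le_less)+
    obtain \<delta> where \<delta>: "\<delta> > 0" "\<delta> \<le> min (z - a) (b - z)" and st: "stable_count f f' (z - \<delta>) (z + \<delta>)"
      using stable_count_near_zero[OF f z(3), of "min (z-a) (b-z)"] z z' less.prems(5)[of z] by auto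
    have nz: "f (z - \<delta>) \<noteq> 0" "f (z + \<delta>) \<noteq> 0" using st by (auto simp: stable_count_def)
    have sub: "{x\<in>{a..z-\<delta>}. f x = 0} \<subset> {x\<in>{a..b}. f x = 0}" "{x\<in>{z+\<delta>..b}. f x = 0} \<subset> {x\<in>{a..b}. f x = 0}"
    proof -
      have "z \<in> {x\<in>{a..b}. f x = 0}" "z \<notin> {a..z-\<delta>}" "z \<notin> {z+\<delta>..b}" using \<delta> z by auto
      moreover have "{x\<in>{a..z-\<delta>}. f x = 0} \<subseteq> {x\<in>{a..b}. f x = 0}" "{x\<in>{z+\<delta>..b}. f x = 0} \<subseteq> {x\<in>{a..b}. f x = 0}"
        using \<delta> z z' by auto
      ultimately show "{x\<in>{a..z-\<delta>}. f x = 0} \<subset> {x\<in>{a..b}. f x = 0}" "{x\<in>{z+\<delta>..b}. f x = 0} \<subset> {x\<in>{a..b}. f x = 0}"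
        by blast+
    qed
    have 1: "stable_count f f' a (z - \<delta>)"
      by (rule less.hyps) (use finite_subset[OF psubset_imp_subset[OF sub(1)]] psubset_card_mono[OF _ sub(1)] less.prems \<delta> z' nz in auto)
    have 2: "stable_count f f' (z + \<delta>) b"
      by (rule less.hyps) (use finite_subset[OF psubset_imp_subset[OF sub(2)]] psubset_card_mono[OF _ sub(2)] less.prems \<delta> z' nz in auto)
    have "stable_count f f' a (z + \<delta>)"
      by (rule stable_count_combine[OF f 1 st]) (use \<delta> in auto)
    then show ?thesis
      by (rule stable_count_combine[OF f _ 2]) (use \<delta> z' in auto)
  qed
qed

section \<open>Hausdorff measure\<close>

lemma ennreal_suminf_tail:
  fixes f :: "nat \<Rightarrow> ennreal"
  assumes "suminf f \<noteq> top" "e > 0"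
  shows "\<exists>N. (\<Sum>i. f (i + N)) \<le> ennreal e"
proof -
  define r where "r i = enn2real (f i)" for i
  have "f i \<noteq> top" for i
    using ennreal_suminf_lessD[of f top i] assms(1) by (auto simp: less_top)
  then have f: "f i = ennreal (r i)" for i by (simp add: r_def less_top)
  have r0: "0 \<le> r i" for i by (simp add: r_def)
  have sm: "summable r" using assms(1) r0 unfolding f by (intro summable_suminf_not_top)
  obtain N where N: "norm (\<Sum>i. r (i + N)) < e"
    using suminf_exist_split[OF assms(2) sm] by auto
  have "(\<Sum>i. f (i + N)) = ennreal (\<Sum>i. r (i + N))"
    unfolding f using r0 sm by (intro suminf_ennreal2) (auto simp: summable_iff_shift)
  also have "\<dots> \<le> ennreal e" using N by (intro ennreal_leI) auto
  finally show ?thesis by blast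
qed

text \<open>The part \<open>XX n\<close> of \<open>X\<close> at distance at least
  \<open>1 / (n + 1)\<close> from \<open>F\<close> is separated from \<open>F\<close>, so the claim
  holds for it. What is missing lies in the distance shells \<open>R k\<close>. Shells of equal
  parity are separated from each other, so both partial sums stay below \<open>\<mu> X\<close>; the
  series of all shells converges and its tail bounds the missing part.\<close>

lemma metric_outer_closed_split:
  fixes \<mu> :: "'a::metric_space set \<Rightarrow> ennreal"
  assumes mono: "\<And>A B. A \<subseteq> B \<Longrightarrow> \<mu> A \<le> \<mu> B"
    and csub: "\<And>A :: nat \<Rightarrow> 'a set. \<mu> (\<Union>i. A i) \<le> (\<Sum>i. \<mu> (A i))"
    and empty: "\<mu> {} = 0"
    and sep: "\<And>A B r. r > 0 \<Longrightarrow> (\<And>x y. x \<in> A \<Longrightarrow> y \<in> B \<Longrightarrow> r \<le> dist x y) \<Longrightarrow> \<mu> A + \<mu> B \<le> \<mu> (A \<union> B)"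
    and F: "closed F"
  shows "\<mu> (F \<inter> X) + \<mu> (X - F) = \<mu> X"
proof (rule antisym)
  have sub2: "\<mu> (A \<union> B) \<le> \<mu> A + \<mu> B" for A B
  proof -
    have "(\<Union>i::nat. if i = 0 then A else if i = 1 then B else {}) = A \<union> B"
      by (auto split: if_splits)
    then have "\<mu> (A \<union> B) \<le> (\<Sum>i::nat. \<mu> (if i = 0 then A else if i = 1 then B else {}))"
      using csub[of "\<lambda>i. if i = 0 then A else if i = 1 then B else {}"] by simp
    also have "\<dots> = (\<Sum>i\<in>{0,1::nat}. \<mu> (if i = 0 then A else if i = 1 then B else {}))"
      by (rule suminf_finite) (auto simp: empty)
    also have "\<dots> = \<mu> A + \<mu> B" by simp
    finally show ?thesis .
  qed
  have "X = (F \<inter> X) \<union> (X - F)" by auto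
  then show "\<mu> X \<le> \<mu> (F \<inter> X) + \<mu> (X - F)" using sub2[of "F \<inter> X" "X - F"] by simp
  show "\<mu> (F \<inter> X) + \<mu> (X - F) \<le> \<mu> X"
  proof (cases "F = {} \<or> \<mu> X = top")
    case True
    then show ?thesis by (auto simp: empty)
  next
    case False
    then have ne: "F \<noteq> {}" and fin: "\<mu> X \<noteq> top" by auto
    let ?d = "\<lambda>x. infdist x F"
    define XX where "XX n = {x\<in>X. 1 / real (n + 1) \<le> ?d x}" for n :: nat
    define R where "R k = {x\<in>X. 1 / real (k + 2) \<le> ?d x \<and> ?d x < 1 / real (k + 1)}" for k :: nat
    have step: "\<mu> (F \<inter> X) + \<mu> (XX n) \<le> \<mu> X" for n
    proof -
      have "\<mu> (F \<inter> X) + \<mu> (XX n) \<le> \<mu> ((F \<inter> X) \<union> XX n)"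
      proof (rule sep[of "1 / real (n + 1)"])
        fix x y assume "x \<in> F \<inter> X" "y \<in> XX n"
        then show "1 / real (n + 1) \<le> dist x y"
          using infdist_le[of x F y] by (auto simp: XX_def dist_commute)
      qed simp
      also have "\<dots> \<le> \<mu> X" by (intro mono) (auto simp: XX_def)
      finally show ?thesis .
    qed
    have Rfin: "(\<Sum>k<m. \<mu> (R (2 * k + i))) \<le> \<mu> (\<Union>k<m. R (2 * k + i))" for m i :: nat
    proof (induction m)
      case 0 then show ?case by simp
    next
      case (Suc m)
      have "(\<Sum>k<Suc m. \<mu> (R (2 * k + i))) \<le> \<mu> (\<Union>k<m. R (2 * k + i)) + \<mu> (R (2 * m + i))"
        using Suc by (simp add: add_right_mono)
      also have "\<dots> \<le> \<mu> ((\<Union>k<m. R (2 * k + i)) \<union> R (2 * m + i))"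
      \<comment> \<open>For \<open>m = 0\<close> the union is empty; excluding it also keeps the
        denominator \<open>2 * m + i\<close> positive.\<close>
      proof (cases "m = 0")
        case True
        then show ?thesis by (simp add: empty)
      next
        case False
        \<comment> \<open>Earlier shells of this parity keep distance at least
          \<open>1 / (2 * m + i)\<close> from \<open>F\<close>, the new shell less than
          \<open>1 / (2 * m + i + 1)\<close>; the skipped shell is the gap.\<close>
        show ?thesis
        proof (rule sep[of "1 / real (2 * m + i) - 1 / real (2 * m + i + 1)"])
          show "0 < 1 / real (2 * m + i) - 1 / real (2 * m + i + 1)"
          proof -
            have "0 < real (2 * m + i)" using False by simp
            then have "1 / real (2 * m + i + 1) < 1 / real (2 * m + i)"
              by (intro divide_strict_left_mono) auto
            then show ?thesis by simp
          qed
          fix x y assume x: "x \<in> (\<Union>k<m. R (2 * k + i))" and y: "y \<in> R (2 * m + i)"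
          from x obtain k where k: "k < m" "x \<in> R (2 * k + i)" by auto
          have "1 / real (2 * m + i) \<le> 1 / real (2 * k + i + 2)"
            using k False by (intro divide_left_mono) auto
          also have "\<dots> \<le> ?d x" using k by (simp add: R_def)
          finally have "1 / real (2 * m + i) \<le> ?d x" .
          moreover have "?d y \<le> 1 / real (2 * m + i + 1)" using y by (simp add: R_def)
          moreover have "?d x \<le> ?d y + dist x y" by (rule infdist_triangle)
          ultimately show "1 / real (2 * m + i) - 1 / real (2 * m + i + 1) \<le> dist x y" by linarith
        qed
      qed
      also have "(\<Union>k<m. R (2 * k + i)) \<union> R (2 * m + i) = (\<Union>k<Suc m. R (2 * k + i))"
        by (auto simp: less_Suc_eq)
      finally show ?case .
    qed
    have Rs: "(\<Sum>k. \<mu> (R (2 * k + i))) \<le> \<mu> X" for i :: nat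
    proof (rule suminf_le_const[OF summableI])
      show "(\<Sum>k<m. \<mu> (R (2 * k + i))) \<le> \<mu> X" for m
        using Rfin[of i m] by (rule order_trans) (auto intro!: mono simp: R_def)
    qed
    have "(\<Sum>k<m. \<mu> (R k)) \<le> \<mu> X + \<mu> X" for m
    proof -
      have "(\<Sum>k<m. \<mu> (R k)) \<le> (\<Sum>k<2*m. \<mu> (R k))"
        by (intro sum_mono2) auto
      also have "\<dots> = (\<Sum>k<m. \<mu> (R (2 * k + 0))) + (\<Sum>k<m. \<mu> (R (2 * k + 1)))"
        by (induction m) (simp_all add: algebra_simps)
      also have "\<dots> \<le> (\<Sum>k. \<mu> (R (2 * k + 0))) + (\<Sum>k. \<mu> (R (2 * k + 1)))"
        by (intro add_mono sum_le_suminf summableI) auto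
      also have "\<dots> \<le> \<mu> X + \<mu> X" by (intro add_mono Rs)
      finally show ?thesis .
    qed
    then have "(\<Sum>k. \<mu> (R k)) \<le> \<mu> X + \<mu> X" by (intro suminf_le_const summableI)
    then have Rtop: "(\<Sum>k. \<mu> (R k)) \<noteq> top" using fin by (auto simp: top_unique)
    show ?thesis
    proof (rule ennreal_le_epsilon)
      fix e :: real assume "e > 0"
      obtain N where N: "(\<Sum>i. \<mu> (R (i + N))) \<le> ennreal e"
        using ennreal_suminf_tail[OF Rtop \<open>e > 0\<close>] by auto
      have "X - F \<subseteq> XX N \<union> (\<Union>i. R (i + N))"
      proof
        fix x assume x: "x \<in> X - F"
        then have dx: "?d x > 0" using F ne by (metis DiffD2 in_closed_iff_infdist_zero infdist_nonneg less_eq_real_def)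
        show "x \<in> XX N \<union> (\<Union>i. R (i + N))"
        proof (cases "1 / real (N + 1) \<le> ?d x")
          case True then show ?thesis using x by (auto simp: XX_def)
        next
          case False
          define k where "k = (LEAST k. 1 / real (k + 2) \<le> ?d x)"
          obtain k0 where "1 / real (k0 + 1) < ?d x"
            using nat_approx_posE[OF dx] by (metis Suc_eq_plus1)
          moreover have "1 / real (k0 + 2) \<le> 1 / real (k0 + 1)" by (intro divide_left_mono) auto
          ultimately have "1 / real (k0 + 2) \<le> ?d x" by linarith
          then have k: "1 / real (k + 2) \<le> ?d x" unfolding k_def by (rule LeastI)
          have kN: "N \<le> k"
          proof (rule ccontr)
            assume "\<not> N \<le> k"
            then have "1 / real (N + 1) \<le> 1 / real (k + 2)" by (intro divide_left_mono) auto
            then show False using k False by linarith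
          qed
          have "?d x < 1 / real (k + 1)"
          proof (cases "k = N")
            case True then show ?thesis using False by simp
          next
            case F: False
            then have "k - 1 < k" using kN by auto
            then have "\<not> 1 / real (k - 1 + 2) \<le> ?d x" unfolding k_def by (rule not_less_Least)
            then show ?thesis using F kN by (simp add: of_nat_diff)
          qed
          then have "x \<in> R (k - N + N)" using k x kN by (simp add: R_def)
          then show ?thesis by blast
        qed
      qed
      then have "\<mu> (X - F) \<le> \<mu> (XX N) + \<mu> (\<Union>i. R (i + N))"
        using mono sub2 order_trans by blast
      also have "\<dots> \<le> \<mu> (XX N) + ennreal e"
        using csub[of "\<lambda>i. R (i + N)"] N by (intro add_mono order_refl) (rule order_trans)
      finally have "\<mu> (F \<inter> X) + \<mu> (X - F) \<le> (\<mu> (F \<inter> X) + \<mu> (XX N)) + ennreal e"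
        by (metis add.assoc add_left_mono)
      also have "\<dots> \<le> \<mu> X + ennreal e" by (intro add_mono step order_refl)
      finally show "\<mu> (F \<inter> X) + \<mu> (X - F) \<le> \<mu> X + ennreal e" .
    qed
  qed
qed

text \<open>The Caratheodory-measurable sets form a sigma-algebra on which the outer measure is a
  measure; it contains the closed sets, hence all Borel sets.\<close>

lemma metric_outer_measure_space:
  fixes \<mu> :: "'a::metric_space set \<Rightarrow> ennreal"
  assumes mono: "\<And>A B. A \<subseteq> B \<Longrightarrow> \<mu> A \<le> \<mu> B"
    and csub: "\<And>A :: nat \<Rightarrow> 'a set. \<mu> (\<Union>i. A i) \<le> (\<Sum>i. \<mu> (A i))"
    and empty: "\<mu> {} = 0"
    and sep: "\<And>A B r. r > 0 \<Longrightarrow> (\<And>x y. x \<in> A \<Longrightarrow> y \<in> B \<Longrightarrow> r \<le> dist x y) \<Longrightarrow> \<mu> A + \<mu> B \<le> \<mu> (A \<union> B)"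
  shows "measure_space UNIV (sets borel) \<mu>"
proof -
  let ?L = "lambda_system UNIV (Pow UNIV) \<mu>"
  interpret sigma_algebra "UNIV :: 'a set" "Pow UNIV" by (rule sigma_algebra_Pow)
  have oms: "outer_measure_space (Pow UNIV) \<mu>"
    unfolding outer_measure_space_def positive_def increasing_def countably_subadditive_def
    using mono csub empty by auto
  have L: "measure_space UNIV ?L \<mu>" by (rule caratheodory_lemma[OF oms])
  have cl: "F \<in> ?L" if "closed F" for F
    unfolding lambda_system_def
    using metric_outer_closed_split[OF mono csub empty sep that] by (auto simp: Diff_eq Int_commute)
  have sL: "sigma_algebra UNIV ?L" using L by (simp add: measure_space_def)
  have "sets (borel :: 'a measure) = sigma_sets UNIV (Collect closed)"
    by (simp add: borel_eq_closed)
  also have "\<dots> \<subseteq> ?L" using sigma_algebra.sigma_sets_subset[OF sL, of "Collect closed"] cl by auto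
  finally have "sets borel \<subseteq> ?L" .
  then show ?thesis
    using measure_down[OF L] sets.sigma_algebra_axioms[of "borel :: 'a measure"] by simp
qed

section \<open>Hausdorff content and Hausdorff outer measure\<close>

lemma hausdorff_gauge_empty [simp]: "hausdorff_gauge n {} = 0"
  by (simp add: hausdorff_gauge_def)

lemma hausdorff_content_le:
  assumes "\<And>i::nat. bounded (A i)" "\<And>i. diameter (A i) \<le> \<delta>" "X \<subseteq> (\<Union>i. A i)"
  shows "hausdorff_content n \<delta> X \<le> (\<Sum>i. hausdorff_gauge n (A i))"
  unfolding hausdorff_content_def by (rule INF_lower) (use assms in auto)

lemma hausdorff_content_mono: "X \<subseteq> Y \<Longrightarrow> hausdorff_content n \<delta> X \<le> hausdorff_content n \<delta> Y"
  unfolding hausdorff_content_def by (rule INF_superset_mono) auto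

lemma hausdorff_content_antimono: "\<delta> \<le> \<delta>' \<Longrightarrow> hausdorff_content n \<delta>' X \<le> hausdorff_content n \<delta> X"
  unfolding hausdorff_content_def by (rule INF_superset_mono) (auto intro: order_trans)

lemma hausdorff_content_approx:
  assumes "hausdorff_content n \<delta> X \<noteq> top" "e > 0"
  obtains A :: "nat \<Rightarrow> 'a::metric_space set" where "\<And>i. bounded (A i)" "\<And>i. diameter (A i) \<le> \<delta>"
    "X \<subseteq> (\<Union>i. A i)" "(\<Sum>i. hausdorff_gauge n (A i)) \<le> hausdorff_content n \<delta> X + ennreal e"
proof -
  have "\<exists>A\<in>{A :: nat \<Rightarrow> 'a set. (\<forall>i. bounded (A i) \<and> diameter (A i) \<le> \<delta>) \<and> X \<subseteq> (\<Union>i. A i)}.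
     (\<Sum>i. hausdorff_gauge n (A i)) < hausdorff_content n \<delta> X + ennreal e"
    using INF_approx_ennreal[OF \<open>e > 0\<close> hausdorff_content_def[of n \<delta> X]] assms(1) by auto
  then show ?thesis using that by (auto dest: less_imp_le)
qed

lemma hausdorff_content_empty: "\<delta> > 0 \<Longrightarrow> hausdorff_content n \<delta> {} = 0"
  using hausdorff_content_le[of "\<lambda>_. {}" \<delta> "{}" n] by simp

lemma hausdorff_content_Union:
  "hausdorff_content n \<delta> (\<Union>i::nat. X i) \<le> (\<Sum>i. hausdorff_content n \<delta> (X i))"
proof (rule ennreal_le_epsilon)
  fix e :: real assume e: "e > 0" and top: "(\<Sum>i. hausdorff_content n \<delta> (X i)) < top"
  have fin: "hausdorff_content n \<delta> (X i) \<noteq> top" for i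
    using ennreal_suminf_lessD[OF top, of i] by (simp add: less_top)
  have e': "e * (1/2)^Suc i > 0" for i using e by simp
  have "\<exists>A. (\<forall>j. bounded (A j) \<and> diameter (A j) \<le> \<delta>) \<and> X i \<subseteq> (\<Union>j::nat. A j) \<and>
      (\<Sum>j. hausdorff_gauge n (A j)) \<le> hausdorff_content n \<delta> (X i) + ennreal (e * (1/2)^Suc i)" for i
    by (rule hausdorff_content_approx[OF fin e']) blast
  then obtain A where A: "\<And>i j. bounded (A i j)" "\<And>i j. diameter (A i j) \<le> \<delta>" "\<And>i. X i \<subseteq> (\<Union>j::nat. A i j)"
    "\<And>i. (\<Sum>j. hausdorff_gauge n (A i j)) \<le> hausdorff_content n \<delta> (X i) + ennreal (e * (1/2)^Suc i)"
    by metis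
  define B where "B = (\<lambda>p. case prod_decode p of (i, j) \<Rightarrow> A i j)"
  have "(\<Union>i. X i) \<subseteq> (\<Union>p. B p)"
  proof
    fix x assume "x \<in> (\<Union>i. X i)"
    then obtain i j where "x \<in> A i j" using A(3) by blast
    then have "x \<in> B (prod_encode (i, j))" by (simp add: B_def)
    then show "x \<in> (\<Union>p. B p)" by blast
  qed
  then have "hausdorff_content n \<delta> (\<Union>i. X i) \<le> (\<Sum>p. hausdorff_gauge n (B p))"
    by (intro hausdorff_content_le) (auto simp: B_def A split: prod.splits)
  also have "\<dots> = (\<Sum>p. (\<lambda>(i, j). hausdorff_gauge n (A i j)) (prod_decode p))"
    by (simp add: B_def case_prod_beta)
  also have "\<dots> = (\<Sum>i. \<Sum>j. hausdorff_gauge n (A i j))"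
    by (rule suminf_ennreal_2dimen) simp
  also have "\<dots> \<le> (\<Sum>i. hausdorff_content n \<delta> (X i) + ennreal (e * (1/2)^Suc i))"
    by (intro suminf_le summableI A(4))
  also have "\<dots> = (\<Sum>i. hausdorff_content n \<delta> (X i)) + (\<Sum>i. ennreal (e * (1/2)^Suc i))"
    by (rule suminf_add[OF summableI summableI, symmetric])
  also have "(\<Sum>i. ennreal (e * (1/2)^Suc i)) = ennreal e"
    using sums_mult[OF power_half_series, of e] e by (intro sums_unique[symmetric]) (subst sums_ennreal, auto)
  finally show "hausdorff_content n \<delta> (\<Union>i. X i) \<le> (\<Sum>i. hausdorff_content n \<delta> (X i)) + ennreal e" .
qed

lemma hausdorff_content_le_outer: "\<delta> > 0 \<Longrightarrow> hausdorff_content n \<delta> X \<le> hausdorff_outer n X"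
  unfolding hausdorff_outer_def by (rule SUP_upper) simp

lemma hausdorff_outer_leI:
  "(\<And>\<delta>. \<delta> > 0 \<Longrightarrow> hausdorff_content n \<delta> X \<le> c) \<Longrightarrow> hausdorff_outer n X \<le> c"
  unfolding hausdorff_outer_def by (rule SUP_least) simp

lemma hausdorff_outer_mono: "X \<subseteq> Y \<Longrightarrow> hausdorff_outer n X \<le> hausdorff_outer n Y"
  by (rule hausdorff_outer_leI)
    (metis hausdorff_content_mono hausdorff_content_le_outer order_trans)

lemma hausdorff_outer_empty [simp]: "hausdorff_outer n {} = 0"
  using hausdorff_outer_leI[of n "{}" 0] by (simp add: hausdorff_content_empty)

lemma hausdorff_outer_Union: "hausdorff_outer n (\<Union>i::nat. X i) \<le> (\<Sum>i. hausdorff_outer n (X i))"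
  by (rule hausdorff_outer_leI, rule order_trans[OF hausdorff_content_Union])
    (intro suminf_le summableI hausdorff_content_le_outer)

text \<open>For \<open>\<delta> < r\<close> no covering set of diameter at most
  \<open>\<delta>\<close> meets both sets, so a cover of the union splits into two covers with the
  same total gauge. Contents increase as \<open>\<delta>\<close> decreases, so it suffices to treat
  small \<open>\<delta>\<close>.\<close>

lemma hausdorff_outer_separated:
  assumes r: "r > 0" and sep: "\<And>x y. x \<in> X \<Longrightarrow> y \<in> Y \<Longrightarrow> r \<le> dist x y"
  shows "hausdorff_outer n X + hausdorff_outer n Y \<le> hausdorff_outer n (X \<union> Y)"
proof -
  have small: "hausdorff_content n \<delta> X + hausdorff_content n \<delta> Y \<le> hausdorff_content n \<delta> (X \<union> Y)"
    if \<delta>: "\<delta> > 0" "\<delta> < r" for \<delta>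
  proof -
    have "hausdorff_content n \<delta> X + hausdorff_content n \<delta> Y \<le> (\<Sum>i. hausdorff_gauge n (A i))"
      if A: "\<forall>i::nat. bounded (A i) \<and> diameter (A i) \<le> \<delta>" "X \<union> Y \<subseteq> (\<Union>i. A i)" for A
    proof -
      define B C where "B i = (if A i \<inter> X \<noteq> {} then A i else {})"
        and "C i = (if A i \<inter> X \<noteq> {} then {} else A i)" for i
      have "X \<subseteq> (\<Union>i. B i)"
      proof
        fix x assume "x \<in> X"
        then obtain i where "x \<in> A i" using A(2) by blast
        then have "x \<in> B i" using \<open>x \<in> X\<close> by (auto simp: B_def)
        then show "x \<in> (\<Union>i. B i)" by blast
      qed
      then have 1: "hausdorff_content n \<delta> X \<le> (\<Sum>i. hausdorff_gauge n (B i))"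
        using A \<delta> by (intro hausdorff_content_le) (auto simp: B_def)
      have "Y \<subseteq> (\<Union>i. C i)"
      proof
        fix y assume y: "y \<in> Y"
        then obtain i where i: "y \<in> A i" using A(2) by blast
        have "A i \<inter> X = {}"
        proof (rule ccontr)
          assume "A i \<inter> X \<noteq> {}"
          then obtain x where "x \<in> A i" "x \<in> X" by auto
          then have "dist x y \<le> \<delta>"
            using diameter_bounded_bound[of "A i" x y] A(1)[rule_format, of i] i by linarith
          then show False using sep[OF \<open>x \<in> X\<close> y] \<delta> by linarith
        qed
        then have "y \<in> C i" using i by (auto simp: C_def)
        then show "y \<in> (\<Union>i. C i)" by blast
      qed
      then have 2: "hausdorff_content n \<delta> Y \<le> (\<Sum>i. hausdorff_gauge n (C i))"
        using A \<delta> by (intro hausdorff_content_le) (auto simp: C_def)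
      have "(\<Sum>i. hausdorff_gauge n (B i)) + (\<Sum>i. hausdorff_gauge n (C i)) = (\<Sum>i. hausdorff_gauge n (A i))"
        unfolding suminf_add[OF summableI summableI] by (intro suminf_cong) (auto simp: B_def C_def)
      then show ?thesis using add_mono[OF 1 2] by simp
    qed
    then show ?thesis unfolding hausdorff_content_def[of n \<delta> "X \<union> Y"] by (intro INF_greatest) auto
  qed
  have "hausdorff_outer n X + hausdorff_outer n Y =
      (SUP \<delta>\<in>{0<..}. hausdorff_content n \<delta> X + hausdorff_content n \<delta> Y)"
    unfolding hausdorff_outer_def
  proof (rule SUP_add_directed_ennreal[symmetric])
    fix i j :: real assume "i \<in> {0<..}" "j \<in> {0<..}"
    then show "\<exists>k\<in>{0<..}. hausdorff_content n i X + hausdorff_content n j Y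
        \<le> hausdorff_content n k X + hausdorff_content n k Y"
      by (intro bexI[of _ "min i j"] add_mono hausdorff_content_antimono) auto
  qed
  also have "\<dots> \<le> hausdorff_outer n (X \<union> Y)"
  proof (rule SUP_least)
    fix \<delta> :: real assume "\<delta> \<in> {0<..}"
    define \<delta>' where "\<delta>' = min \<delta> (r/2)"
    have \<delta>': "\<delta>' > 0" "\<delta>' < r" "\<delta>' \<le> \<delta>" using r \<open>\<delta> \<in> {0<..}\<close> by (auto simp: \<delta>'_def)
    have "hausdorff_content n \<delta> X + hausdorff_content n \<delta> Y
        \<le> hausdorff_content n \<delta>' X + hausdorff_content n \<delta>' Y"
      by (intro add_mono hausdorff_content_antimono \<delta>')
    also have "\<dots> \<le> hausdorff_outer n (X \<union> Y)"
      using small[OF \<delta>'(1,2)] hausdorff_content_le_outer[OF \<delta>'(1)] by (rule order_trans)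
    finally show "hausdorff_content n \<delta> X + hausdorff_content n \<delta> Y \<le> hausdorff_outer n (X \<union> Y)" .
  qed
  finally show ?thesis .
qed

lemma sets_hausdorff_measure [simp]: "sets (hausdorff_measure n) = sets borel"
  by (simp add: hausdorff_measure_def sets.sigma_sets_eq[of borel, simplified])

lemma space_hausdorff_measure [simp]: "space (hausdorff_measure n) = UNIV"
  by (simp add: hausdorff_measure_def)

text \<open>\<open>measure_of\<close> returns the given set function once it is known to be a
  measure on the Borel sets; separation of distant sets provides this.\<close>

lemma emeasure_hausdorff_measure:
  assumes "X \<in> sets borel"
  shows "emeasure (hausdorff_measure n) X = hausdorff_outer n X"
proof -
  have "measure_space UNIV (sets borel) (hausdorff_outer n :: 'a set \<Rightarrow> ennreal)"
    by (rule metric_outer_measure_space)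
      (auto intro: hausdorff_outer_mono hausdorff_outer_Union hausdorff_outer_separated)
  then show ?thesis
    by (intro emeasure_measure_of[OF hausdorff_measure_def])
      (use assms in \<open>auto simp: measure_space_def\<close>)
qed

section \<open>The isodiametric inequality\<close>

lemma nn_integral_lborel_shift:
  fixes f :: "'a::euclidean_space \<Rightarrow> ennreal"
  assumes [measurable]: "f \<in> borel_measurable borel"
  shows "(\<integral>\<^sup>+x. f (x + c) \<partial>lborel) = (\<integral>\<^sup>+x. f x \<partial>lborel)"
proof -
  have "(\<integral>\<^sup>+x. f x \<partial>lborel) = (\<integral>\<^sup>+x. f x \<partial>distr lborel borel ((+) c))"
    by (simp add: lborel_distr_plus)
  also have "\<dots> = (\<integral>\<^sup>+x. f (c + x) \<partial>lborel)"
    by (subst nn_integral_distr) auto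
  finally show ?thesis by (simp add: add.commute)
qed

text \<open>Fubini, and for fixed \<open>t\<close> the translation by \<open>t *\<^sub>R v\<close>:
  what the points send along their lines equals what the points receive. This does the work of
  coordinates orthogonal to \<open>v\<close>.\<close>

lemma nn_integral_line_transport:
  fixes f :: "'a::euclidean_space \<Rightarrow> 'a \<Rightarrow> ennreal"
  assumes [measurable]: "(\<lambda>(x, y). f x y) \<in> borel_measurable (borel \<Otimes>\<^sub>M borel)"
  shows "(\<integral>\<^sup>+y. \<integral>\<^sup>+t. f y (y + t *\<^sub>R v) \<partial>lborel \<partial>lborel) = (\<integral>\<^sup>+y. \<integral>\<^sup>+t. f (y - t *\<^sub>R v) y \<partial>lborel \<partial>lborel)"
proof -
  have "(\<integral>\<^sup>+y. \<integral>\<^sup>+t. f y (y + t *\<^sub>R v) \<partial>lborel \<partial>lborel) = (\<integral>\<^sup>+t. \<integral>\<^sup>+y. f y (y + t *\<^sub>R v) \<partial>lborel \<partial>lborel)"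
    by (rule lborel_pair.Fubini') measurable
  also have "\<dots> = (\<integral>\<^sup>+t. \<integral>\<^sup>+y. f (y - t *\<^sub>R v) y \<partial>lborel \<partial>lborel)"
  proof (rule nn_integral_cong)
    fix t :: real
    show "(\<integral>\<^sup>+y. f y (y + t *\<^sub>R v) \<partial>lborel) = (\<integral>\<^sup>+y. f (y - t *\<^sub>R v) y \<partial>lborel)"
      by (subst nn_integral_lborel_shift[of "\<lambda>y. f (y - t *\<^sub>R v) y" "t *\<^sub>R v", symmetric]) simp_all
  qed
  also have "\<dots> = (\<integral>\<^sup>+y. \<integral>\<^sup>+t. f (y - t *\<^sub>R v) y \<partial>lborel \<partial>lborel)"
    by (rule lborel_pair.Fubini'[symmetric]) measurable
  finally show ?thesis .
qed

text \<open>Averaging the translates of \<open>E\<close> along \<open>v\<close> over times in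
  \<open>{0..1}\<close> does not change the measure, and after exchanging the integrals only
  sections of \<open>E\<close> by lines remain.\<close>

lemma line_null_imp_null:
  fixes E :: "'a::euclidean_space set"
  assumes [measurable]: "E \<in> sets borel"
    and null: "\<And>y. y \<in> UNIV \<Longrightarrow> emeasure lborel {t. y + t *\<^sub>R v \<in> E} = 0"
  shows "emeasure lborel E = 0"
proof -
  have "emeasure lborel E = (\<integral>\<^sup>+t. indicator {0..1} t * emeasure lborel E \<partial>(lborel :: real measure))"
    by (simp add: nn_integral_multc)
  also have "\<dots> = (\<integral>\<^sup>+t. \<integral>\<^sup>+y. indicator {0..1::real} t * indicator E (y + t *\<^sub>R v) \<partial>lborel \<partial>lborel)"
    by (intro nn_integral_cong) (simp add: nn_integral_cmult nn_integral_lborel_shift)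
  also have "\<dots> = (\<integral>\<^sup>+y. \<integral>\<^sup>+t. indicator {0..1::real} t * indicator E (y + t *\<^sub>R v) \<partial>lborel \<partial>lborel)"
    by (rule lborel_pair.Fubini'[symmetric]) measurable
  also have "\<dots> \<le> (\<integral>\<^sup>+y. \<integral>\<^sup>+t. indicator {t. y + t *\<^sub>R v \<in> E} t \<partial>lborel \<partial>lborel)"
    by (intro nn_integral_mono) (auto simp: indicator_def)
  also have "\<dots> = 0"
    using null by (subst nn_integral_indicator) auto
  finally show ?thesis by simp
qed

lemma nn_integral_indicator_line:
  fixes A :: "'a::euclidean_space set"
  assumes [measurable]: "A \<in> sets borel"
  shows "(\<integral>\<^sup>+t. indicator A (y + t *\<^sub>R v) \<partial>lborel) = emeasure lborel {t. y + t *\<^sub>R v \<in> A}"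
proof -
  have [measurable]: "{t. y + t *\<^sub>R v \<in> A} \<in> sets borel" by measurable
  have "(\<integral>\<^sup>+t. indicator A (y + t *\<^sub>R v) \<partial>lborel) = (\<integral>\<^sup>+t. indicator {t. y + t *\<^sub>R v \<in> A} t \<partial>lborel)"
    by (intro nn_integral_cong) (simp add: indicator_def)
  then show ?thesis by simp
qed

section \<open>Steiner symmetrization\<close>

definition reflect :: "'a::euclidean_space \<Rightarrow> 'a \<Rightarrow> 'a" where
  "reflect c x = x - (2 * (x \<bullet> c)) *\<^sub>R c"

definition mirror_symmetric :: "'a::euclidean_space \<Rightarrow> 'a set \<Rightarrow> bool" where
  "mirror_symmetric c A \<longleftrightarrow> (\<forall>x. reflect c x \<in> A \<longleftrightarrow> x \<in> A)"

definition line_length :: "'a::euclidean_space set \<Rightarrow> 'a \<Rightarrow> 'a \<Rightarrow> ennreal" where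
  "line_length A b x = emeasure lborel {t. x + t *\<^sub>R b \<in> A}"

lemma line_length_shift:
  assumes [measurable]: "A \<in> sets borel"
  shows "line_length A b (x + s *\<^sub>R b) = line_length A b x"
proof -
  have "(\<integral>\<^sup>+t. indicator A (x + (t + s) *\<^sub>R b) \<partial>lborel) = (\<integral>\<^sup>+t. indicator A (x + t *\<^sub>R b) \<partial>lborel)"
    by (rule nn_integral_lborel_shift) measurable
  then show ?thesis
    unfolding line_length_def nn_integral_indicator_line[OF assms, symmetric]
    by (simp add: algebra_simps)
qed

lemma line_length_measurable [measurable]:
  assumes [measurable]: "A \<in> sets borel"
  shows "line_length A b \<in> borel_measurable borel"
proof -
  have eq: "line_length A b = (\<lambda>y. \<integral>\<^sup>+t. indicator A (y + t *\<^sub>R b) \<partial>lborel)"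
    unfolding line_length_def nn_integral_indicator_line[OF assms] ..
  have "(\<lambda>y. \<integral>\<^sup>+t. indicator A (y + t *\<^sub>R b) \<partial>lborel) \<in> borel_measurable (lborel :: 'a measure)"
    by measurable
  then show ?thesis unfolding eq by simp
qed

lemma line_length_finite:
  assumes "bounded A" "norm b = 1"
  shows "line_length A b x < top"
proof -
  obtain B where B: "\<And>y. y \<in> A \<Longrightarrow> norm y \<le> B" using assms(1) by (auto simp: bounded_iff)
  have "{t. x + t *\<^sub>R b \<in> A} \<subseteq> {- (B + norm x)..B + norm x}"
  proof
    fix t assume "t \<in> {t. x + t *\<^sub>R b \<in> A}"
    then have "norm (x + t *\<^sub>R b) \<le> B" using B by blast
    moreover have "norm (t *\<^sub>R b) \<le> norm (x + t *\<^sub>R b) + norm x"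
      using norm_triangle_ineq4[of "x + t *\<^sub>R b" x] by simp
    ultimately show "t \<in> {- (B + norm x)..B + norm x}" using assms(2) by auto
  qed
  then have "line_length A b x \<le> emeasure lborel {- (B + norm x)..B + norm x}"
    unfolding line_length_def by (intro emeasure_mono) auto
  also have "\<dots> < top" by (simp add: emeasure_lborel_Icc_eq)
  finally show ?thesis .
qed

text \<open>Steiner symmetrization along a unit vector \<open>b\<close>: each line parallel to
  \<open>b\<close> meets the set in the open interval, centred on the hyperplane orthogonal to
  \<open>b\<close>, that is as long as its section of \<open>A\<close>. The strict inequality drops
  lines with null sections.\<close>

definition steiner :: "'a::euclidean_space \<Rightarrow> 'a set \<Rightarrow> 'a set" where
  "steiner b A = {x. ennreal (2 * \<bar>x \<bullet> b\<bar>) < line_length A b x}"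

lemma steiner_measurable [measurable]:
  assumes [measurable]: "A \<in> sets borel"
  shows "steiner b A \<in> sets borel"
proof -
  have "{x \<in> space borel. ennreal (2 * \<bar>x \<bullet> b\<bar>) < line_length A b x} \<in> sets borel"
    by (rule borel_measurable_less) (simp_all add: line_length_measurable assms)
  then show ?thesis by (simp add: steiner_def)
qed

text \<open>A mass transport along lines: each point of \<open>A\<close> spreads unit mass uniformly
  over the section of \<open>steiner b A\<close> on its own line. Both sections there have the same
  length, so each point of the symmetrized set receives mass 1. Points of \<open>A\<close> on lines
  with null section send nothing, but together they are null.\<close>

lemma steiner_emeasure:
  assumes A[measurable]: "A \<in> sets borel" and bd: "bounded A" and b: "norm b = 1"
  shows "emeasure lborel (steiner b A) = emeasure lborel A"
proof -
  let ?S = "steiner b A" and ?m = "line_length A b"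
  have bb: "b \<bullet> b = 1" using b by (simp add: dot_square_norm)
  have fin: "?m x < top" for x by (rule line_length_finite[OF bd b])
  have Sline: "(\<integral>\<^sup>+t. indicator ?S (y + t *\<^sub>R b) \<partial>lborel) = ?m y" for y
  proof -
    obtain r where r: "?m y = ennreal r" "r \<ge> 0" using fin[of y] by (cases "?m y") auto
    have "{t. y + t *\<^sub>R b \<in> ?S} = {- (y \<bullet> b) - r/2 <..< - (y \<bullet> b) + r/2}"
      unfolding steiner_def mem_Collect_eq line_length_shift[OF A] r
      using r(2) by (auto simp: ennreal_less_iff inner_add_left bb abs_if split: if_splits)
    then have "emeasure lborel {t. y + t *\<^sub>R b \<in> ?S} = ennreal r"
      using r(2) by (simp)
    moreover have "(\<integral>\<^sup>+t. indicator ?S (y + t *\<^sub>R b) \<partial>lborel) = emeasure lborel {t. y + t *\<^sub>R b \<in> ?S}"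
      by (rule nn_integral_indicator_line) (rule steiner_measurable[OF A])
    ultimately show ?thesis by (simp add: r)
  qed
  have Aline: "(\<integral>\<^sup>+t. indicator A (y - t *\<^sub>R b) \<partial>lborel) = ?m y" for y
  proof -
    have "(\<integral>\<^sup>+t. indicator A (y - t *\<^sub>R b) \<partial>lborel) = (\<integral>\<^sup>+t. indicator A (y + t *\<^sub>R b) \<partial>lborel)"
      using nn_integral_real_affine[of "\<lambda>t. indicator A (y + t *\<^sub>R b)" "-1" 0] by simp
    also have "\<dots> = ?m y"
      unfolding line_length_def by (rule nn_integral_indicator_line[OF A])
    finally show ?thesis .
  qed
  define f where "f y z = indicator A y * (indicator ?S z * inverse (?m z))" for y z
  have ms: "(\<lambda>(x, y). f x y) \<in> borel_measurable (borel \<Otimes>\<^sub>M borel)"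
    unfolding f_def by measurable
  have inv: "inverse (?m y) * ?m y = indicator {y. 0 < ?m y} y" for y
  proof (cases "?m y = 0")
    case False
    have "inverse (?m y) * ?m y = ?m y / ?m y" by (simp add: divide_ennreal_def mult.commute)
    then show ?thesis using False fin[of y] by (simp add: ennreal_divide_self zero_less_iff_neq_zero)
  qed simp
  have 1: "(\<integral>\<^sup>+t. f y (y + t *\<^sub>R b) \<partial>lborel) = indicator (A \<inter> {y. 0 < ?m y}) y" for y
  proof -
    have "(\<integral>\<^sup>+t. f y (y + t *\<^sub>R b) \<partial>lborel) = (\<integral>\<^sup>+t. (indicator A y * inverse (?m y)) * indicator ?S (y + t *\<^sub>R b) \<partial>lborel)"
      unfolding f_def line_length_shift[OF A] by (intro nn_integral_cong) (simp add: ac_simps)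
    also have "\<dots> = (indicator A y * inverse (?m y)) * ?m y"
      by (subst nn_integral_cmult) (auto simp: Sline)
    also have "\<dots> = indicator (A \<inter> {y. 0 < ?m y}) y"
      unfolding mult.assoc inv by (auto simp: indicator_def)
    finally show ?thesis .
  qed
  have 2: "(\<integral>\<^sup>+t. f (y - t *\<^sub>R b) y \<partial>lborel) = indicator ?S y" for y
  proof -
    have "(\<integral>\<^sup>+t. f (y - t *\<^sub>R b) y \<partial>lborel) = (\<integral>\<^sup>+t. indicator A (y - t *\<^sub>R b) * (indicator ?S y * inverse (?m y)) \<partial>lborel)"
      unfolding f_def ..
    also have "\<dots> = ?m y * (indicator ?S y * inverse (?m y))"
      by (subst nn_integral_multc) (auto simp: Aline)
    also have "\<dots> = indicator ?S y * (inverse (?m y) * ?m y)" by (simp add: ac_simps)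
    also have "\<dots> = indicator ?S y" unfolding inv
      by (auto simp: indicator_def steiner_def intro: le_less_trans[OF zero_le])
    finally show ?thesis .
  qed
  have "emeasure lborel ?S = (\<integral>\<^sup>+y. \<integral>\<^sup>+t. f (y - t *\<^sub>R b) y \<partial>lborel \<partial>lborel)"
    unfolding 2 by simp
  also have "\<dots> = (\<integral>\<^sup>+y. \<integral>\<^sup>+t. f y (y + t *\<^sub>R b) \<partial>lborel \<partial>lborel)"
    by (rule nn_integral_line_transport[OF ms, symmetric])
  also have "\<dots> = emeasure lborel (A \<inter> {y. 0 < ?m y})"
    unfolding 1 by (subst nn_integral_indicator) auto
  also have "\<dots> = emeasure lborel A"
  proof -
    let ?E = "A \<inter> {y. ?m y = 0}"
    have "emeasure lborel ?E = 0"
    proof (rule line_null_imp_null[where v=b])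
      show "?E \<in> sets borel" by measurable
      fix y :: 'a
      show "emeasure lborel {t. y + t *\<^sub>R b \<in> ?E} = 0"
      proof (cases "?m y = 0")
        case True
        have "{t. y + t *\<^sub>R b \<in> ?E} = {t. y + t *\<^sub>R b \<in> A}"
          using True by (auto simp: line_length_shift[OF A])
        then show ?thesis using True by (simp add: line_length_def)
      next
        case False
        then have "{t. y + t *\<^sub>R b \<in> ?E} = {}" by (auto simp: line_length_shift[OF A])
        then show ?thesis by (simp only: emeasure_empty)
      qed
    qed
    moreover have "A = (A \<inter> {y. 0 < ?m y}) \<union> ?E" by (auto simp: zero_less_iff_neq_zero)
    moreover have "emeasure lborel ((A \<inter> {y. 0 < ?m y}) \<union> ?E) = emeasure lborel (A \<inter> {y. 0 < ?m y}) + emeasure lborel ?E"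
      by (rule plus_emeasure[symmetric]) auto
    ultimately show ?thesis by simp
  qed
  finally show ?thesis .
qed

lemma steiner_mirror_symmetric:
  assumes "norm b = 1" "A \<in> sets borel"
  shows "mirror_symmetric b (steiner b A)"
proof -
  have bb: "b \<bullet> b = 1" using assms by (simp add: dot_square_norm)
  have "line_length A b (reflect b x) = line_length A b x" for x
    using line_length_shift[OF assms(2), of b x "- (2 * (x \<bullet> b))"] by (simp add: reflect_def)
  moreover have "reflect b x \<bullet> b = - (x \<bullet> b)" for x by (simp add: reflect_def inner_diff_left bb)
  ultimately show ?thesis by (simp add: mirror_symmetric_def steiner_def)
qed

text \<open>A reflection in a direction orthogonal to \<open>b\<close> permutes the lines parallel
  to \<open>b\<close> and keeps the coordinate along \<open>b\<close>. Symmetries gained in earlier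
  directions therefore survive.\<close>

lemma steiner_preserves_mirror_symmetric:
  assumes "b \<bullet> c = 0" "mirror_symmetric c A"
  shows "mirror_symmetric c (steiner b A)"
proof -
  have "reflect c x + t *\<^sub>R b = reflect c (x + t *\<^sub>R b)" for x t
    using assms(1) by (simp add: reflect_def inner_add_left)
  then have "line_length A b (reflect c x) = line_length A b x" for x
    using assms(2) by (simp add: mirror_symmetric_def line_length_def)
  moreover have "reflect c x \<bullet> b = x \<bullet> b" for x
    using assms(1) by (simp add: reflect_def inner_diff_left inner_commute[of c])
  ultimately show ?thesis by (simp add: mirror_symmetric_def steiner_def)
qed

text \<open>If all distances were at most \<open>d\<close>, both \<open>Sup T - Inf U\<close> and
  \<open>Sup U - Inf T\<close> would be at most \<open>d\<close>. Their sum is the total length of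
  the hulls of \<open>T\<close> and \<open>U\<close>, which is at least
  \<open>r + s\<close>.\<close>

lemma spread_two_sets:
  fixes T U :: "real set"
  assumes T: "ennreal r \<le> emeasure lborel T" "r > 0" and U: "ennreal s \<le> emeasure lborel U" "s > 0"
    and d: "2 * d < r + s"
  shows "\<exists>t\<in>T. \<exists>u\<in>U. d < \<bar>t - u\<bar>"
proof (rule ccontr)
  assume "\<not> ?thesis"
  then have le: "\<bar>t - u\<bar> \<le> d" if "t \<in> T" "u \<in> U" for t u using that by (auto simp: not_less)
  have ne: "T \<noteq> {}" "U \<noteq> {}" using T U by auto
  then obtain t0 u0 where tu: "t0 \<in> T" "u0 \<in> U" by auto
  have bT: "bdd_above T" "bdd_below T" and bU: "bdd_above U" "bdd_below U"
  proof -
    have "t \<in> {u0 - d..u0 + d}" if "t \<in> T" for t using le[OF that tu(2)] by (simp add: abs_le_iff)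
    then show "bdd_above T" "bdd_below T" by (meson bdd_above_Icc bdd_below_Icc bdd_above_mono bdd_below_mono subsetI)+
    have "u \<in> {t0 - d..t0 + d}" if "u \<in> U" for u using le[OF tu(1) that] by (simp add: abs_le_iff)
    then show "bdd_above U" "bdd_below U" by (meson bdd_above_Icc bdd_below_Icc bdd_above_mono bdd_below_mono subsetI)+
  qed
  have len: "q \<le> Sup V - Inf V" if "ennreal q \<le> emeasure lborel V" "q > 0" "bdd_above V" "bdd_below V" "V \<noteq> {}" for q and V :: "real set"
  proof -
    have sub: "V \<subseteq> {Inf V..Sup V}" using that by (auto intro: cInf_lower cSup_upper)
    have "Inf V \<le> Sup V" using that by (meson cInf_le_cSup)
    then have "emeasure lborel V \<le> ennreal (Sup V - Inf V)"
      using emeasure_mono[OF sub, of lborel] by simp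
    then have "ennreal q \<le> ennreal (Sup V - Inf V)" using that(1) by (rule order_trans[rotated])
    then show ?thesis using \<open>Inf V \<le> Sup V\<close> by (subst (asm) ennreal_le_iff) auto
  qed
  have le': "t \<le> d + u" "u \<le> d + t" if "t \<in> T" "u \<in> U" for t u
    using le[OF that] by (simp_all add: abs_le_iff)
  have "Sup T \<le> d + u" if "u \<in> U" for u by (intro cSup_least ne le' that)
  then have "Sup T - d \<le> Inf U" by (intro cInf_greatest ne) (simp add: diff_le_eq add.commute)
  moreover have "Sup U \<le> d + t" if "t \<in> T" for t by (intro cSup_least ne le' that)
  then have "Sup U - d \<le> Inf T" by (intro cInf_greatest ne) (simp add: diff_le_eq add.commute)
  ultimately show False using len[OF T bT ne(1)] len[OF U bU ne(2)] d by linarith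
qed

text \<open>The lines through \<open>x\<close> and \<open>y\<close> contain two points of
  \<open>A\<close> whose coordinates along \<open>b\<close> differ at least as much as those of
  \<open>x\<close> and \<open>y\<close>, while the orthogonal components are unchanged.\<close>

lemma steiner_dist_le:
  assumes A: "A \<in> sets borel" and b: "norm b = 1" and D: "\<And>x y. x \<in> A \<Longrightarrow> y \<in> A \<Longrightarrow> dist x y \<le> D"
    and bd: "bounded A" and xy: "x \<in> steiner b A" "y \<in> steiner b A"
  shows "dist x y \<le> D"
proof -
  have bb: "b \<bullet> b = 1" using b by (simp add: dot_square_norm)
  obtain r where r: "line_length A b x = ennreal r" "r \<ge> 0"
    using line_length_finite[OF bd b, of x] by (cases "line_length A b x") auto
  obtain s where s: "line_length A b y = ennreal s" "s \<ge> 0"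
    using line_length_finite[OF bd b, of y] by (cases "line_length A b y") auto
  have xr: "2 * \<bar>x \<bullet> b\<bar> < r" and ys: "2 * \<bar>y \<bullet> b\<bar> < s"
    using xy r s by (auto simp: steiner_def ennreal_less_iff)
  let ?a = "x \<bullet> b" and ?c = "y \<bullet> b"
  define T where "T = {t. x + t *\<^sub>R b \<in> A}"
  define U where "U = {t. y + t *\<^sub>R b \<in> A}"
  have shift: "emeasure lborel ((+) c ` V) = emeasure lborel V" if "V \<in> sets borel" for c and V :: "real set"
  proof -
    have "(+) c ` V = (\<lambda>x. - c + x) -` V" by (auto simp: image_iff algebra_simps) (metis add.commute add_diff_cancel_left' diff_add_cancel)
    moreover have "emeasure lborel V = emeasure (distr lborel borel ((+) (- c))) V"
      by (simp add: lborel_distr_plus)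
    moreover have "\<dots> = emeasure lborel ((\<lambda>x. - c + x) -` V)"
      using that by (subst emeasure_distr) auto
    ultimately show ?thesis by simp
  qed
  have [measurable]: "T \<in> sets borel" "U \<in> sets borel"
    unfolding T_def U_def using A by measurable
  \<comment> \<open>The parameters are shifted to become actual coordinates along \<open>b\<close>.
    The section lengths exceed \<open>2 * \<bar>x \<bullet> b\<bar>\<close> and
    \<open>2 * \<bar>y \<bullet> b\<bar>\<close>, which is the bound that
    \<open>spread_two_sets\<close> requires.\<close>
  have "\<exists>t\<in>(+) ?a ` T. \<exists>u\<in>(+) ?c ` U. \<bar>?a - ?c\<bar> < \<bar>t - u\<bar>"
  proof (rule spread_two_sets[where r=r and s=s])
    show "ennreal r \<le> emeasure lborel ((+) ?a ` T)" "ennreal s \<le> emeasure lborel ((+) ?c ` U)"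
      using r s by (simp_all add: shift line_length_def T_def[symmetric] U_def[symmetric])
    show "0 < r" using xr by linarith
    show "0 < s" using ys by linarith
    have "\<bar>?a - ?c\<bar> \<le> \<bar>?a\<bar> + \<bar>?c\<bar>" by (rule abs_triangle_ineq4)
    then have "2 * \<bar>?a - ?c\<bar> \<le> 2 * \<bar>?a\<bar> + 2 * \<bar>?c\<bar>" by simp
    then show "2 * \<bar>?a - ?c\<bar> < r + s" using add_strict_mono[OF xr ys] by (rule le_less_trans)
  qed
  then obtain t u where tu: "x + t *\<^sub>R b \<in> A" "y + u *\<^sub>R b \<in> A" and less: "\<bar>?a - ?c\<bar> < \<bar>(?a + t) - (?c + u)\<bar>"
    by (auto simp: T_def U_def)
  have "(?a - ?c)\<^sup>2 \<le> ((?a - ?c) + (t - u))\<^sup>2"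
    using less by (intro abs_le_square_iff[THEN iffD1]) (simp add: algebra_simps)
  then have pos: "0 \<le> 2 * (?a - ?c) * (t - u) + (t - u)\<^sup>2" by (simp add: power2_sum)
  have "(dist x y)\<^sup>2 \<le> (dist (x + t *\<^sub>R b) (y + u *\<^sub>R b))\<^sup>2"
  proof -
    have e: "x + t *\<^sub>R b - (y + u *\<^sub>R b) = (x - y) + (t - u) *\<^sub>R b" by (simp add: algebra_simps)
    show ?thesis unfolding dist_norm e power2_norm_eq_inner
      using pos by (simp add: inner_add_left inner_add_right inner_diff_left inner_commute bb power2_eq_square algebra_simps)
  qed
  then have "dist x y \<le> dist (x + t *\<^sub>R b) (y + u *\<^sub>R b)" by (rule power2_le_imp_le) simp
  also have "\<dots> \<le> D" by (rule D[OF tu])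
  finally show ?thesis .
qed

lemma bounded_if_dist_le:
  assumes "\<And>x y. x \<in> A \<Longrightarrow> y \<in> A \<Longrightarrow> dist x y \<le> D" shows "bounded A"
proof (cases "A = {}")
  case False
  then obtain a where "a \<in> A" by auto
  then show ?thesis using assms unfolding bounded_def by blast
qed simp

lemma steiner_symmetrization:
  fixes A :: "'a::euclidean_space set"
  assumes A: "A \<in> sets borel" and D: "\<And>x y. x \<in> A \<Longrightarrow> y \<in> A \<Longrightarrow> dist x y \<le> D"
    and B: "finite B" "B \<subseteq> (Basis :: 'a set)"
  shows "\<exists>S\<in>sets borel. emeasure lborel S = emeasure lborel A \<and> (\<forall>x\<in>S. \<forall>y\<in>S. dist x y \<le> D) \<and>
     (\<forall>c\<in>B. mirror_symmetric c S)"
  using B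
proof (induction rule: finite_induct)
  case empty
  show ?case by (rule bexI[OF _ A]) (use D in auto)
next
  case (insert b B)
  then obtain S where S: "S \<in> sets borel" "emeasure lborel S = emeasure lborel A"
    "\<forall>x\<in>S. \<forall>y\<in>S. dist x y \<le> D" "\<forall>c\<in>B. mirror_symmetric c S" by auto
  have b: "norm b = 1" using insert.prems by auto
  have bd: "bounded S" using bounded_if_dist_le S(3) by blast
  have "mirror_symmetric c (steiner b S)" if "c \<in> insert b B" for c
  proof (cases "c = b")
    case True
    then show ?thesis using steiner_mirror_symmetric[OF b S(1)] by simp
  next
    case False
    then have "c \<in> B" "b \<bullet> c = 0" using that insert.prems by (auto simp: inner_Basis)
    then show ?thesis using steiner_preserves_mirror_symmetric S(4) by blast
  qed
  moreover have "\<forall>x\<in>steiner b S. \<forall>y\<in>steiner b S. dist x y \<le> D"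
    using steiner_dist_le[OF S(1) b _ bd] S(3) by blast
  moreover have "emeasure lborel (steiner b S) = emeasure lborel A"
    using steiner_emeasure[OF S(1) bd b] S(2) by simp
  ultimately show ?case using steiner_measurable[OF S(1)] by blast
qed

text \<open>Symmetrization in all coordinate directions makes the set invariant under
  \<open>x \<mapsto> - x\<close>. Then the distance from \<open>x\<close> to \<open>- x\<close>
  bounds \<open>2 * norm x\<close> by \<open>D\<close>, so the set lies in the ball of radius
  \<open>D / 2\<close>.\<close>

lemma isodiametric:
  fixes A :: "'a::euclidean_space set"
  assumes A: "A \<in> sets borel" and D: "\<And>x y. x \<in> A \<Longrightarrow> y \<in> A \<Longrightarrow> dist x y \<le> D" and "0 \<le> D"
  shows "emeasure lborel A \<le> ennreal (unit_ball_vol (real DIM('a)) * (D / 2) ^ DIM('a))"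
proof -
  obtain S where S: "S \<in> sets borel" "emeasure lborel S = emeasure lborel A"
    "\<forall>x\<in>S. \<forall>y\<in>S. dist x y \<le> D" "\<forall>c\<in>(Basis::'a set). mirror_symmetric c S"
    using steiner_symmetrization[OF A D finite_Basis subset_refl] by auto
  \<comment> \<open>The basis reflections are applied one at a time, each changing the sign of one
    coordinate; all of them together give \<open>- x\<close>.\<close>
  have partial: "x - (\<Sum>c\<in>B. (2 * (x \<bullet> c)) *\<^sub>R c) \<in> S" if "x \<in> S" "finite B" "B \<subseteq> Basis" for x B
    using that(2,3)
  proof (induction rule: finite_induct)
    case empty
    then show ?case using that(1) by simp
  next
    case (insert b B)
    let ?y = "x - (\<Sum>c\<in>B. (2 * (x \<bullet> c)) *\<^sub>R c)"
    have "(\<Sum>c\<in>B. (2 * (x \<bullet> c)) *\<^sub>R c) \<bullet> b = 0"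
      unfolding inner_sum_left
    proof (intro sum.neutral ballI)
      fix c assume "c \<in> B"
      then have "c \<noteq> b" "c \<in> Basis" "b \<in> Basis" using insert by auto
      then show "((2 * (x \<bullet> c)) *\<^sub>R c) \<bullet> b = 0" by (simp add: inner_not_same_Basis)
    qed
    then have "reflect b ?y = x - (\<Sum>c\<in>insert b B. (2 * (x \<bullet> c)) *\<^sub>R c)"
      using insert by (simp add: reflect_def inner_diff_left)
    moreover have "reflect b ?y \<in> S" using insert S(4) by (auto simp: mirror_symmetric_def)
    ultimately show ?case by simp
  qed
  have "S \<subseteq> cball 0 (D / 2)"
  proof
    fix x assume x: "x \<in> S"
    have "(\<Sum>c\<in>Basis. (2 * (x \<bullet> c)) *\<^sub>R c) = 2 *\<^sub>R (\<Sum>c\<in>Basis. (x \<bullet> c) *\<^sub>R c)"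
      by (simp add: scaleR_sum_right)
    then have "x - (\<Sum>c\<in>Basis. (2 * (x \<bullet> c)) *\<^sub>R c) = - x"
      by (simp add: euclidean_representation scaleR_2)
    then have "- x \<in> S" using partial[OF x finite_Basis subset_refl] by simp
    then have "dist x (- x) \<le> D" using S(3) x by blast
    moreover have "dist x (- x) = 2 * norm x"
      by (simp add: dist_norm flip: scaleR_2)
    ultimately show "x \<in> cball 0 (D / 2)" by simp
  qed
  then have "emeasure lborel S \<le> emeasure lborel (cball (0::'a) (D / 2))" by (intro emeasure_mono) auto
  also have "\<dots> = ennreal (unit_ball_vol (real DIM('a)) * (D / 2) ^ DIM('a))"
    using \<open>0 \<le> D\<close> by (intro emeasure_cball) auto
  finally show ?thesis using S(2) by simp
qed

text \<open>The sets of a Hausdorff cover are arbitrary; the closure makes them measurable without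
  changing the diameter.\<close>

lemma isodiametric_closure:
  fixes A :: "'a::euclidean_space set"
  assumes "bounded A"
  shows "emeasure lborel (closure A) \<le> hausdorff_gauge DIM('a) A"
proof (cases "A = {}")
  case False
  have "emeasure lborel (closure A) \<le> ennreal (unit_ball_vol (real DIM('a)) * (diameter (closure A) / 2) ^ DIM('a))"
    by (intro isodiametric diameter_bounded_bound bounded_closure assms diameter_ge_0) auto
  then show ?thesis using False by (simp add: hausdorff_gauge_def diameter_closure[OF assms])
qed simp

section \<open>Lipschitz images\<close>

text \<open>The lower bound for Hausdorff measure uses the sharp constant of the isodiametric inequality,
  the upper bound the Vitali covering theorem.\<close>

lemma lborel_Lipschitz_image_le_hausdorff:
  fixes f :: "'b::metric_space \<Rightarrow> 'a::euclidean_space"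
  assumes lip: "\<And>x y. x \<in> X \<Longrightarrow> y \<in> X \<Longrightarrow> dist (f x) (f y) \<le> K * dist x y" and K: "0 \<le> K"
    and meas: "f ` X \<in> sets borel"
  shows "emeasure lborel (f ` X) \<le> ennreal (K ^ DIM('a)) * hausdorff_outer DIM('a) X"
proof -
  let ?n = "DIM('a)"
  have "emeasure lborel (f ` X) \<le> (\<Sum>i. ennreal (K ^ ?n) * hausdorff_gauge ?n (A i))"
    if A: "\<forall>i::nat. bounded (A i) \<and> diameter (A i) \<le> 1" "X \<subseteq> (\<Union>i. A i)" for A
  proof -
    define E where "E i = f ` (A i \<inter> X)" for i
    have dE: "dist u v \<le> K * diameter (A i)" if uv: "u \<in> E i" "v \<in> E i" for u v i
    proof -
      obtain x y where xy: "x \<in> A i \<inter> X" "y \<in> A i \<inter> X" "u = f x" "v = f y" using uv by (auto simp: E_def)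
      have "dist u v \<le> K * dist x y" using lip xy by auto
      also have "\<dots> \<le> K * diameter (A i)"
        using xy A(1) by (intro mult_left_mono[OF _ K] diameter_bounded_bound) auto
      finally show ?thesis .
    qed
    have bE: "bounded (E i)" for i using dE by (rule bounded_if_dist_le)
    have gE: "hausdorff_gauge ?n (E i) \<le> ennreal (K ^ ?n) * hausdorff_gauge ?n (A i)" for i
    proof (cases "E i = {}")
      case False
      then have ne: "A i \<noteq> {}" by (auto simp: E_def)
      have d0: "0 \<le> diameter (E i)" "0 \<le> diameter (A i)" using bE A(1) by (auto intro: diameter_ge_0)
      have "diameter (E i) \<le> K * diameter (A i)"
        using dE False by (intro diameter_le) (auto simp: dist_norm)
      then have "unit_ball_vol ?n * (diameter (E i) / 2) ^ ?n \<le> unit_ball_vol ?n * (K * diameter (A i) / 2) ^ ?n"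
        using d0 by (intro mult_left_mono power_mono) auto
      also have "\<dots> = K ^ ?n * (unit_ball_vol ?n * (diameter (A i) / 2) ^ ?n)"
        by (simp add: power_mult_distrib power_divide)
      finally have "ennreal (unit_ball_vol ?n * (diameter (E i) / 2) ^ ?n)
          \<le> ennreal (K ^ ?n) * ennreal (unit_ball_vol ?n * (diameter (A i) / 2) ^ ?n)"
        using K d0 by (subst ennreal_mult[symmetric]) (auto intro: ennreal_leI)
      then show ?thesis using False ne by (simp add: hausdorff_gauge_def)
    qed simp
    have "f ` X \<subseteq> (\<Union>i. closure (E i))"
    proof
      fix z assume "z \<in> f ` X"
      then obtain x where x: "x \<in> X" "z = f x" by auto
      then obtain i where "x \<in> A i" using A(2) by blast
      then have "z \<in> E i" using x by (auto simp: E_def)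
      then show "z \<in> (\<Union>i. closure (E i))" using closure_subset by blast
    qed
    then have "emeasure lborel (f ` X) \<le> emeasure lborel (\<Union>i. closure (E i))"
      by (intro emeasure_mono) auto
    also have "\<dots> \<le> (\<Sum>i. emeasure lborel (closure (E i)))"
      by (intro emeasure_subadditive_countably) auto
    also have "\<dots> \<le> (\<Sum>i. ennreal (K ^ ?n) * hausdorff_gauge ?n (A i))"
      by (intro suminf_le summableI order_trans[OF isodiametric_closure[OF bE] gE])
    finally show ?thesis .
  qed
  then have cover: "emeasure lborel (f ` X) \<le> ennreal (K ^ ?n) * (\<Sum>i. hausdorff_gauge ?n (A i))"
    if "\<forall>i::nat. bounded (A i) \<and> diameter (A i) \<le> 1" "X \<subseteq> (\<Union>i. A i)" for A
    using that by simp
  have "emeasure lborel (f ` X) \<le> ennreal (K ^ ?n) * hausdorff_content ?n 1 X"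
  proof (cases "K ^ ?n = 0")
    \<comment> \<open>Here \<open>f\<close> is constant on \<open>X\<close>, so its image has
      measure 0; in the other case the inequality is divided by \<open>K ^ n\<close>.\<close>
    case True
    let ?P = "{A :: nat \<Rightarrow> 'b set. (\<forall>i. bounded (A i) \<and> diameter (A i) \<le> 1) \<and> X \<subseteq> (\<Union>i. A i)}"
    have K0: "K = 0" using True by simp
    have "f ` X = {} \<or> (\<exists>z. f ` X = {z})"
    proof (cases "X = {}")
      case False
      then obtain x0 where "x0 \<in> X" by auto
      have "f x = f x0" if "x \<in> X" for x using lip[OF that \<open>x0 \<in> X\<close>] K0 by simp
      then have "f ` X \<subseteq> {f x0}" by blast
      then have "f ` X = {f x0}" using \<open>x0 \<in> X\<close> by blast
      then show ?thesis by blast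
    qed simp
    then show ?thesis by auto
  next
    case False
    then have K': "0 < K ^ ?n" using K by simp
    let ?c = "ennreal (K ^ ?n)" and ?L = "emeasure lborel (f ` X)"
    have c: "?c \<noteq> 0" using K' by (metis ennreal_eq_0_iff not_le)
    have c': "?c < top" by simp
    have "?L / ?c \<le> hausdorff_content ?n 1 X"
      unfolding hausdorff_content_def
      by (intro INF_greatest divide_le_posI_ennreal) (use c c' cover in \<open>auto simp: zero_less_iff_neq_zero\<close>)
    then have "?L / ?c * ?c \<le> hausdorff_content ?n 1 X * ?c" by (rule mult_right_mono) simp
    moreover have "?L / ?c * ?c = ?L" using c c' by (simp add: ennreal_divide_times ennreal_divide_self)
    ultimately show ?thesis by (simp add: mult.commute)
  qed
  also have "\<dots> \<le> ennreal (K ^ ?n) * hausdorff_outer ?n X"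
    by (intro mult_left_mono hausdorff_content_le_outer) auto
  finally show ?thesis .
qed

lemma hausdorff_content_Un:
  assumes "\<delta> > 0"
  shows "hausdorff_content n \<delta> (X \<union> Y) \<le> hausdorff_content n \<delta> X + hausdorff_content n \<delta> Y"
proof -
  let ?A = "\<lambda>i::nat. if i = 0 then X else if i = 1 then Y else {}"
  have "(\<Union>i. ?A i) = X \<union> Y" by (auto split: if_splits)
  then have "hausdorff_content n \<delta> (X \<union> Y) \<le> (\<Sum>i. hausdorff_content n \<delta> (?A i))"
    using hausdorff_content_Union[of n \<delta> ?A] by simp
  also have "\<dots> = (\<Sum>i\<in>{0,1::nat}. hausdorff_content n \<delta> (?A i))"
    by (rule suminf_finite) (auto simp: hausdorff_content_empty[OF assms])
  finally show ?thesis by simp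
qed

text \<open>The images of the balls enlarged by \<open>c\<close> form the cover, while the original
  balls are disjoint inside \<open>U\<close>; the gauges thus sum to at most a multiple of the
  volume of \<open>U\<close>. Applied with \<open>c = 1\<close> to a Vitali covering up to a null
  set and with \<open>c = 5\<close> to the null set left over.\<close>

lemma hausdorff_content_image_disjoint_balls:
  fixes f :: "'a::euclidean_space \<Rightarrow> 'b::metric_space" and a :: "'i \<Rightarrow> 'a"
  assumes lip: "\<And>x y. x \<in> B \<Longrightarrow> y \<in> B \<Longrightarrow> dist (f x) (f y) \<le> K * dist x y" and K: "0 \<le> K" and c: "0 < c"
    and C: "countable C" "pairwise (\<lambda>i j. disjnt (cball (a i) (r i)) (cball (a j) (r j))) C"
    and r: "\<And>i. i \<in> C \<Longrightarrow> 0 < r i" "\<And>i. i \<in> C \<Longrightarrow> 2 * c * K * r i \<le> \<delta>"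
    and U: "\<And>i. i \<in> C \<Longrightarrow> cball (a i) (r i) \<subseteq> U" "U \<in> sets borel" and "0 < \<delta>"
  shows "hausdorff_content DIM('a) \<delta> (f ` (B \<inter> (\<Union>i\<in>C. cball (a i) (c * r i))))
     \<le> ennreal ((c * K) ^ DIM('a)) * emeasure lborel U"
proof -
  let ?n = "DIM('a)"
  define J where "J = to_nat_on C ` C"
  define g where "g = from_nat_into C"
  define A where "A n = (if n \<in> J then f ` (B \<inter> cball (a (g n)) (c * r (g n))) else {})" for n
  define D where "D n = (if n \<in> J then cball (a (g n)) (r (g n)) else {})" for n
  have g: "g n \<in> C" if "n \<in> J" for n using that C(1) by (auto simp: J_def g_def)
  have g_inj: "n = m" if "n \<in> J" "m \<in> J" "g n = g m" for n m
    using that C(1) by (auto simp: J_def g_def)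
  have dA: "dist u v \<le> 2 * c * K * r (g n)" if n: "n \<in> J" and uv: "u \<in> A n" "v \<in> A n" for u v n
  proof -
    obtain x y where xy: "x \<in> B" "y \<in> B" "dist (a (g n)) x \<le> c * r (g n)" "dist (a (g n)) y \<le> c * r (g n)" "u = f x" "v = f y"
      using uv n by (auto simp: A_def)
    have "dist u v \<le> K * dist x y" using lip xy by auto
    also have "\<dots> \<le> K * (2 * (c * r (g n)))"
      using xy(3,4) dist_triangle3[of x y "a (g n)"] by (intro mult_left_mono[OF _ K]) linarith
    finally show ?thesis by (simp add: mult_ac)
  qed
  have bA: "bounded (A n) \<and> diameter (A n) \<le> \<delta>" for n
  proof (cases "n \<in> J")
    case True
    have "diameter (A n) \<le> \<delta>"
    proof (cases "A n = {}")
      case False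
      then show ?thesis unfolding diameter_def
        using dA[OF True] r(2)[OF g[OF True]] by (auto intro!: cSUP_least intro: order_trans)
    qed (use \<open>0 < \<delta>\<close> in simp)
    then show ?thesis using bounded_if_dist_le[OF dA[OF True]] by blast
  next
    case False
    then show ?thesis using \<open>0 < \<delta>\<close> by (simp add: A_def)
  qed
  have gA: "hausdorff_gauge ?n (A n) \<le> ennreal ((c * K) ^ ?n) * emeasure lborel (D n)" for n
  proof (cases "A n = {}")
    case False
    then have n: "n \<in> J" by (auto simp: A_def)
    have r0: "0 \<le> r (g n)" using r(1)[OF g[OF n]] by simp
    have "diameter (A n) \<le> 2 * c * K * r (g n)"
      using False unfolding diameter_def by (auto intro!: cSUP_least dA[OF n])
    moreover have "0 \<le> diameter (A n)" using bA by (auto intro: diameter_ge_0)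
    ultimately have "unit_ball_vol ?n * (diameter (A n) / 2) ^ ?n \<le> unit_ball_vol ?n * (2 * c * K * r (g n) / 2) ^ ?n"
      by (intro mult_left_mono power_mono) auto
    also have "\<dots> = (c * K) ^ ?n * (unit_ball_vol ?n * r (g n) ^ ?n)"
      by (simp add: power_mult_distrib)
    finally have "ennreal (unit_ball_vol ?n * (diameter (A n) / 2) ^ ?n)
        \<le> ennreal ((c * K) ^ ?n) * ennreal (unit_ball_vol ?n * r (g n) ^ ?n)"
      using K c r0 by (subst ennreal_mult[symmetric]) (auto intro: ennreal_leI)
    then show ?thesis using False n r0 by (simp add: hausdorff_gauge_def D_def emeasure_cball)
  qed simp
  have "f ` (B \<inter> (\<Union>i\<in>C. cball (a i) (c * r i))) \<subseteq> (\<Union>n. A n)"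
  proof
    fix z assume "z \<in> f ` (B \<inter> (\<Union>i\<in>C. cball (a i) (c * r i)))"
    then obtain x i where x: "x \<in> B" "z = f x" "i \<in> C" "x \<in> cball (a i) (c * r i)" by auto
    have "to_nat_on C i \<in> J" "g (to_nat_on C i) = i" using x(3) C(1) by (auto simp: J_def g_def)
    then have "z \<in> A (to_nat_on C i)" using x by (auto simp: A_def)
    then show "z \<in> (\<Union>n. A n)" by blast
  qed
  then have "hausdorff_content ?n \<delta> (f ` (B \<inter> (\<Union>i\<in>C. cball (a i) (c * r i)))) \<le> (\<Sum>n. hausdorff_gauge ?n (A n))"
    using bA by (intro hausdorff_content_le) auto
  also have "\<dots> \<le> (\<Sum>n. ennreal ((c * K) ^ ?n) * emeasure lborel (D n))"
    by (intro suminf_le summableI gA)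
  also have "\<dots> = ennreal ((c * K) ^ ?n) * emeasure lborel (\<Union>n. D n)"
  proof -
    have "disjoint_family D"
      unfolding disjoint_family_on_def
    proof (intro ballI impI)
      fix n m :: nat assume "n \<noteq> m"
      show "D n \<inter> D m = {}"
      proof (cases "n \<in> J \<and> m \<in> J")
        case True
        then have "g n \<noteq> g m" using g_inj \<open>n \<noteq> m\<close> by blast
        then show ?thesis using C(2) g True by (auto simp: pairwise_def disjnt_def D_def)
      qed (auto simp: D_def)
    qed
    moreover have "range D \<subseteq> sets lborel" by (auto simp: D_def)
    ultimately show ?thesis by (simp add: suminf_emeasure)
  qed
  also have "\<dots> \<le> ennreal ((c * K) ^ ?n) * emeasure lborel U"
    using U g by (intro mult_left_mono emeasure_mono) (auto simp: D_def split: if_splits)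
  finally show ?thesis .
qed

text \<open>Disjoint small balls in an open set slightly larger than \<open>B\<close> cover
  \<open>B\<close> up to a null set \<open>N\<close>, with the sharp constant. \<open>N\<close> is
  covered by fivefold enlargements of disjoint balls in an open set of measure at most
  \<open>e\<close>, so the factor 5 only multiplies \<open>e\<close>.\<close>

lemma hausdorff_Lipschitz_image_le_lborel:
  fixes f :: "'a::euclidean_space \<Rightarrow> 'b::metric_space"
  assumes lip: "\<And>x y. x \<in> B \<Longrightarrow> y \<in> B \<Longrightarrow> dist (f x) (f y) \<le> K * dist x y" and K: "0 \<le> K"
    and B[measurable]: "B \<in> sets borel" and fin: "emeasure lborel B < top"
  shows "hausdorff_outer DIM('a) (f ` B) \<le> ennreal (K ^ DIM('a)) * emeasure lborel B"
proof (rule hausdorff_outer_leI)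
  fix \<delta> :: real assume \<delta>: "\<delta> > 0"
  let ?n = "DIM('a)"
  \<comment> \<open>Images of balls enlarged by \<open>c \<le> 5\<close> have diameter at most
    \<open>2 * c * K * r\<close>, hence the 10; \<open>K + 1\<close> keeps the denominator positive
    when \<open>K = 0\<close>.\<close>
  define r0 where "r0 = \<delta> / (10 * (K + 1))"
  have r0: "r0 > 0" using \<delta> K by (simp add: r0_def)
  have r0': "2 * c * K * r \<le> \<delta>" if "r < r0" "0 < r" "c \<le> 5" "0 < c" for r c
  proof -
    have "2 * c * K * r \<le> 10 * (K + 1) * r0"
      using that K by (intro mult_mono) auto
    also have "\<dots> = \<delta>" using K by (simp add: r0_def)
    finally show ?thesis .
  qed
  show "hausdorff_content ?n \<delta> (f ` B) \<le> ennreal (K ^ ?n) * emeasure lborel B"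
  proof (rule ennreal_le_epsilon)
    fix \<epsilon> :: real assume \<epsilon>: "\<epsilon> > 0"
    \<comment> \<open>The factors that multiply \<open>e\<close> in the final estimate; the summand
      1 makes \<open>M\<close> positive when \<open>K = 0\<close>.\<close>
    define M where "M = K ^ ?n + (5 * K) ^ ?n + 1"
    have M: "M > 0" using K by (simp add: M_def add_nonneg_pos)
    define e where "e = \<epsilon> / M"
    have e: "e > 0" using \<epsilon> M by (simp add: e_def)
    obtain V where V: "open V" "B \<subseteq> V" "emeasure lborel (V - B) < ennreal e"
      using outer_regular_lborel[OF B, of e] e by auto
    have VB: "emeasure lborel V \<le> emeasure lborel B + ennreal e"
    proof -
      have "emeasure lborel V \<le> emeasure lborel B + emeasure lborel (V - B)"
        using V by (subst plus_emeasure) (auto intro!: emeasure_mono)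
      then show ?thesis using V(3) by (meson add_left_mono less_imp_le order_trans)
    qed
    let ?I = "{(x, r). x \<in> B \<and> 0 < r \<and> r < r0 \<and> cball x r \<subseteq> V}"
    have 1: "\<And>i. i \<in> ?I \<Longrightarrow> 0 < snd i" by auto
    have 2: "\<exists>i. i \<in> ?I \<and> x \<in> cball (fst i) (snd i) \<and> snd i < d" if "x \<in> B" "0 < d" for x d
    proof -
      obtain s where s: "s > 0" "cball x s \<subseteq> V" using V(1,2) \<open>x \<in> B\<close> open_contains_cball by blast
      define t where "t = min s (min (r0/2) (d/2))"
      have "t > 0" "t \<le> s" "t < r0" "t < d" using s r0 that by (auto simp: t_def)
      then have "(x, t) \<in> ?I" using s that by (auto intro: order_trans[OF subset_cball])
      then show ?thesis using \<open>t < d\<close> \<open>t > 0\<close> by (intro exI[of _ "(x, t)"]) auto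
    qed
    obtain C where C: "countable C" "C \<subseteq> ?I"
      "pairwise (\<lambda>i j. disjnt (cball (fst i) (snd i)) (cball (fst j) (snd j))) C"
      "negligible (B - (\<Union>i\<in>C. cball (fst i) (snd i)))"
      using Vitali_covering_theorem_cballs[OF 1 2] by blast
    define N where "N = B - (\<Union>i\<in>C. cball (fst i) (snd i))"
    have Nb: "N \<in> sets borel" unfolding N_def using C(1) by (intro sets.Diff B sets.countable_UN'') auto
    have N0: "emeasure lborel N = 0"
    proof -
      have "emeasure lebesgue N = 0" using C(4) by (simp add: N_def negligible_iff_null_sets null_setsD1)
      then show ?thesis using Nb by simp
    qed
    obtain W where W: "open W" "N \<subseteq> W" "emeasure lborel (W - N) < ennreal e"
      using outer_regular_lborel[OF Nb, of e] e by auto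
    have We: "emeasure lborel W \<le> ennreal e"
    proof -
      have "emeasure lborel W \<le> emeasure lborel N + emeasure lborel (W - N)"
        using W Nb by (subst plus_emeasure) (auto intro!: emeasure_mono)
      then show ?thesis using W(3) N0 by simp
    qed
    let ?I' = "{(x, r). x \<in> N \<and> 0 < r \<and> r < r0 \<and> cball x r \<subseteq> W}"
    have 3: "N \<subseteq> (\<Union>i\<in>?I'. cball (fst i) (snd i))"
    proof
      fix x assume x: "x \<in> N"
      obtain s where s: "s > 0" "cball x s \<subseteq> W" using W(1,2) x open_contains_cball by blast
      define t where "t = min s (r0/2)"
      have t: "t > 0" "t \<le> s" "t < r0" using s r0 by (auto simp: t_def)
      then have "(x, t) \<in> ?I'" using s x by (auto intro: order_trans[OF subset_cball])
      then show "x \<in> (\<Union>i\<in>?I'. cball (fst i) (snd i))" using t by (intro UN_I[of "(x, t)"]) auto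
    qed
    have 4: "\<And>i. i \<in> ?I' \<Longrightarrow> 0 < snd i \<and> snd i \<le> r0" by auto
    obtain C' where C': "countable C'" "C' \<subseteq> ?I'"
      "pairwise (\<lambda>i j. disjnt (cball (fst i) (snd i)) (cball (fst j) (snd j))) C'"
      "N \<subseteq> (\<Union>i\<in>C'. cball (fst i) (5 * snd i))"
      using Vitali_covering_lemma_cballs[OF 3 4] by blast
    let ?U1 = "B \<inter> (\<Union>i\<in>C. cball (fst i) (1 * snd i))" and ?U2 = "B \<inter> (\<Union>i\<in>C'. cball (fst i) (5 * snd i))"
    have "B \<subseteq> ?U1 \<union> ?U2" using C'(4) by (auto simp: N_def)
    then have "f ` B \<subseteq> f ` ?U1 \<union> f ` ?U2" unfolding image_Un[symmetric] by (rule image_mono)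
    then have "hausdorff_content ?n \<delta> (f ` B) \<le> hausdorff_content ?n \<delta> (f ` ?U1) + hausdorff_content ?n \<delta> (f ` ?U2)"
      by (rule order_trans[OF hausdorff_content_mono hausdorff_content_Un[OF \<delta>]])
    also have "\<dots> \<le> ennreal ((1 * K) ^ ?n) * emeasure lborel V + ennreal ((5 * K) ^ ?n) * emeasure lborel W"
    proof (rule add_mono)
      show "hausdorff_content ?n \<delta> (f ` ?U1) \<le> ennreal ((1 * K) ^ ?n) * emeasure lborel V"
      proof (rule hausdorff_content_image_disjoint_balls[OF lip K _ C(1,3)])
        fix i assume "i \<in> C"
        then have "i \<in> ?I" using C(2) by (rule subsetD[rotated])
        then have "0 < snd i" "snd i < r0" "cball (fst i) (snd i) \<subseteq> V" by (simp_all add: case_prod_beta)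
        then show "0 < snd i" "2 * 1 * K * snd i \<le> \<delta>" "cball (fst i) (snd i) \<subseteq> V"
          using r0'[of "snd i" 1] by auto
      qed (use V(1) \<delta> in auto)
      show "hausdorff_content ?n \<delta> (f ` ?U2) \<le> ennreal ((5 * K) ^ ?n) * emeasure lborel W"
      proof (rule hausdorff_content_image_disjoint_balls[OF lip K _ C'(1,3)])
        fix i assume "i \<in> C'"
        then have "i \<in> ?I'" using C'(2) by (rule subsetD[rotated])
        then have "0 < snd i" "snd i < r0" "cball (fst i) (snd i) \<subseteq> W" by (simp_all add: case_prod_beta)
        then show "0 < snd i" "2 * 5 * K * snd i \<le> \<delta>" "cball (fst i) (snd i) \<subseteq> W"
          using r0'[of "snd i" 5] by auto
      qed (use W(1) \<delta> in auto)
    qed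
    also have "\<dots> \<le> ennreal (K ^ ?n) * (emeasure lborel B + ennreal e) + ennreal ((5 * K) ^ ?n) * ennreal e"
      unfolding mult_1 by (rule add_mono[OF mult_left_mono[OF VB] mult_left_mono[OF We]]) simp_all
    also have "\<dots> = ennreal (K ^ ?n) * emeasure lborel B + ennreal (K ^ ?n * e + (5 * K) ^ ?n * e)"
      using K e by (simp add: distrib_left ennreal_mult ennreal_plus add.assoc)
    also have "\<dots> \<le> ennreal (K ^ ?n) * emeasure lborel B + ennreal \<epsilon>"
    proof (intro add_left_mono ennreal_leI)
      have "K ^ ?n * e + (5 * K) ^ ?n * e \<le> M * e" using e by (simp add: M_def algebra_simps)
      also have "\<dots> = \<epsilon>" using M by (simp add: e_def)
      finally show "K ^ ?n * e + (5 * K) ^ ?n * e \<le> \<epsilon>" .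
    qed
    finally show "hausdorff_content ?n \<delta> (f ` B) \<le> ennreal (K ^ ?n) * emeasure lborel B + ennreal \<epsilon>" .
  qed
qed

section \<open>Flow strips over a hyperplane\<close>

text \<open>For a bijection \<open>\<beta>\<close> of the bases this is a linear isometry between
  two Euclidean types of equal dimension, such as a hyperplane times \<open>real\<close> and
  \<open>real^'d\<close>.\<close>

definition basis_map :: "('b \<Rightarrow> 'a) \<Rightarrow> 'b::euclidean_space \<Rightarrow> 'a::euclidean_space" where
  "basis_map \<beta> u = (\<Sum>b\<in>Basis. (u \<bullet> b) *\<^sub>R \<beta> b)"

lemma linear_basis_map: "linear (basis_map \<beta>)"
proof (rule linearI)
  show "basis_map \<beta> (x + y) = basis_map \<beta> x + basis_map \<beta> y" for x y
    by (simp add: basis_map_def inner_add_left scaleR_add_left sum.distrib)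
  show "basis_map \<beta> (c *\<^sub>R x) = c *\<^sub>R basis_map \<beta> x" for c x
    by (simp add: basis_map_def scaleR_sum_right)
qed

context
  fixes \<beta> :: "'b::euclidean_space \<Rightarrow> 'a::euclidean_space"
  assumes \<beta>: "bij_betw \<beta> Basis Basis"
begin

lemma basis_map_inner:
  assumes "b \<in> Basis" shows "basis_map \<beta> u \<bullet> \<beta> b = u \<bullet> b"
proof -
  have "basis_map \<beta> u \<bullet> \<beta> b = (\<Sum>c\<in>Basis. (u \<bullet> c) * (\<beta> c \<bullet> \<beta> b))"
    by (simp add: basis_map_def inner_sum_left)
  also have "\<dots> = (\<Sum>c\<in>Basis. if c = b then u \<bullet> c else 0)"
  proof (rule sum.cong)
    fix c :: 'b assume c: "c \<in> Basis"
    have "\<beta> c \<in> Basis" "\<beta> b \<in> Basis" using \<beta> c assms by (auto simp: bij_betw_def)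
    moreover have "\<beta> c = \<beta> b \<longleftrightarrow> c = b" using \<beta> c assms by (auto simp: bij_betw_def inj_on_def)
    ultimately show "(u \<bullet> c) * (\<beta> c \<bullet> \<beta> b) = (if c = b then u \<bullet> c else 0)" by (simp add: inner_Basis)
  qed simp
  also have "\<dots> = u \<bullet> b" using assms by simp
  finally show ?thesis .
qed

lemma basis_map_inner_basis_map: "basis_map \<beta> u \<bullet> basis_map \<beta> v = u \<bullet> v"
proof -
  have "basis_map \<beta> u \<bullet> basis_map \<beta> v = (\<Sum>b\<in>Basis. (v \<bullet> b) * (basis_map \<beta> u \<bullet> \<beta> b))"
    by (subst (2) basis_map_def) (simp add: inner_sum_right)
  also have "\<dots> = (\<Sum>b\<in>Basis. (u \<bullet> b) * (v \<bullet> b))"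
    by (intro sum.cong) (auto simp: basis_map_inner)
  also have "\<dots> = u \<bullet> v" by (rule euclidean_inner[symmetric])
  finally show ?thesis .
qed

lemma basis_map_surj: "\<exists>u. basis_map \<beta> u = x"
proof -
  define u where "u = (\<Sum>b\<in>Basis. (x \<bullet> \<beta> b) *\<^sub>R b)"
  have "basis_map \<beta> u \<bullet> e = x \<bullet> e" if "e \<in> Basis" for e
  proof -
    have "e \<in> \<beta> ` Basis" using \<beta> that by (simp add: bij_betw_def)
    then obtain b where b: "b \<in> Basis" "e = \<beta> b" by blast
    have "u \<bullet> b = x \<bullet> \<beta> b" using b by (simp add: u_def)
    then show ?thesis using b by (simp add: basis_map_inner)
  qed
  then show ?thesis by (intro exI[of _ u]) (rule euclidean_eqI)
qed

end

lemma linear_borel_measurable: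
  fixes f :: "'a::euclidean_space \<Rightarrow> 'b::euclidean_space"
  assumes "linear f" shows "f \<in> borel_measurable borel"
proof -
  have "bounded_linear f" using assms linear_conv_bounded_linear by blast
  then have "continuous_on UNIV f" by (rule linear_continuous_on)
  then show ?thesis by (rule borel_measurable_continuous_onI)
qed

text \<open>Both sides of the claim, multiplied by the volume of the unit ball, are the two iterated
  integrals of the indicator of \<open>{(u, y). T u \<in> A \<and> norm (y - T u) \<le> 1}\<close>.\<close>

lemma lborel_distr_isometry:
  fixes T :: "'b::euclidean_space \<Rightarrow> 'a::euclidean_space"
  assumes lin: "linear T" and nrm: "\<And>u. norm (T u) = norm u" and sur: "surj T"
    and dim: "DIM('b) = DIM('a)"
  shows "distr lborel borel T = lborel"
proof (rule measure_eqI)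
  have T[measurable]: "T \<in> borel_measurable borel" by (rule linear_borel_measurable[OF lin])
  fix A assume "A \<in> sets (distr lborel borel T)"
  then have A[measurable]: "A \<in> sets borel" by simp
  let ?v = "ennreal (unit_ball_vol (real DIM('a)))"
  let ?f = "\<lambda>z::'a. indicator (cball 0 1) z :: ennreal"
  have fm[measurable]: "?f \<in> borel_measurable borel" by (rule borel_measurable_indicator) simp
  have v: "(\<integral>\<^sup>+z. ?f z \<partial>lborel) = ?v" by (simp add: emeasure_cball)
  have "(\<integral>\<^sup>+u. \<integral>\<^sup>+y. indicator A (T u) * ?f (y - T u) \<partial>lborel \<partial>lborel) = (\<integral>\<^sup>+u. indicator A (T u) * ?v \<partial>lborel)"
  proof (rule nn_integral_cong)
    fix u
    have "(\<integral>\<^sup>+y. ?f (y - T u) \<partial>lborel) = ?v"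
      using nn_integral_lborel_shift[OF fm, of "- T u"] v by simp
    moreover have "(\<lambda>y. ?f (y - T u)) \<in> borel_measurable lborel"
      using measurable_compose[OF _ fm, of "\<lambda>y. y - T u" borel] by simp
    ultimately show "(\<integral>\<^sup>+y. indicator A (T u) * ?f (y - T u) \<partial>lborel) = indicator A (T u) * ?v"
      by (simp add: nn_integral_cmult)
  qed
  also have "\<dots> = emeasure (distr lborel borel T) A * ?v"
  proof -
    have "(\<integral>\<^sup>+u. indicator A (T u) \<partial>lborel) = (\<integral>\<^sup>+x. indicator A x \<partial>distr lborel borel T)"
      by (rule nn_integral_distr[symmetric]) auto
    also have "\<dots> = emeasure (distr lborel borel T) A" by (rule nn_integral_indicator) simp
    finally show ?thesis by (subst nn_integral_multc) auto
  qed
  finally have 1: "(\<integral>\<^sup>+u. \<integral>\<^sup>+y. indicator A (T u) * ?f (y - T u) \<partial>lborel \<partial>lborel) = emeasure (distr lborel borel T) A * ?v" .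
  have "(\<integral>\<^sup>+u. \<integral>\<^sup>+y. indicator A (T u) * ?f (y - T u) \<partial>lborel \<partial>lborel)
      = (\<integral>\<^sup>+y. \<integral>\<^sup>+u. indicator A (T u) * ?f (y - T u) \<partial>lborel \<partial>lborel)"
    by (rule lborel_pair.Fubini') measurable
  also have "\<dots> = (\<integral>\<^sup>+y. \<integral>\<^sup>+u. indicator A (T u + y) * ?f (- T u) \<partial>lborel \<partial>lborel)"
  proof (rule nn_integral_cong)
    fix y :: 'a
    obtain w where w: "y = T w" using sur by (metis surj_def)
    show "(\<integral>\<^sup>+u. indicator A (T u) * ?f (y - T u) \<partial>lborel) = (\<integral>\<^sup>+u. indicator A (T u + y) * ?f (- T u) \<partial>lborel)"
      by (subst nn_integral_lborel_shift[of "\<lambda>u. indicator A (T u) * ?f (y - T u)" w, symmetric])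
        (simp_all add: linear_add[OF lin] w)
  qed
  also have "\<dots> = (\<integral>\<^sup>+u. \<integral>\<^sup>+y. indicator A (T u + y) * ?f (- T u) \<partial>lborel \<partial>lborel)"
    by (rule lborel_pair.Fubini'[symmetric]) measurable
  also have "\<dots> = (\<integral>\<^sup>+u. emeasure lborel A * indicator (cball (0::'b) 1) u \<partial>lborel)"
  proof (rule nn_integral_cong)
    fix u
    have "(\<integral>\<^sup>+y. indicator A (T u + y) \<partial>lborel) = emeasure lborel A"
      using nn_integral_lborel_shift[OF borel_measurable_indicator[OF A], of "T u"]
      by (simp add: add.commute)
    moreover have "?f (- T u) = indicator (cball 0 1) u" by (simp add: indicator_def nrm)
    ultimately show "(\<integral>\<^sup>+y. indicator A (T u + y) * ?f (- T u) \<partial>lborel) = emeasure lborel A * indicator (cball 0 1) u"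
      by (subst nn_integral_multc) auto
  qed
  also have "\<dots> = emeasure lborel A * ?v"
  proof -
    have "cball (0::'b) 1 \<in> sets lborel" by simp
    then show ?thesis by (simp add: nn_integral_cmult_indicator emeasure_cball dim)
  qed
  finally have "emeasure (distr lborel borel T) A * ?v = emeasure lborel A * ?v" unfolding 1 .
  moreover have "?v \<noteq> 0" by (simp add: ennreal_eq_0_iff not_le)
  moreover have "?v \<noteq> top" by simp
  ultimately show "emeasure (distr lborel borel T) A = emeasure lborel A"
    by (metis ennreal_mult_divide_eq)
qed simp

text \<open>Matching the bases gives an isometry onto \<open>real^'d\<close>; a rotation then moves
  the image of \<open>e\<close> to \<open>n\<close>.\<close>

lemma isometric_coordinates:
  fixes n :: "real^'d" and e :: "'b::euclidean_space"
  assumes dim: "DIM('b) = CARD('d)" and e: "norm e = 1" and n: "norm n = 1"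
  obtains J :: "'b \<Rightarrow> real^'d" where "linear J" "\<And>u v. J u \<bullet> J v = u \<bullet> v" "surj J" "J e = n"
    "distr lborel borel J = lborel"
proof -
  have "card (Basis :: 'b set) = card (Basis :: (real^'d) set)" using dim by simp
  then obtain \<beta> where \<beta>: "bij_betw \<beta> (Basis :: 'b set) (Basis :: (real^'d) set)"
    using finite_same_card_bij[OF finite_Basis finite_Basis] by blast
  let ?i = "basis_map \<beta>"
  have "norm (?i e) = norm n"
    using basis_map_inner_basis_map[OF \<beta>, of e e] e n by (simp add: norm_eq_sqrt_inner)
  then obtain T where T: "orthogonal_transformation T" "T (?i e) = n"
    using orthogonal_transformation_exists by blast
  have lin: "linear (T \<circ> ?i)"
    using T(1) by (intro linear_compose linear_basis_map orthogonal_transformation_linear)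
  have inn: "(T \<circ> ?i) u \<bullet> (T \<circ> ?i) v = u \<bullet> v" for u v
    using T(1) basis_map_inner_basis_map[OF \<beta>, of u v] by (simp add: orthogonal_transformation_def)
  have sur: "surj (T \<circ> ?i)"
  proof -
    have "surj ?i" using basis_map_surj[OF \<beta>] by (metis surjI surj_def)
    then show ?thesis using orthogonal_transformation_surj[OF T(1)] by (rule comp_surj)
  qed
  have "distr lborel borel (T \<circ> ?i) = lborel"
    by (rule lborel_distr_isometry[OF lin _ sur]) (use dim inn in \<open>auto simp: norm_eq_sqrt_inner\<close>)
  moreover have "(T \<circ> ?i) e = n" using T(2) by simp
  ultimately show ?thesis using that[OF lin inn sur] by blast
qed

lemma nn_integral_real_scale:
  fixes f :: "real \<Rightarrow> ennreal"
  assumes "f \<in> borel_measurable borel" "c \<noteq> 0"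
  shows "(\<integral>\<^sup>+t. f t \<partial>lborel) = ennreal \<bar>c\<bar> * (\<integral>\<^sup>+x. f (c * x) \<partial>lborel)"
  by (subst nn_integral_real_affine[OF assms, of 0]) simp

text \<open>Coordinates adapted to a direction \<open>\<omega>\<close> transversal to the hyperplane orthogonal to \<open>n\<close>: the
  Jacobian is \<open>\<bar>\<omega> \<bullet> n\<bar>\<close>.\<close>

lemma flow_coordinates:
  fixes n \<omega> :: "real^'d"
  assumes dim: "Suc DIM('n::euclidean_space) = CARD('d)" and n: "norm n = 1" and c: "\<omega> \<bullet> n \<noteq> 0"
  obtains J :: "'n::euclidean_space \<Rightarrow> real^'d" where "linear J" "\<And>q. norm (J q) = norm q" "\<And>q. J q \<bullet> n = 0"
    "\<And>y. y \<bullet> n = 0 \<Longrightarrow> \<exists>q. J q = y"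
    "\<And>W. W \<in> sets borel \<Longrightarrow> emeasure lborel W =
       ennreal \<bar>\<omega> \<bullet> n\<bar> * (\<integral>\<^sup>+q. \<integral>\<^sup>+x. indicator W (J q + x *\<^sub>R \<omega>) \<partial>lborel \<partial>lborel)"
proof -
  have dim': "DIM('n \<times> real) = CARD('d)" using dim by simp
  have e: "norm ((0, 1) :: 'n \<times> real) = 1" by simp
  obtain H :: "'n \<times> real \<Rightarrow> real^'d" where H: "linear H" "\<And>u v. H u \<bullet> H v = u \<bullet> v" "surj H" "H (0, 1) = n"
    "distr lborel borel H = lborel"
    using isometric_coordinates[OF dim' e n] by blast
  have Hm[measurable]: "H \<in> borel_measurable borel" by (rule linear_borel_measurable[OF H(1)])
  let ?J = "\<lambda>q. H (q, 0)"
  let ?c = "\<omega> \<bullet> n"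
  have Hn: "H (q, t) \<bullet> n = t" for q t
    using H(2)[of "(q, t)" "(0, 1)"] H(4) by simp
  have lin: "linear ?J"
  proof -
    have "?J = H \<circ> (\<lambda>q. (q, 0))" by auto
    moreover have "linear (\<lambda>q::'n. (q, 0::real))" by (rule linearI) auto
    ultimately show ?thesis using linear_compose H(1) by metis
  qed
  have Jm[measurable]: "?J \<in> borel_measurable borel" by (rule linear_borel_measurable[OF lin])
  have nrm: "norm (?J q) = norm q" for q
    using H(2)[of "(q,0)" "(q,0)"] by (simp add: norm_eq_sqrt_inner)
  \<comment> \<open>In these coordinates \<open>\<omega>\<close> has the hyperplane part
    \<open>w\<close> and the normal part \<open>\<omega> \<bullet> n\<close>.\<close>
  obtain w t0 where "H (w, t0) = \<omega>" using H(3) by (metis surj_def surj_pair)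
  then have w: "H (w, ?c) = \<omega>" using Hn[of w t0] by simp
  have Hw: "H (q + x *\<^sub>R w, ?c * x) = ?J q + x *\<^sub>R \<omega>" for q x
  proof -
    have "(q + x *\<^sub>R w, ?c * x) = (q, 0) + x *\<^sub>R (w, ?c)" by simp
    then show ?thesis using linear_add[OF H(1)] linear_scale[OF H(1)] w by metis
  qed
  have surj: "\<exists>q. ?J q = y" if "y \<bullet> n = 0" for y
  proof -
    obtain q t where "H (q, t) = y" using H(3) by (metis surj_def surj_pair)
    then show ?thesis using Hn[of q t] that by auto
  qed
  have main: "emeasure lborel W = ennreal \<bar>?c\<bar> * (\<integral>\<^sup>+q. \<integral>\<^sup>+x. indicator W (?J q + x *\<^sub>R \<omega>) \<partial>lborel \<partial>lborel)"
    if [measurable]: "W \<in> sets borel" for W :: "(real^'d) set"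
  proof -
    have [measurable]: "(\<lambda>p. indicator W (H p) :: ennreal) \<in> borel_measurable borel" by measurable
    have m2[measurable]: "(\<lambda>p. indicator W (H p) :: ennreal) \<in> borel_measurable (borel \<Otimes>\<^sub>M borel)"
      by (simp add: borel_prod)
    have m3[measurable]: "(\<lambda>(q, t). indicator W (H (q, t)) :: ennreal) \<in> borel_measurable (borel \<Otimes>\<^sub>M borel)"
      using m2 by (simp add: case_prod_beta')
    have m4[measurable]: "(\<lambda>q. indicator W (H (q, t)) :: ennreal) \<in> borel_measurable borel" for t
      by measurable
    have "emeasure lborel W = emeasure (distr lborel borel H) W" by (simp add: H(5))
    also have "\<dots> = (\<integral>\<^sup>+p. indicator W p \<partial>distr lborel borel H)" by simp
    also have "\<dots> = (\<integral>\<^sup>+p. indicator W (H p) \<partial>(lborel \<Otimes>\<^sub>M lborel))"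
      by (subst nn_integral_distr) (auto simp: lborel_prod)
    also have "\<dots> = (\<integral>\<^sup>+q. \<integral>\<^sup>+t. indicator W (H (q, t)) \<partial>lborel \<partial>lborel)"
      by (rule lborel.nn_integral_fst[symmetric]) measurable
    also have "\<dots> = (\<integral>\<^sup>+t. \<integral>\<^sup>+q. indicator W (H (q, t)) \<partial>lborel \<partial>lborel)"
      by (rule lborel_pair.Fubini') measurable
    \<comment> \<open>Substituting \<open>t = c * x\<close> produces the Jacobian. The remaining
      shear is, for fixed \<open>x\<close>, the translation of \<open>q\<close> by
      \<open>x *\<^sub>R w\<close>, which preserves the inner integral.\<close>
    also have "\<dots> = ennreal \<bar>?c\<bar> * (\<integral>\<^sup>+x. \<integral>\<^sup>+q. indicator W (H (q, ?c * x)) \<partial>lborel \<partial>lborel)"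
      by (rule nn_integral_real_scale) (use c in measurable)
    also have "(\<integral>\<^sup>+x. \<integral>\<^sup>+q. indicator W (H (q, ?c * x)) \<partial>lborel \<partial>lborel)
        = (\<integral>\<^sup>+x. \<integral>\<^sup>+q. indicator W (?J q + x *\<^sub>R \<omega>) \<partial>lborel \<partial>lborel)"
    proof (rule nn_integral_cong)
      fix x :: real
      show "(\<integral>\<^sup>+q. indicator W (H (q, ?c * x)) \<partial>lborel) = (\<integral>\<^sup>+q. indicator W (?J q + x *\<^sub>R \<omega>) \<partial>lborel)"
        using nn_integral_lborel_shift[of "\<lambda>q. indicator W (H (q, ?c * x)) :: ennreal" "x *\<^sub>R w"] m4
        by (simp add: Hw)
    qed
    also have "\<dots> = (\<integral>\<^sup>+q. \<integral>\<^sup>+x. indicator W (?J q + x *\<^sub>R \<omega>) \<partial>lborel \<partial>lborel)"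
      by (rule lborel_pair.Fubini') measurable
    finally show ?thesis .
  qed
  have Jn: "?J q \<bullet> n = 0" for q by (rule Hn)
  show ?thesis by (rule that[OF lin nrm Jn surj main])
qed

text \<open>The starting points from which the flow reaches \<open>A\<close> within time
  \<open>h\<close>; hence the minus sign.\<close>

definition flow_strip :: "'a::real_vector \<Rightarrow> real \<Rightarrow> 'a set \<Rightarrow> 'a set" where
  "flow_strip \<omega> h A = {a - x *\<^sub>R \<omega> | a x. a \<in> A \<and> x \<in> {0..h}}"

text \<open>This class of Borel sets is stable under continuous images and flow strips, whereas a
  continuous image of a general Borel set may fail to be Borel.\<close>

definition sigma_compact :: "'a::topological_space set \<Rightarrow> bool" where
  "sigma_compact A \<longleftrightarrow> (\<exists>C::nat \<Rightarrow> 'a set. (\<forall>i. compact (C i)) \<and> A = (\<Union>i. C i))"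

lemma sigma_compact_borel: "sigma_compact (A :: 'a::euclidean_space set) \<Longrightarrow> A \<in> sets borel"
proof -
  assume "sigma_compact A"
  then obtain C where C: "\<And>i::nat. compact (C i)" "A = (\<Union>i. C i)" by (auto simp: sigma_compact_def)
  show "A \<in> sets borel" unfolding C(2) by (rule sets.countable_UN) (use C(1) borel_compact in auto)
qed

lemma sigma_compact_continuous_image:
  fixes A :: "'a::topological_space set" and f :: "'a \<Rightarrow> 'b::topological_space"
  shows "sigma_compact A \<Longrightarrow> continuous_on UNIV f \<Longrightarrow> sigma_compact (f ` A)"
  unfolding sigma_compact_def
proof (elim exE conjE)
  fix C :: "nat \<Rightarrow> 'a set" assume C: "\<forall>i. compact (C i)" "A = (\<Union>i. C i)" and f: "continuous_on UNIV f"
  show "\<exists>D::nat \<Rightarrow> 'b set. (\<forall>i. compact (D i)) \<and> f ` A = (\<Union>i. D i)"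
    by (rule exI[of _ "\<lambda>i. f ` C i"])
      (use C continuous_on_subset[OF f] in \<open>auto intro: compact_continuous_image\<close>)
qed

lemma sigma_compact_flow_strip:
  fixes A :: "'a::euclidean_space set"
  assumes "sigma_compact A" shows "sigma_compact (flow_strip \<omega> h A)"
proof -
  obtain C where C: "\<And>i::nat. compact (C i)" "A = (\<Union>i. C i)" using assms by (auto simp: sigma_compact_def)
  have "flow_strip \<omega> h A = (\<Union>i. (\<lambda>(a, x). a - x *\<^sub>R \<omega>) ` (C i \<times> {0..h}))"
  proof (intro set_eqI iffI)
    fix z assume "z \<in> flow_strip \<omega> h A"
    then obtain a x i where "z = a - x *\<^sub>R \<omega>" "a \<in> C i" "x \<in> {0..h}"
      unfolding flow_strip_def C(2) by blast
    then show "z \<in> (\<Union>i. (\<lambda>(a, x). a - x *\<^sub>R \<omega>) ` (C i \<times> {0..h}))"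
      by (intro UN_I[of i] image_eqI[of _ _ "(a, x)"]) auto
  next
    fix z assume "z \<in> (\<Union>i. (\<lambda>(a, x). a - x *\<^sub>R \<omega>) ` (C i \<times> {0..h}))"
    then obtain i a x where "z = a - x *\<^sub>R \<omega>" "a \<in> C i" "x \<in> {0..h}" by auto
    then show "z \<in> flow_strip \<omega> h A" unfolding flow_strip_def C(2) by blast
  qed
  moreover have "compact ((\<lambda>(a, x). a - x *\<^sub>R \<omega>) ` (C i \<times> {0..h}))" for i
    by (intro compact_continuous_image compact_Times C compact_Icc)
      (auto simp: case_prod_beta' intro!: continuous_intros)
  ultimately show ?thesis unfolding sigma_compact_def
    by (intro exI[of _ "\<lambda>i. (\<lambda>(a, x). a - x *\<^sub>R \<omega>) ` (C i \<times> {0..h})"]) simp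
qed

lemma flow_strip_measurable:
  fixes A :: "'a::euclidean_space set"
  shows "sigma_compact A \<Longrightarrow> flow_strip \<omega> h A \<in> sets borel"
  by (rule sigma_compact_borel[OF sigma_compact_flow_strip])

text \<open>Let \<open>P\<close> project along \<open>\<omega>\<close> to the hyperplane orthogonal
  to \<open>n\<close>. Flatness bounds the correction along \<open>\<omega>\<close> by
  \<open>k * dist a a'\<close>, so \<open>P\<close> changes distances in \<open>A\<close> by factors
  between \<open>1 - k\<close> and \<open>1 + k\<close>. The strip has volume
  \<open>h * \<bar>\<omega> \<bullet> n\<bar>\<close> times that of the projection, and the two
  Lipschitz comparisons relate the latter to Hausdorff measure.\<close>

lemma flat_strip_measure:
  fixes n \<omega> :: "real^'d" and A :: "(real^'d) set"
  assumes dim: "Suc DIM('n::euclidean_space) = CARD('d)" and n: "norm n = 1" and c: "\<omega> \<bullet> n \<noteq> 0"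
    and A: "sigma_compact A" "bounded A" and h: "0 \<le> h"
    and flat: "\<And>a a'. a \<in> A \<Longrightarrow> a' \<in> A \<Longrightarrow> \<bar>(a - a') \<bullet> n\<bar> * norm \<omega> \<le> k * \<bar>\<omega> \<bullet> n\<bar> * dist a a'"
    and k: "0 \<le> k" "k < 1"
  shows "emeasure lborel (flow_strip \<omega> h A)
      \<le> ennreal (h * \<bar>\<omega> \<bullet> n\<bar> * (1 + k) ^ DIM('n)) * hausdorff_outer DIM('n) A"
    and "ennreal (h * \<bar>\<omega> \<bullet> n\<bar>) * hausdorff_outer DIM('n) A
      \<le> ennreal ((1 / (1 - k)) ^ DIM('n)) * emeasure lborel (flow_strip \<omega> h A)"
proof -
  let ?c = "\<omega> \<bullet> n"
  obtain J :: "'n \<Rightarrow> real^'d" where J: "linear J" "\<And>q. norm (J q) = norm q" "\<And>q. J q \<bullet> n = 0"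
    "\<And>y. y \<bullet> n = 0 \<Longrightarrow> \<exists>q. J q = y"
    and meas: "\<And>W. W \<in> sets borel \<Longrightarrow> emeasure lborel W =
       ennreal \<bar>?c\<bar> * (\<integral>\<^sup>+q. \<integral>\<^sup>+x. indicator W (J q + x *\<^sub>R \<omega>) \<partial>lborel \<partial>lborel)"
    using flow_coordinates[OF dim n c] by blast
  have "\<exists>q. J q = a - ((a \<bullet> n) / ?c) *\<^sub>R \<omega>" for a
    by (rule J(4)) (use c in \<open>simp add: inner_diff_left\<close>)
  then obtain P where P: "\<And>a. J (P a) = a - ((a \<bullet> n) / ?c) *\<^sub>R \<omega>" by metis
  have Jd: "norm (q - q') = norm (J q - J q')" for q q'
    using J(2)[of "q - q'"] linear_diff[OF J(1)] by simp
  have Pd: "norm (P a - P a') = norm ((a - a') - (((a - a') \<bullet> n) / ?c) *\<^sub>R \<omega>)" for a a'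
    unfolding Jd P by (simp add: inner_diff_left diff_divide_distrib scaleR_diff_left algebra_simps)
  have Jinj: "q = q'" if "J q = J q'" for q q'
    using Jd[of q q'] that by simp
  have Pcont: "continuous_on UNIV P"
  proof -
    have "dist (P a) (P a') \<le> (1 + norm n / \<bar>?c\<bar> * norm \<omega>) * dist a a'" for a a'
    proof -
      have "dist (P a) (P a') \<le> norm (a - a') + \<bar>(a - a') \<bullet> n\<bar> / \<bar>?c\<bar> * norm \<omega>"
        unfolding dist_norm Pd using norm_triangle_ineq4[of "a - a'"] by (metis abs_divide norm_scaleR real_norm_def)
      also have "\<dots> \<le> norm (a - a') + (norm (a - a') * norm n) / \<bar>?c\<bar> * norm \<omega>"
        by (intro add_left_mono mult_right_mono divide_right_mono Cauchy_Schwarz_ineq2) auto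
      finally show ?thesis by (simp add: dist_norm algebra_simps)
    qed
    then have "(1 + norm n / \<bar>?c\<bar> * norm \<omega>)-lipschitz_on UNIV P"
      by (intro lipschitz_onI) auto
    then show ?thesis by (rule lipschitz_on_continuous_on)
  qed
  have up: "dist (P a) (P a') \<le> (1 + k) * dist a a'" and low: "(1 - k) * dist a a' \<le> dist (P a) (P a')"
    if "a \<in> A" "a' \<in> A" for a a'
  proof -
    have "norm ((((a - a') \<bullet> n) / ?c) *\<^sub>R \<omega>) = \<bar>(a - a') \<bullet> n\<bar> * norm \<omega> / \<bar>?c\<bar>" by simp
    also have "\<dots> \<le> k * dist a a'" using flat[OF that] c by (simp add: field_simps)
    finally have le: "norm ((((a - a') \<bullet> n) / ?c) *\<^sub>R \<omega>) \<le> k * dist a a'" .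
    show "dist (P a) (P a') \<le> (1 + k) * dist a a'"
      using norm_triangle_ineq4[of "a - a'" "(((a - a') \<bullet> n) / ?c) *\<^sub>R \<omega>"] le
      by (simp add: dist_norm Pd algebra_simps)
    show "(1 - k) * dist a a' \<le> dist (P a) (P a')"
      using norm_triangle_ineq2[of "a - a'" "(((a - a') \<bullet> n) / ?c) *\<^sub>R \<omega>"] le
      by (simp add: dist_norm Pd algebra_simps)
  qed
  have inj: "a = a'" if "a \<in> A" "a' \<in> A" "P a = P a'" for a a'
  proof -
    have "(1 - k) * dist a a' \<le> 0" using low[OF that(1,2)] that(3) by simp
    then have "dist a a' \<le> 0" using k by (simp add: mult_le_0_iff)
    then show ?thesis by simp
  qed
  let ?B = "P ` A" and ?W = "flow_strip \<omega> h A"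
  have B: "?B \<in> sets borel" by (rule sigma_compact_borel[OF sigma_compact_continuous_image[OF A(1) Pcont]])
  have W: "?W \<in> sets borel" by (rule flow_strip_measurable[OF A(1)])
  have sec: "(\<integral>\<^sup>+x. indicator ?W (J q + x *\<^sub>R \<omega>) \<partial>lborel) = ennreal h * indicator ?B q" for q
  proof (cases "q \<in> ?B")
    case True
    then obtain a where a: "a \<in> A" "q = P a" by auto
    have mem: "J q + x *\<^sub>R \<omega> \<in> ?W \<longleftrightarrow> x \<in> {(a \<bullet> n) / ?c - h .. (a \<bullet> n) / ?c}" for x
    proof
      assume "J q + x *\<^sub>R \<omega> \<in> ?W"
      then obtain a' y where a': "a' \<in> A" "0 \<le> y" "y \<le> h" "J q + x *\<^sub>R \<omega> = a' - y *\<^sub>R \<omega>"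
        by (auto simp: flow_strip_def)
      then have eq: "a' = J q + (x + y) *\<^sub>R \<omega>" by (simp add: algebra_simps)
      then have n': "a' \<bullet> n = (x + y) * ?c" by (simp add: inner_add_left J(3))
      have "J (P a') = J q" unfolding P n' using c eq by simp
      then have "a' = a" using Jinj inj a a' by metis
      then have "x + y = (a \<bullet> n) / ?c" using n' c by simp
      then show "x \<in> {(a \<bullet> n) / ?c - h .. (a \<bullet> n) / ?c}" using a' by auto
    next
      assume "x \<in> {(a \<bullet> n) / ?c - h .. (a \<bullet> n) / ?c}"
      moreover have "J q + x *\<^sub>R \<omega> = a - ((a \<bullet> n) / ?c - x) *\<^sub>R \<omega>"
        using P[of a] a by (simp add: algebra_simps)
      ultimately show "J q + x *\<^sub>R \<omega> \<in> ?W" using a unfolding flow_strip_def by force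
    qed
    have "(\<integral>\<^sup>+x. indicator ?W (J q + x *\<^sub>R \<omega>) \<partial>lborel) = (\<integral>\<^sup>+x. indicator {(a \<bullet> n) / ?c - h .. (a \<bullet> n) / ?c} x \<partial>lborel)"
      by (intro nn_integral_cong) (simp only: indicator_def mem)
    also have "\<dots> = ennreal h" using h by simp
    finally show ?thesis using True by simp
  next
    case False
    have "J q + x *\<^sub>R \<omega> \<notin> ?W" for x
    proof
      assume "J q + x *\<^sub>R \<omega> \<in> ?W"
      then obtain a' y where a': "a' \<in> A" "J q + x *\<^sub>R \<omega> = a' - y *\<^sub>R \<omega>"
        by (auto simp: flow_strip_def)
      then have eq: "a' = J q + (x + y) *\<^sub>R \<omega>" by (simp add: algebra_simps)
      then have n': "a' \<bullet> n = (x + y) * ?c" by (simp add: inner_add_left J(3))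
      have "J (P a') = J q" unfolding P n' using c eq by simp
      then show False using Jinj False a' by blast
    qed
    then show ?thesis using False by simp
  qed
  have WB: "emeasure lborel ?W = ennreal (h * \<bar>?c\<bar>) * emeasure lborel ?B"
    unfolding meas[OF W] sec using B h by (simp add: nn_integral_cmult ennreal_mult mult_ac)
  have "emeasure lborel ?B \<le> ennreal ((1 + k) ^ DIM('n)) * hausdorff_outer DIM('n) A"
    by (rule lborel_Lipschitz_image_le_hausdorff) (use up k B in auto)
  then have "emeasure lborel ?W \<le> ennreal (h * \<bar>?c\<bar>) * (ennreal ((1 + k) ^ DIM('n)) * hausdorff_outer DIM('n) A)"
    unfolding WB by (rule mult_left_mono) simp
  then show "emeasure lborel ?W \<le> ennreal (h * \<bar>?c\<bar> * (1 + k) ^ DIM('n)) * hausdorff_outer DIM('n) A"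
    using h k by (simp add: ennreal_mult mult.assoc)
  have "bounded ?B"
  proof -
    obtain D where D: "\<And>a a'. a \<in> A \<Longrightarrow> a' \<in> A \<Longrightarrow> dist a a' \<le> D"
      using A(2) diameter_bounded_bound by blast
    have "dist u v \<le> (1 + k) * D" if uv: "u \<in> ?B" "v \<in> ?B" for u v
    proof -
      obtain a a' where a: "a \<in> A" "a' \<in> A" "u = P a" "v = P a'" using uv by blast
      have "dist u v \<le> (1 + k) * dist a a'" using up a by simp
      also have "\<dots> \<le> (1 + k) * D" using D a k by (intro mult_left_mono) auto
      finally show ?thesis .
    qed
    then show ?thesis by (rule bounded_if_dist_le)
  qed
  then have Bfin: "emeasure lborel ?B < top" using emeasure_bounded_finite by auto
  have "hausdorff_outer DIM('n) (inv_into A P ` ?B) \<le> ennreal ((1 / (1 - k)) ^ DIM('n)) * emeasure lborel ?B"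
  proof (rule hausdorff_Lipschitz_image_le_lborel[OF _ _ B Bfin])
    fix x y assume "x \<in> ?B" "y \<in> ?B"
    then obtain a a' where a: "a \<in> A" "a' \<in> A" "x = P a" "y = P a'" by auto
    have "inj_on P A" using inj by (auto intro: inj_onI)
    then have "inv_into A P x = a" "inv_into A P y = a'" using a by auto
    then show "dist (inv_into A P x) (inv_into A P y) \<le> 1 / (1 - k) * dist x y"
      using low[OF a(1,2)] a k by (simp add: field_simps)
  qed (use k in simp)
  moreover have "inv_into A P ` ?B = A"
  proof -
    have "inj_on P A" using inj by (auto intro: inj_onI)
    then show ?thesis by (simp add: inv_into_image_cancel)
  qed
  ultimately have "ennreal (h * \<bar>?c\<bar>) * hausdorff_outer DIM('n) A
      \<le> ennreal (h * \<bar>?c\<bar>) * (ennreal ((1 / (1 - k)) ^ DIM('n)) * emeasure lborel ?B)"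
    by (intro mult_left_mono) auto
  then show "ennreal (h * \<bar>?c\<bar>) * hausdorff_outer DIM('n) A \<le> ennreal ((1 / (1 - k)) ^ DIM('n)) * emeasure lborel ?W"
    unfolding WB by (simp add: mult_ac)
qed

section \<open>Smooth functions on the torus\<close>

lemma times_differentiable_add:
  "times_differentiable k f \<Longrightarrow> times_differentiable k g \<Longrightarrow> times_differentiable k (\<lambda>x. f x + g x)"
proof (induction k arbitrary: f g)
  case 0
  then show ?case by (auto intro: continuous_on_add)
next
  case (Suc k)
  have d: "f differentiable (at x)" "g differentiable (at x)" for x using Suc.prems by auto
  have "((\<lambda>y. f y + g y) has_derivative (\<lambda>v. frechet_derivative f (at x) v + frechet_derivative g (at x) v)) (at x)" for x
    using d[of x] by (intro has_derivative_add) (simp_all add: frechet_derivative_works)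
  then have eq: "frechet_derivative (\<lambda>y. f y + g y) (at x) = (\<lambda>v. frechet_derivative f (at x) v + frechet_derivative g (at x) v)" for x
    by (rule frechet_derivative_at[symmetric])
  show ?case
    unfolding times_differentiable.simps eq
    using Suc d by (auto intro: differentiable_add)
qed

lemma times_differentiable_cmult:
  "times_differentiable k f \<Longrightarrow> times_differentiable k (\<lambda>x. c * f x)"
proof (induction k arbitrary: f)
  case 0
  then show ?case by (auto intro!: continuous_intros)
next
  case (Suc k)
  have d: "f differentiable (at x)" for x using Suc.prems by auto
  have hd: "((\<lambda>y. c * f y) has_derivative (\<lambda>v. c * frechet_derivative f (at x) v)) (at x)" for x
    using d[of x] by (intro has_derivative_mult_right) (simp_all add: frechet_derivative_works)
  then have eq: "frechet_derivative (\<lambda>y. c * f y) (at x) = (\<lambda>v. c * frechet_derivative f (at x) v)" for x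
    by (rule frechet_derivative_at[symmetric])
  show ?case
    unfolding times_differentiable.simps eq
    using Suc hd by (auto simp: differentiable_def)
qed

lemma times_differentiable_zero: "times_differentiable k (\<lambda>x. 0)"
  by (induction k) auto

lemma times_differentiable_sum:
  "finite I \<Longrightarrow> (\<And>i. i \<in> I \<Longrightarrow> times_differentiable k (f i)) \<Longrightarrow> times_differentiable k (\<lambda>x. \<Sum>i\<in>I. f i x)"
  by (induction rule: finite_induct) (auto simp: times_differentiable_zero intro: times_differentiable_add)

lemma smooth_differentiable: "smooth f \<Longrightarrow> f differentiable (at x)"
  unfolding smooth_def by (metis times_differentiable.simps(2))

lemma smooth_continuous: "smooth f \<Longrightarrow> continuous_on A f"
  unfolding smooth_def by (metis times_differentiable.simps(1) continuous_on_subset subset_UNIV)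

lemma smooth_partial: "smooth f \<Longrightarrow> b \<in> Basis \<Longrightarrow> smooth (\<lambda>x. frechet_derivative f (at x) b)"
  unfolding smooth_def by (metis times_differentiable.simps(2))

lemma gradient_inner: "v \<bullet> gradient f x = (\<Sum>b\<in>Basis. (v \<bullet> b) * frechet_derivative f (at x) b)"
  by (simp add: gradient_def inner_sum_right mult.commute)

lemma smooth_dir_deriv: "smooth f \<Longrightarrow> smooth (dir_deriv \<omega> f)"
proof -
  assume f: "smooth f"
  have "times_differentiable k (\<lambda>x. \<Sum>b\<in>Basis. (\<omega> \<bullet> b) * frechet_derivative f (at x) b)" for k
    using smooth_partial[OF f] by (intro times_differentiable_sum times_differentiable_cmult) (auto simp: smooth_def)
  then show ?thesis
    unfolding smooth_def dir_deriv_def gradient_inner by blast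
qed

lemma smooth_dir_deriv_iter: "smooth f \<Longrightarrow> smooth ((dir_deriv \<omega> ^^ l) f)"
  by (induction l) (auto intro: smooth_dir_deriv)

lemma smooth_has_derivative:
  assumes "smooth f"
  shows "(f has_derivative (\<lambda>v. v \<bullet> gradient f x)) (at x)"
proof -
  have hd: "(f has_derivative frechet_derivative f (at x)) (at x)"
    using smooth_differentiable[OF assms] by (simp add: frechet_derivative_works)
  have "frechet_derivative f (at x) v = v \<bullet> gradient f x" for v
  proof -
    have lin: "linear (frechet_derivative f (at x))" using hd by (rule has_derivative_linear)
    have "frechet_derivative f (at x) v = frechet_derivative f (at x) (\<Sum>b\<in>Basis. (v \<bullet> b) *\<^sub>R b)"
      by (simp add: euclidean_representation)
    also have "\<dots> = (\<Sum>b\<in>Basis. (v \<bullet> b) * frechet_derivative f (at x) b)"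
      by (simp add: linear_sum[OF lin] linear_scale[OF lin])
    finally show ?thesis by (simp add: gradient_inner)
  qed
  then show ?thesis using hd by (metis (no_types, lifting) ext)
qed

lemma continuous_gradient:
  assumes "smooth f" shows "continuous_on A (gradient f)"
  unfolding gradient_def[abs_def]
  by (intro continuous_on_sum continuous_on_scaleR continuous_on_const smooth_continuous smooth_partial[OF assms])

lemma C1_deriv_line:
  assumes "smooth f"
  shows "C1_deriv (\<lambda>t. f (\<theta> + t *\<^sub>R \<omega>)) (\<lambda>t. dir_deriv \<omega> f (\<theta> + t *\<^sub>R \<omega>))"
proof -
  have "((\<lambda>t. f (\<theta> + t *\<^sub>R \<omega>)) has_derivative (\<lambda>s. (s *\<^sub>R \<omega>) \<bullet> gradient f (\<theta> + t *\<^sub>R \<omega>))) (at t)" for t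
    by (rule has_derivative_compose[OF _ smooth_has_derivative[OF assms]]) (auto intro!: derivative_eq_intros)
  moreover have eq: "(\<lambda>s. (s *\<^sub>R \<omega>) \<bullet> v) = (*) (\<omega> \<bullet> v)" for v by (simp add: fun_eq_iff)
  ultimately have "((\<lambda>t. f (\<theta> + t *\<^sub>R \<omega>)) has_real_derivative dir_deriv \<omega> f (\<theta> + t *\<^sub>R \<omega>)) (at t)" for t
    unfolding has_field_derivative_def dir_deriv_def eq by blast
  moreover have "continuous_on UNIV (\<lambda>t. dir_deriv \<omega> f (\<theta> + t *\<^sub>R \<omega>))"
    by (rule continuous_on_compose2[OF smooth_continuous[OF smooth_dir_deriv[OF assms], of UNIV]])
      (auto intro!: continuous_intros)
  ultimately show ?thesis by (simp add: C1_deriv_def)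
qed

lemma smooth_mean_value:
  assumes "smooth f"
  shows "\<exists>\<xi>\<in>closed_segment x y. f y - f x = (y - x) \<bullet> gradient f \<xi>"
proof -
  let ?\<phi> = "\<lambda>t. f (x + t *\<^sub>R (y - x))"
  have "\<exists>z. 0 < z \<and> z < 1 \<and> ?\<phi> 1 - ?\<phi> 0 = (1 - 0) * dir_deriv (y - x) f (x + z *\<^sub>R (y - x))"
    by (rule MVT2) (use C1_deriv_line[OF assms, of x "y - x"] in \<open>auto simp: C1_deriv_def\<close>)
  then obtain z where z: "0 < z" "z < 1" "f y - f x = dir_deriv (y - x) f (x + z *\<^sub>R (y - x))" by auto
  have "x + z *\<^sub>R (y - x) \<in> closed_segment x y"
    using z by (auto simp: in_segment algebra_simps intro!: exI[of _ z])
  then show ?thesis using z by (auto simp: dir_deriv_def)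
qed

lemma torus_periodic_gradient:
  fixes f :: "real^'d \<Rightarrow> real"
  assumes "smooth f" "torus_periodic f"
  shows "torus_periodic (gradient f)"
  unfolding torus_periodic_def
proof (intro allI)
  fix x :: "real^'d" and l :: "int^'d"
  let ?c = "(2 * pi) *\<^sub>R int_vec l"
  have "((\<lambda>y. f (y + ?c)) has_derivative (\<lambda>v. v \<bullet> gradient f (x + ?c))) (at x)"
    by (rule has_derivative_compose[OF _ smooth_has_derivative[OF assms(1)]]) (auto intro!: derivative_eq_intros)
  moreover have "(\<lambda>y. f (y + ?c)) = f" using assms(2) by (auto simp: torus_periodic_def)
  ultimately have "(f has_derivative (\<lambda>v. v \<bullet> gradient f (x + ?c))) (at x)" by simp
  then have "(\<lambda>v. v \<bullet> gradient f (x + ?c)) = (\<lambda>v. v \<bullet> gradient f x)"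
    by (rule has_derivative_unique[OF _ smooth_has_derivative[OF assms(1)]])
  then have "v \<bullet> gradient f (x + ?c) = v \<bullet> gradient f x" for v by meson
  then show "gradient f (x + ?c) = gradient f x" by (metis vector_eq_rdot inner_commute)
qed

lemma torus_periodic_dir_deriv:
  "smooth f \<Longrightarrow> torus_periodic f \<Longrightarrow> torus_periodic (dir_deriv \<omega> f)"
  using torus_periodic_gradient[of f] by (simp add: torus_periodic_def dir_deriv_def)

lemma torus_periodic_dir_deriv_iter:
  "smooth f \<Longrightarrow> torus_periodic f \<Longrightarrow> torus_periodic ((dir_deriv \<omega> ^^ l) f)"
  by (induction l) (auto intro: torus_periodic_dir_deriv smooth_dir_deriv_iter)

section \<open>Equidistribution of the linear flow\<close>

lemma torus_measurable [measurable]: "torus \<in> sets borel"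
proof -
  have eq: "torus = (\<Inter>i\<in>UNIV. {\<theta>::real^'d. 0 \<le> \<theta> $ i \<and> \<theta> $ i < 2 * pi})" by (auto simp: torus_def)
  have "{\<theta>::real^'d. 0 \<le> \<theta> $ i \<and> \<theta> $ i < 2 * pi} \<in> sets borel" for i by measurable
  then show ?thesis unfolding eq by (intro sets.finite_INT) auto
qed

lemma torus_subset_cbox: "torus \<subseteq> cbox 0 (\<chi> i. 2 * pi)"
  by (auto simp: torus_def mem_box_cart less_imp_le)

lemma emeasure_torus: "emeasure lborel (torus :: (real^'d) set) = ennreal ((2 * pi) ^ CARD('d))"
proof -
  let ?u = "(\<chi> i. 2 * pi) :: real^'d"
  have p: "(\<Prod>b\<in>(Basis::(real^'d) set). (?u - 0) \<bullet> b) = (2 * pi) ^ CARD('d)"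
  proof -
    have "(\<Prod>b\<in>(Basis::(real^'d) set). (?u - 0) \<bullet> b) = (\<Prod>b\<in>(Basis::(real^'d) set). 2 * pi)"
      by (intro prod.cong) (auto simp: Basis_vec_def inner_axis)
    then show ?thesis by simp
  qed
  have le: "\<forall>b\<in>Basis. (0::real^'d) \<bullet> b \<le> ?u \<bullet> b" by (auto simp: Basis_vec_def inner_axis)
  have "emeasure lborel (box 0 ?u) \<le> emeasure lborel (torus :: (real^'d) set)"
    by (intro emeasure_mono) (auto simp: torus_def mem_box_cart less_imp_le)
  moreover have "emeasure lborel (torus :: (real^'d) set) \<le> emeasure lborel (cbox 0 ?u)"
    by (intro emeasure_mono torus_subset_cbox) simp
  moreover have "emeasure lborel (box 0 ?u) = ennreal ((2 * pi) ^ CARD('d))"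
    using emeasure_lborel_box[of 0 ?u] le p by simp
  moreover have "emeasure lborel (cbox 0 ?u) = ennreal ((2 * pi) ^ CARD('d))"
    using emeasure_lborel_cbox[of 0 ?u] le p by simp
  ultimately show ?thesis by simp
qed

section \<open>Lattice translates of the fundamental cell\<close>

lemma int_vec_uminus: "int_vec (- l) = - int_vec l"
  by (simp add: int_vec_def vec_eq_iff)

lemma ex1_lattice_translate: "\<exists>!l. \<theta> + (2 * pi) *\<^sub>R int_vec l \<in> torus"
proof (rule ex1I)
  let ?l = "\<chi> i. - \<lfloor>\<theta> $ i / (2 * pi)\<rfloor>"
  show "\<theta> + (2 * pi) *\<^sub>R int_vec ?l \<in> torus"
    unfolding torus_def mem_Collect_eq
  proof (intro allI)
    fix i
    define q where "q = \<theta> $ i / (2 * pi)"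
    have \<theta>q: "\<theta> $ i = 2 * pi * q" by (simp add: q_def)
    have "2 * pi * of_int \<lfloor>q\<rfloor> \<le> 2 * pi * q" by (intro mult_left_mono) auto
    moreover have "2 * pi * q < 2 * pi * (of_int \<lfloor>q\<rfloor> + 1)" by (intro mult_strict_left_mono) (linarith, simp)
    ultimately have "2 * pi * of_int \<lfloor>\<theta> $ i / (2 * pi)\<rfloor> \<le> \<theta> $ i" "\<theta> $ i < 2 * pi * of_int \<lfloor>\<theta> $ i / (2 * pi)\<rfloor> + 2 * pi"
      unfolding q_def[symmetric] \<theta>q by (simp_all add: distrib_left)
    then show "0 \<le> (\<theta> + (2 * pi) *\<^sub>R int_vec ?l) $ i \<and> (\<theta> + (2 * pi) *\<^sub>R int_vec ?l) $ i < 2 * pi"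
      by (simp add: int_vec_def)
  qed
  fix l assume l: "\<theta> + (2 * pi) *\<^sub>R int_vec l \<in> torus"
  have pi2: "0 < 2 * pi" by simp
  show "l = ?l"
    unfolding vec_eq_iff
  proof
    fix i
    have "0 \<le> \<theta> $ i + 2 * pi * of_int (l $ i)" "\<theta> $ i + 2 * pi * of_int (l $ i) < 2 * pi"
      using l by (auto simp: torus_def int_vec_def)
    moreover define q where "q = \<theta> $ i / (2 * pi)"
    have \<theta>q: "\<theta> $ i = 2 * pi * q" by (simp add: q_def)
    ultimately have "2 * pi * 0 \<le> 2 * pi * (q + of_int (l $ i))" "2 * pi * (q + of_int (l $ i)) < 2 * pi * 1"
      by (simp_all add: distrib_left)
    then have "0 \<le> q + of_int (l $ i)" "q + of_int (l $ i) < 1"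
      unfolding mult_le_cancel_left_pos[OF pi2] mult_less_cancel_left_pos[OF pi2] by auto
    then have "of_int (- (l $ i)) \<le> \<theta> $ i / (2 * pi)" "\<theta> $ i / (2 * pi) < of_int (- (l $ i)) + 1"
      by (simp_all add: q_def)
    then have "\<lfloor>\<theta> $ i / (2 * pi)\<rfloor> = - (l $ i)" by (rule floor_unique)
    then show "l $ i = ?l $ i" by simp
  qed
qed

text \<open>An enumeration of the period lattice by natural numbers, so that sums over the lattice
  become \<open>suminf\<close>.\<close>

definition lattice_point :: "nat \<Rightarrow> real^'d" where
  "lattice_point k = (2 * pi) *\<^sub>R int_vec (from_nat_into UNIV k)"

lemma bij_lattice_enum: "bij (from_nat_into (UNIV :: (int^'d) set))"
proof -
  have "inj (\<lambda>k::int. (\<chi> i. k) :: int^'d)" by (auto simp: inj_def vec_eq_iff)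
  then have "infinite (UNIV :: (int^'d) set)"
    by (metis finite_imageD finite_subset infinite_UNIV_char_0 subset_UNIV)
  then show ?thesis by (intro bij_betw_from_nat_into) auto
qed

lemma lattice_point_exists: "\<exists>k. (2 * pi) *\<^sub>R int_vec l = lattice_point k"
proof -
  obtain k where "l = from_nat_into UNIV k" using surjD[OF bij_is_surj[OF bij_lattice_enum]] by blast
  then show ?thesis by (intro exI[of _ k]) (simp add: lattice_point_def)
qed

lemma torus_periodic_lattice_point: "torus_periodic f \<Longrightarrow> f (\<theta> + lattice_point k) = f \<theta>"
  by (simp add: torus_periodic_def lattice_point_def)

lemma ex1_lattice_point: "\<exists>!k. \<theta> + lattice_point k \<in> torus"
proof -
  obtain l where l: "\<theta> + (2 * pi) *\<^sub>R int_vec l \<in> torus" "\<And>l'. \<theta> + (2 * pi) *\<^sub>R int_vec l' \<in> torus \<Longrightarrow> l' = l"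
    using ex1_lattice_translate[of \<theta>] by blast
  obtain k where k: "from_nat_into UNIV k = l" "\<And>k'. from_nat_into UNIV k' = l \<Longrightarrow> k' = k"
    using bij_lattice_enum[unfolded bij_iff] by blast
  show ?thesis
  proof (rule ex1I[of _ k])
    show "\<theta> + lattice_point k \<in> torus" using l(1) k(1) by (simp add: lattice_point_def)
    fix k' assume "\<theta> + lattice_point k' \<in> torus"
    then have "from_nat_into UNIV k' = l" by (intro l(2)) (simp add: lattice_point_def)
    then show "k' = k" by (rule k(2))
  qed
qed

lemma ex1_lattice_point': "\<exists>!k. \<theta> - lattice_point k \<in> torus"
proof -
  obtain l where l: "\<theta> + (2 * pi) *\<^sub>R int_vec l \<in> torus" "\<And>l'. \<theta> + (2 * pi) *\<^sub>R int_vec l' \<in> torus \<Longrightarrow> l' = l"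
    using ex1_lattice_translate[of \<theta>] by blast
  obtain k where k: "from_nat_into UNIV k = - l" "\<And>k'. from_nat_into UNIV k' = - l \<Longrightarrow> k' = k"
    using bij_lattice_enum[unfolded bij_iff] by blast
  show ?thesis
  proof (rule ex1I[of _ k])
    show "\<theta> - lattice_point k \<in> torus" using l(1) k(1) by (simp add: lattice_point_def int_vec_uminus)
    fix k' assume "\<theta> - lattice_point k' \<in> torus"
    then have "- from_nat_into UNIV k' = l" by (intro l(2)) (simp add: lattice_point_def int_vec_uminus)
    then show "k' = k" by (intro k(2)) (metis minus_minus)
  qed
qed

lemma suminf_indicator_ex1:
  assumes "\<exists>!k::nat. P k"
  shows "(\<Sum>k. if P k then c else (0::ennreal)) = c"
proof -
  obtain k0 where k0: "P k0" "\<And>k. P k \<Longrightarrow> k = k0" using assms by blast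
  have "(\<Sum>k. if P k then c else 0) = (\<Sum>k\<in>{k0}. if P k then c else 0)"
  proof (rule suminf_finite)
    fix k assume "k \<notin> {k0}"
    then show "(if P k then c else 0) = 0" using k0(2)[of k] by auto
  qed simp
  then show ?thesis using k0(1) by simp
qed

text \<open>The integral over the whole space is split over the lattice translates of the cell, each
  of which is moved back to the cell.\<close>

lemma nn_integral_torus_tiling:
  fixes F :: "real^'d \<Rightarrow> ennreal"
  assumes [measurable]: "F \<in> borel_measurable borel"
  shows "(\<integral>\<^sup>+\<theta>. F \<theta> \<partial>lborel) = (\<integral>\<^sup>+\<theta>\<in>torus. (\<Sum>k. F (\<theta> + lattice_point k)) \<partial>lborel)"
proof -
  have "(\<integral>\<^sup>+\<theta>\<in>torus. (\<Sum>k. F (\<theta> + lattice_point k)) \<partial>lborel)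
      = (\<integral>\<^sup>+\<theta>. (\<Sum>k. F (\<theta> + lattice_point k) * indicator torus \<theta>) \<partial>lborel)"
    by (intro nn_integral_cong) simp
  also have "\<dots> = (\<Sum>k. \<integral>\<^sup>+\<theta>. F (\<theta> + lattice_point k) * indicator torus \<theta> \<partial>lborel)"
    by (rule nn_integral_suminf) measurable
  also have "\<dots> = (\<Sum>k. \<integral>\<^sup>+\<theta>. F \<theta> * indicator torus (\<theta> - lattice_point k) \<partial>lborel)"
  proof (rule suminf_cong)
    fix k
    show "(\<integral>\<^sup>+\<theta>. F (\<theta> + lattice_point k) * indicator torus \<theta> \<partial>lborel) = (\<integral>\<^sup>+\<theta>. F \<theta> * indicator torus (\<theta> - lattice_point k) \<partial>lborel)"
      by (subst nn_integral_lborel_shift[of "\<lambda>\<theta>. F \<theta> * indicator torus (\<theta> - lattice_point k)" "lattice_point k", symmetric])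
        simp_all
  qed
  also have "\<dots> = (\<integral>\<^sup>+\<theta>. (\<Sum>k. F \<theta> * indicator torus (\<theta> - lattice_point k)) \<partial>lborel)"
    by (rule nn_integral_suminf[symmetric]) measurable
  also have "\<dots> = (\<integral>\<^sup>+\<theta>. F \<theta> \<partial>lborel)"
  proof (rule nn_integral_cong)
    fix \<theta> :: "real^'d"
    have "(\<Sum>k. F \<theta> * indicator torus (\<theta> - lattice_point k)) = (\<Sum>k. if \<theta> - lattice_point k \<in> torus then F \<theta> else 0)"
      by (intro suminf_cong) (simp add: indicator_def)
    also have "\<dots> = F \<theta>" by (rule suminf_indicator_ex1[OF ex1_lattice_point'])
    finally show "(\<Sum>k. F \<theta> * indicator torus (\<theta> - lattice_point k)) = F \<theta>" .
  qed
  finally show ?thesis ..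
qed

text \<open>The shifted cell is again a fundamental domain: folding it back by
  \<open>nn_integral_torus_tiling\<close>, each point of the cell is hit by exactly one lattice
  translate.\<close>

lemma nn_integral_torus_shift:
  fixes F :: "real^'d \<Rightarrow> ennreal"
  assumes [measurable]: "F \<in> borel_measurable borel" and per: "torus_periodic F"
  shows "(\<integral>\<^sup>+\<theta>\<in>torus. F (\<theta> + c) \<partial>lborel) = (\<integral>\<^sup>+\<theta>\<in>torus. F \<theta> \<partial>lborel)"
proof -
  have "(\<integral>\<^sup>+\<theta>\<in>torus. F (\<theta> + c) \<partial>lborel) = (\<integral>\<^sup>+\<theta>. F \<theta> * indicator torus (\<theta> - c) \<partial>lborel)"
    by (subst nn_integral_lborel_shift[of "\<lambda>\<theta>. F \<theta> * indicator torus (\<theta> - c)" c, symmetric]) simp_all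
  also have "\<dots> = (\<integral>\<^sup>+\<theta>\<in>torus. (\<Sum>k. F (\<theta> + lattice_point k) * indicator torus (\<theta> + lattice_point k - c)) \<partial>lborel)"
    by (rule nn_integral_torus_tiling) measurable
  also have "\<dots> = (\<integral>\<^sup>+\<theta>\<in>torus. F \<theta> \<partial>lborel)"
  proof (intro nn_integral_cong)
    fix \<theta> :: "real^'d"
    have "(\<Sum>k. F (\<theta> + lattice_point k) * indicator torus (\<theta> + lattice_point k - c))
        = (\<Sum>k. if (\<theta> - c) + lattice_point k \<in> torus then F \<theta> else 0)"
      by (intro suminf_cong) (simp add: indicator_def torus_periodic_lattice_point[OF per] algebra_simps)
    also have "\<dots> = F \<theta>" by (rule suminf_indicator_ex1[OF ex1_lattice_point])
    finally show "(\<Sum>k. F (\<theta> + lattice_point k) * indicator torus (\<theta> + lattice_point k - c)) * indicator torus \<theta>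
        = F \<theta> * indicator torus \<theta>" by simp
  qed
  finally show ?thesis .
qed

text \<open>Nonresonance says that the components of \<open>\<omega>\<close> are linearly
  independent over the integers. Kronecker's theorem with a real time parameter then approximates
  any target modulo the lattice, after division by \<open>2 * pi\<close>.\<close>

lemma Kronecker_flow:
  fixes \<omega> \<alpha> :: "real^'d"
  assumes "nonresonant \<omega>" "\<epsilon> > 0"
  shows "\<exists>t l. norm (t *\<^sub>R \<omega> - (2 * pi) *\<^sub>R int_vec l - \<alpha>) < \<epsilon>"
proof -
  let ?d = "CARD('d)"
  obtain e :: "nat \<Rightarrow> 'd" where e: "bij_betw e {..<?d} UNIV"
    using ex_bij_betw_nat_finite[OF finite, of "UNIV :: 'd set"] unfolding atLeast0LessThan by blast
  define g where "g = the_inv_into {..<?d} e"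
  have g: "g j < ?d" "e (g j) = j" for j
    using bij_betwE[OF bij_betw_the_inv_into[OF e]] f_the_inv_into_f_bij_betw[OF e] by (auto simp: g_def)
  have ge: "g (e i) = i" if "i < ?d" for i
    using e that by (auto simp: g_def bij_betw_def the_inv_into_f_f)
  have comb: "c = 0" if "(\<Sum>j\<in>UNIV. real_of_int (c $ j) * (\<omega> $ j)) = 0" for c :: "int^'d"
  proof (rule ccontr)
    assume "c \<noteq> 0"
    then have "\<omega> \<bullet> int_vec c \<noteq> 0" using assms(1) by (simp add: nonresonant_def)
    then show False using that by (simp add: inner_vec_def int_vec_def mult.commute)
  qed
  define \<theta> where "\<theta> i = \<omega> $ (e i) / (2 * pi)" for i
  \<comment> \<open>Two equal components of \<open>\<omega>\<close> would be annihilated by a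
    difference of unit vectors, which nonresonance forbids.\<close>
  have inj: "inj_on \<theta> {..<?d}"
  proof (rule inj_onI)
    fix i j assume ij: "i \<in> {..<?d}" "j \<in> {..<?d}" "\<theta> i = \<theta> j"
    show "i = j"
    proof (rule ccontr)
      assume "i \<noteq> j"
      then have ne: "e i \<noteq> e j" using ij e by (auto simp: bij_betw_def inj_on_def)
      define c :: "int^'d" where "c = axis (e i) 1 - axis (e j) 1"
      have eq: "\<omega> $ e i = \<omega> $ e j" using ij by (simp add: \<theta>_def)
      have "(\<Sum>k\<in>UNIV. real_of_int (c $ k) * (\<omega> $ k)) = (\<Sum>k\<in>UNIV. (if k = e i then \<omega> $ k else 0) - (if k = e j then \<omega> $ k else 0))"
        by (intro sum.cong) (auto simp: c_def axis_def)
      also have "\<dots> = 0" using eq by (simp add: sum_subtractf)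
      finally have "c = 0" by (rule comb)
      moreover have "c $ e i = 1" using ne by (simp add: c_def axis_def)
      ultimately show False by simp
    qed
  qed
  interpret M: Modules.module "(\<lambda>r. (*) (real_of_int r))"
    by (simp add: Modules.module.intro distrib_left mult.commute)
  have ind: "M.independent (\<theta> ` {..<?d})"
  proof (rule ccontr)
    assume "\<not> ?thesis"
    then obtain u v where u: "v \<in> \<theta> ` {..<?d}" "u v \<noteq> 0" "(\<Sum>v\<in>\<theta> ` {..<?d}. real_of_int (u v) * v) = 0"
      using M.dependent_finite[of "\<theta> ` {..<?d}"] by auto
    define c :: "int^'d" where "c = (\<chi> j. u (\<theta> (g j)))"
    have "(\<Sum>j\<in>UNIV. real_of_int (c $ j) * (\<omega> $ j)) = (\<Sum>i<?d. real_of_int (c $ e i) * (\<omega> $ e i))"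
      by (rule sum.reindex_bij_betw[OF e, symmetric])
    also have "\<dots> = (\<Sum>i<?d. 2 * pi * (real_of_int (u (\<theta> i)) * \<theta> i))"
      by (intro sum.cong) (auto simp: c_def ge \<theta>_def)
    also have "\<dots> = 2 * pi * (\<Sum>v\<in>\<theta> ` {..<?d}. real_of_int (u v) * v)"
      by (simp add: sum_distrib_left sum.reindex[OF inj])
    also have "\<dots> = 0" using u by simp
    finally have "c = 0" by (rule comb)
    moreover obtain i where "i < ?d" "v = \<theta> i" using u(1) by auto
    then have "c $ e i = u v" by (simp add: c_def ge)
    ultimately show False using u(2) by simp
  qed
  \<comment> \<open>The norm is at most the sum of the \<open>d\<close> coordinate errors, each of
    which is scaled by \<open>2 * pi\<close>.\<close>
  define \<epsilon>' where "\<epsilon>' = \<epsilon> / (2 * pi * real ?d)"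
  have d0: "real ?d > 0" by simp
  have e': "\<epsilon>' > 0" using assms(2) by (simp add: \<epsilon>'_def)
  obtain t h where th: "\<And>i. i < ?d \<Longrightarrow> \<bar>t * \<theta> i - of_int (h i) - \<alpha> $ (e i) / (2 * pi)\<bar> < \<epsilon>'"
    using Kronecker_thm_1[OF ind inj e', of "\<lambda>i. \<alpha> $ (e i) / (2 * pi)"] by blast
  define l :: "int^'d" where "l = (\<chi> j. h (g j))"
  have comp: "\<bar>(t *\<^sub>R \<omega> - (2 * pi) *\<^sub>R int_vec l - \<alpha>) $ j\<bar> < 2 * pi * \<epsilon>'" for j
  proof -
    have "(t *\<^sub>R \<omega> - (2 * pi) *\<^sub>R int_vec l - \<alpha>) $ j = 2 * pi * (t * \<theta> (g j) - of_int (h (g j)) - \<alpha> $ (e (g j)) / (2 * pi))"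
      by (simp add: \<theta>_def g l_def int_vec_def algebra_simps)
    then have "\<bar>(t *\<^sub>R \<omega> - (2 * pi) *\<^sub>R int_vec l - \<alpha>) $ j\<bar> = 2 * pi * \<bar>t * \<theta> (g j) - of_int (h (g j)) - \<alpha> $ (e (g j)) / (2 * pi)\<bar>"
      by (simp add: abs_mult)
    then show ?thesis using th[OF g(1)[of j]] by simp
  qed
  have "norm (t *\<^sub>R \<omega> - (2 * pi) *\<^sub>R int_vec l - \<alpha>) \<le> (\<Sum>j\<in>UNIV. \<bar>(t *\<^sub>R \<omega> - (2 * pi) *\<^sub>R int_vec l - \<alpha>) $ j\<bar>)"
    by (rule norm_le_l1_cart)
  also have "\<dots> < (\<Sum>j\<in>(UNIV::'d set). 2 * pi * \<epsilon>')" by (intro sum_strict_mono comp) auto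
  also have "\<dots> = \<epsilon>" by (simp add: \<epsilon>'_def)
  finally show ?thesis by blast
qed

section \<open>Time averages of continuous functions along the flow\<close>

lemma torus_periodic_continuous_bounded:
  fixes F :: "real^'d \<Rightarrow> real"
  assumes "torus_periodic F" "continuous_on UNIV F"
  obtains M where "0 < M" "\<And>\<theta>. \<bar>F \<theta>\<bar> \<le> M"
proof -
  have "compact (F ` cbox 0 (\<chi> i. 2 * pi))"
    by (intro compact_continuous_image continuous_on_subset[OF assms(2)]) auto
  then obtain M where M: "\<And>\<theta>. \<theta> \<in> cbox 0 (\<chi> i. 2 * pi) \<Longrightarrow> \<bar>F \<theta>\<bar> \<le> M"
    using compact_imp_bounded bounded_iff by (metis imageI real_norm_def)
  have "\<bar>F \<theta>\<bar> \<le> \<bar>M\<bar> + 1" for \<theta>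
  proof -
    obtain k where "\<theta> + lattice_point k \<in> torus" using ex1_lattice_point by blast
    then have "\<bar>F (\<theta> + lattice_point k)\<bar> \<le> M" using M torus_subset_cbox by blast
    then show ?thesis by (simp add: torus_periodic_lattice_point[OF assms(1)])
  qed
  then show ?thesis using that[of "\<bar>M\<bar> + 1"] by auto
qed

lemma torus_periodic_uniformly_continuous:
  fixes F :: "real^'d \<Rightarrow> real"
  assumes "torus_periodic F" "continuous_on UNIV F" "\<epsilon> > 0"
  obtains \<delta> where "0 < \<delta>" "\<And>x y. dist x y < \<delta> \<Longrightarrow> \<bar>F x - F y\<bar> < \<epsilon>"
proof -
  have "bounded (torus :: (real^'d) set)" by (rule bounded_subset[OF bounded_cbox torus_subset_cbox])
  then obtain R where "\<forall>x\<in>(torus :: (real^'d) set). norm x \<le> R" unfolding bounded_iff by blast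
  then have R: "torus \<subseteq> cball (0::real^'d) R" by auto
  \<comment> \<open>The extra radius 1 leaves room for the second point, which is within distance 1
    of a point of the cell.\<close>
  have "uniformly_continuous_on (cball 0 (R + 1)) F"
    by (intro compact_uniformly_continuous continuous_on_subset[OF assms(2)]) auto
  then obtain \<delta> where \<delta>: "\<delta> > 0" "\<And>x y. x \<in> cball 0 (R + 1) \<Longrightarrow> y \<in> cball 0 (R + 1) \<Longrightarrow> dist x y < \<delta> \<Longrightarrow> dist (F x) (F y) < \<epsilon>"
    using assms(3) unfolding uniformly_continuous_on_def by metis
  show ?thesis
  proof (rule that[of "min \<delta> 1"])
    show "0 < min \<delta> 1" using \<delta> by simp
    fix x y :: "real^'d" assume xy: "dist x y < min \<delta> 1"
    obtain k where k: "x + lattice_point k \<in> torus" using ex1_lattice_point by blast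
    have d: "dist (x + lattice_point k) (y + lattice_point k) = dist x y" by (simp add: dist_norm)
    have "norm (x + lattice_point k) \<le> R" using k R by auto
    moreover have "norm (y + lattice_point k) \<le> norm (x + lattice_point k) + dist (x + lattice_point k) (y + lattice_point k)"
      by (metis dist_0_norm dist_commute dist_triangle2 add.commute)
    ultimately have "dist (F (x + lattice_point k)) (F (y + lattice_point k)) < \<epsilon>"
      using xy d by (intro \<delta>(2)) auto
    then show "\<bar>F x - F y\<bar> < \<epsilon>"
      by (simp add: torus_periodic_lattice_point[OF assms(1)] dist_real_def)
  qed
qed

text \<open>Averages over a long orbit segment almost do not depend on the starting point, because some
  bounded piece of the orbit is dense in the torus up to a given error.\<close>

lemma flow_average_almost_constant:
  fixes F :: "real^'d \<Rightarrow> real"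
  assumes \<omega>: "nonresonant \<omega>" and per: "torus_periodic F" and cont: "continuous_on UNIV F" and "\<epsilon> > 0"
  obtains B where "0 < B" "\<And>\<theta> T. \<theta> \<in> torus \<Longrightarrow> 0 \<le> T \<Longrightarrow>
    \<bar>integral {0..T} (\<lambda>x. F (\<theta> + x *\<^sub>R \<omega>)) - integral {0..T} (\<lambda>x. F (x *\<^sub>R \<omega>))\<bar> \<le> \<epsilon> * T + B"
proof -
  obtain M where M: "0 < M" "\<And>\<theta>. \<bar>F \<theta>\<bar> \<le> M" using torus_periodic_continuous_bounded[OF per cont] by blast
  obtain \<delta> where \<delta>: "0 < \<delta>" "\<And>x y. dist x y < \<delta> \<Longrightarrow> \<bar>F x - F y\<bar> < \<epsilon>"
    using torus_periodic_uniformly_continuous[OF per cont \<open>\<epsilon> > 0\<close>] by blast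
  have "compact (cbox 0 (\<chi> i. 2 * pi) :: (real^'d) set)" by (rule compact_cbox)
  moreover have "cbox 0 (\<chi> i. 2 * pi) \<subseteq> (\<Union>\<alpha>\<in>cbox 0 (\<chi> i. 2 * pi). ball (\<alpha>::real^'d) (\<delta>/2))"
  proof
    fix x :: "real^'d" assume "x \<in> cbox 0 (\<chi> i. 2 * pi)"
    then show "x \<in> (\<Union>\<alpha>\<in>cbox 0 (\<chi> i. 2 * pi). ball \<alpha> (\<delta>/2))" using \<delta>(1) by (intro UN_I[of x]) auto
  qed
  ultimately obtain N where N: "finite N" "cbox 0 (\<chi> i. 2 * pi) \<subseteq> (\<Union>\<alpha>\<in>N. ball (\<alpha>::real^'d) (\<delta>/2))"
    by (rule compactE_image[OF _ open_ball])
  have "\<forall>\<alpha>. \<exists>t l. norm (t *\<^sub>R \<omega> - (2 * pi) *\<^sub>R int_vec l - \<alpha>) < \<delta>/2"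
    using Kronecker_flow[OF \<omega>, of "\<delta>/2"] \<delta>(1) by auto
  then obtain t l where tl: "\<And>\<alpha>. norm (t \<alpha> *\<^sub>R \<omega> - (2 * pi) *\<^sub>R int_vec (l \<alpha>) - \<alpha>) < \<delta>/2" by metis
  \<comment> \<open>Only finitely many net points are used, so the times leading near them have a
    common bound; multiplied by \<open>2 * M\<close> it becomes the constant
    \<open>B\<close>.\<close>
  obtain B0 where B0: "\<And>\<alpha>. \<alpha> \<in> N \<Longrightarrow> \<bar>t \<alpha>\<bar> \<le> B0" "0 < B0"
  proof (rule that[of "(\<Sum>\<alpha>\<in>N. \<bar>t \<alpha>\<bar>) + 1"])
    show "\<bar>t \<alpha>\<bar> \<le> (\<Sum>\<alpha>\<in>N. \<bar>t \<alpha>\<bar>) + 1" if "\<alpha> \<in> N" for \<alpha>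
      using member_le_sum[OF that, of "\<lambda>\<alpha>. \<bar>t \<alpha>\<bar>"] N(1) by simp
    show "0 < (\<Sum>\<alpha>\<in>N. \<bar>t \<alpha>\<bar>) + 1" by (simp add: sum_nonneg add_nonneg_pos)
  qed
  have contl: "continuous_on A (\<lambda>x. F (\<theta> + x *\<^sub>R \<omega>))" for A \<theta>
    by (rule continuous_on_compose2[OF cont]) (auto intro!: continuous_intros)
  have int: "(\<lambda>x. F (\<theta> + x *\<^sub>R \<omega>)) integrable_on {a..b}" for \<theta> a b
    by (rule integrable_continuous_real[OF contl])
  have int0: "(\<lambda>x. F (x *\<^sub>R \<omega>)) integrable_on {a..b}" for a b using int[of 0] by simp
  have bnd: "\<bar>integral {a..b} (\<lambda>x. F (x *\<^sub>R \<omega>))\<bar> \<le> M * (b - a)" if "a \<le> b" for a b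
    using integral_bound[OF that, of "\<lambda>x. F (x *\<^sub>R \<omega>)" M] contl[of "{a..b}" 0] M(2) by simp
  \<comment> \<open>Exchanging the window \<open>{s..T + s}\<close> for \<open>{0..T}\<close> costs
    two end intervals of length \<open>\<bar>s\<bar>\<close>.\<close>
  have shift: "\<bar>integral {s..T + s} (\<lambda>x. F (x *\<^sub>R \<omega>)) - integral {0..T} (\<lambda>x. F (x *\<^sub>R \<omega>))\<bar> \<le> 2 * M * \<bar>s\<bar>"
    if "0 \<le> T" for s T
  proof -
    let ?I = "\<lambda>a b. integral {a..b} (\<lambda>x. F (x *\<^sub>R \<omega>))"
    have comb: "?I a b + ?I b c = ?I a c" if "a \<le> b" "b \<le> c" for a b c
      by (rule Henstock_Kurzweil_Integration.integral_combine[OF that int0])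
    show ?thesis
    proof (cases "0 \<le> s")
      case True
      have "?I 0 s + ?I s (T + s) = ?I 0 T + ?I T (T + s)"
        using comb[of 0 s "T + s"] comb[of 0 T "T + s"] True that by simp
      then show ?thesis using bnd[of 0 s] bnd[of T "T + s"] True that by (simp add: abs_le_iff)
    next
      case False
      have "?I s (T + s) + ?I (T + s) T = ?I s 0 + ?I 0 T"
        using comb[of s "T + s" T] comb[of s 0 T] False that by simp
      then show ?thesis using bnd[of s 0] bnd[of "T + s" T] False that by (simp add: abs_le_iff)
    qed
  qed
  have main: "\<bar>integral {0..T} (\<lambda>x. F (\<theta> + x *\<^sub>R \<omega>)) - integral {0..T} (\<lambda>x. F (x *\<^sub>R \<omega>))\<bar> \<le> \<epsilon> * T + 2 * M * B0"
    if \<theta>: "\<theta> \<in> torus" and T: "0 \<le> T" for \<theta> T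
  proof -
    obtain \<alpha> where \<alpha>: "\<alpha> \<in> N" "dist \<alpha> \<theta> < \<delta>/2" using N(2) \<theta> torus_subset_cbox by fastforce
    let ?s = "t \<alpha>" and ?l = "(2 * pi) *\<^sub>R int_vec (l \<alpha>)"
    have eq: "?s *\<^sub>R \<omega> - ?l - \<theta> = (?s *\<^sub>R \<omega> - ?l - \<alpha>) + (\<alpha> - \<theta>)" by simp
    have "norm (?s *\<^sub>R \<omega> - ?l - \<theta>) \<le> norm (?s *\<^sub>R \<omega> - ?l - \<alpha>) + norm (\<alpha> - \<theta>)"
      by (subst eq) (rule norm_triangle_ineq)
    then have near: "norm (?s *\<^sub>R \<omega> - ?l - \<theta>) < \<delta>" using tl[of \<alpha>] \<alpha>(2) by (simp add: dist_norm)
    \<comment> \<open>Modulo the lattice, the orbit of 0 delayed by \<open>t \<alpha>\<close> stays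
      within \<open>\<delta>\<close> of the orbit of \<open>\<theta>\<close> for all times, since
      the flow is a translation.\<close>
    have close: "\<bar>F (\<theta> + x *\<^sub>R \<omega>) - F ((x + ?s) *\<^sub>R \<omega>)\<bar> \<le> \<epsilon>" for x
    proof -
      have "F ((x + ?s) *\<^sub>R \<omega>) = F ((x *\<^sub>R \<omega> + (?s *\<^sub>R \<omega> - ?l)) + ?l)" by (simp add: algebra_simps)
      also have "\<dots> = F (x *\<^sub>R \<omega> + (?s *\<^sub>R \<omega> - ?l))" using per unfolding torus_periodic_def by blast
      finally have eq: "F ((x + ?s) *\<^sub>R \<omega>) = F (x *\<^sub>R \<omega> + (?s *\<^sub>R \<omega> - ?l))" .
      have "(x *\<^sub>R \<omega> + (?s *\<^sub>R \<omega> - ?l)) - (\<theta> + x *\<^sub>R \<omega>) = ?s *\<^sub>R \<omega> - ?l - \<theta>" by simp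
      then have "dist (\<theta> + x *\<^sub>R \<omega>) (x *\<^sub>R \<omega> + (?s *\<^sub>R \<omega> - ?l)) < \<delta>"
        using near by (metis dist_commute dist_norm)
      from \<delta>(2)[OF this] show ?thesis unfolding eq by (rule less_imp_le)
    qed
    have "integral {0..T} (\<lambda>x. F ((x + ?s) *\<^sub>R \<omega>)) = integral {?s..T + ?s} (\<lambda>x. F (x *\<^sub>R \<omega>))"
      using integral_shift_Icc_real[of 0 T "\<lambda>x. F (x *\<^sub>R \<omega>)" ?s] by (simp add: o_def add.commute)
    moreover have "(\<lambda>x. F ((x + ?s) *\<^sub>R \<omega>)) integrable_on {0..T}"
      using int[of "?s *\<^sub>R \<omega>" 0 T] by (simp add: algebra_simps)
    ultimately have e1: "integral {0..T} (\<lambda>x. F (\<theta> + x *\<^sub>R \<omega>)) - integral {?s..T + ?s} (\<lambda>x. F (x *\<^sub>R \<omega>))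
        = integral {0..T} (\<lambda>x. F (\<theta> + x *\<^sub>R \<omega>) - F ((x + ?s) *\<^sub>R \<omega>))"
      using int by (simp add: Henstock_Kurzweil_Integration.integral_diff)
    have e2: "\<bar>integral {0..T} (\<lambda>x. F (\<theta> + x *\<^sub>R \<omega>) - F ((x + ?s) *\<^sub>R \<omega>))\<bar> \<le> \<epsilon> * (T - 0)"
    proof -
      have "continuous_on {0..T} (\<lambda>x. F (\<theta> + x *\<^sub>R \<omega>) - F ((x + ?s) *\<^sub>R \<omega>))"
        using contl[of "{0..T}" "?s *\<^sub>R \<omega>"] by (intro continuous_on_diff contl) (simp add: algebra_simps)
      from integral_bound[OF T this, of \<epsilon>] show ?thesis using close by simp
    qed
    have e3: "2 * M * \<bar>?s\<bar> \<le> 2 * M * B0" using B0(1)[OF \<alpha>(1)] M by (intro mult_left_mono) auto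
    have comb: "\<bar>A - C\<bar> \<le> \<epsilon> * T + b" if "A - B = D" "\<bar>D\<bar> \<le> \<epsilon> * (T - 0)" "\<bar>B - C\<bar> \<le> c" "c \<le> b" for A B C D b c
      using that by (simp add: abs_le_iff)
    show ?thesis by (rule comb[OF e1 e2 shift[OF T] e3])
  qed
  show ?thesis by (rule that[of "2 * M * B0"]) (use M B0 main in auto)
qed

text \<open>Fubini, and the translation invariance of the torus integral at each time
  \<open>x\<close>.\<close>

lemma nn_integral_torus_flow_integral:
  fixes F :: "real^'d \<Rightarrow> real"
  assumes per: "torus_periodic F" and cont: "continuous_on UNIV F" and F0: "\<And>\<theta>. 0 \<le> F \<theta>" and T: "0 \<le> T"
  shows "(\<integral>\<^sup>+\<theta>\<in>torus. ennreal (integral {0..T} (\<lambda>x. F (\<theta> + x *\<^sub>R \<omega>))) \<partial>lborel)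
    = ennreal T * (\<integral>\<^sup>+\<theta>\<in>torus. ennreal (F \<theta>) \<partial>lborel)"
proof -
  let ?J = "\<integral>\<^sup>+\<theta>\<in>torus. ennreal (F \<theta>) \<partial>lborel"
  let ?G = "\<lambda>T \<theta>. integral {0..T} (\<lambda>x. F (\<theta> + x *\<^sub>R \<omega>))"
  have [measurable]: "F \<in> borel_measurable borel" by (rule borel_measurable_continuous_onI[OF cont])
  have contl: "continuous_on A (\<lambda>x. F (\<theta> + x *\<^sub>R \<omega>))" for A \<theta>
    by (rule continuous_on_compose2[OF cont]) (auto intro!: continuous_intros)
  have int: "(\<lambda>x. F (\<theta> + x *\<^sub>R \<omega>)) integrable_on {a..b}" for \<theta> a b
    by (rule integrable_continuous_real[OF contl])
  have G: "(\<integral>\<^sup>+x. ennreal (F (\<theta> + x *\<^sub>R \<omega>)) * indicator {0..T} x \<partial>lborel) = ennreal (?G T \<theta>)" for \<theta> T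
    by (rule nn_integral_has_integral_lebesgue'[OF F0 integrable_integral[OF int]])
    have "(\<integral>\<^sup>+\<theta>. ennreal (?G T \<theta>) * indicator torus \<theta> \<partial>lborel)
        = (\<integral>\<^sup>+\<theta>. \<integral>\<^sup>+x. ennreal (F (\<theta> + x *\<^sub>R \<omega>)) * indicator torus \<theta> * indicator {0..T} x \<partial>lborel \<partial>lborel)"
    proof (rule nn_integral_cong)
      fix \<theta> :: "real^'d"
      have "(\<integral>\<^sup>+x. ennreal (F (\<theta> + x *\<^sub>R \<omega>)) * indicator torus \<theta> * indicator {0..T} x \<partial>lborel)
          = (\<integral>\<^sup>+x. (ennreal (F (\<theta> + x *\<^sub>R \<omega>)) * indicator {0..T} x) * indicator torus \<theta> \<partial>lborel)"
        by (intro nn_integral_cong) (simp add: mult_ac)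
      also have "\<dots> = ennreal (?G T \<theta>) * indicator torus \<theta>"
        unfolding G[symmetric] by (rule nn_integral_multc) measurable
      finally show "ennreal (?G T \<theta>) * indicator torus \<theta>
          = (\<integral>\<^sup>+x. ennreal (F (\<theta> + x *\<^sub>R \<omega>)) * indicator torus \<theta> * indicator {0..T} x \<partial>lborel)" ..
    qed
    also have "\<dots> = (\<integral>\<^sup>+x. \<integral>\<^sup>+\<theta>. ennreal (F (\<theta> + x *\<^sub>R \<omega>)) * indicator torus \<theta> * indicator {0..T} x \<partial>lborel \<partial>lborel)"
      by (rule lborel_pair.Fubini') measurable
    also have "\<dots> = (\<integral>\<^sup>+x. ?J * indicator {0..T} x \<partial>(lborel :: real measure))"
    proof (rule nn_integral_cong)
      fix x :: real
      have "(\<integral>\<^sup>+\<theta>\<in>torus. ennreal (F (\<theta> + x *\<^sub>R \<omega>)) \<partial>lborel) = ?J"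
        by (rule nn_integral_torus_shift[of "\<lambda>\<theta>. ennreal (F \<theta>)"])
          (use per in \<open>auto simp: torus_periodic_def\<close>)
      then show "(\<integral>\<^sup>+\<theta>. ennreal (F (\<theta> + x *\<^sub>R \<omega>)) * indicator torus \<theta> * indicator {0..T} x \<partial>lborel) = ?J * indicator {0..T} x"
        by (subst nn_integral_multc) auto
    qed
    also have "\<dots> = ennreal T * ?J"
      using T by (subst nn_integral_cmult_indicator) (simp_all add: mult.commute)
    finally show ?thesis .
qed

text \<open>The time average from \<open>\<theta>\<close> differs from the one from 0 by at most
  \<open>\<epsilon> + B / T\<close>. Averaging over all \<open>\<theta>\<close> in the torus turns
  the former into the exact space mean, so the orbit of 0 inherits it in the limit.\<close>

theorem flow_equidistribution:
  fixes F :: "real^'d \<Rightarrow> real"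
  assumes \<omega>: "nonresonant \<omega>" and per: "torus_periodic F" and cont: "continuous_on UNIV F"
    and F0: "\<And>\<theta>. 0 \<le> F \<theta>"
  shows "((\<lambda>T. integral {0..T} (\<lambda>x. F (x *\<^sub>R \<omega>)) / T) \<longlongrightarrow>
    enn2real (\<integral>\<^sup>+\<theta>\<in>torus. ennreal (F \<theta>) \<partial>lborel) / (2 * pi) ^ CARD('d)) at_top"
proof -
  let ?V = "(2 * pi) ^ CARD('d) :: real" and ?J = "\<integral>\<^sup>+\<theta>\<in>torus. ennreal (F \<theta>) \<partial>lborel"
  let ?G = "\<lambda>T \<theta>. integral {0..T} (\<lambda>x. F (\<theta> + x *\<^sub>R \<omega>))"
  have V: "?V > 0" by simp
  have [measurable]: "F \<in> borel_measurable borel" by (rule borel_measurable_continuous_onI[OF cont])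
  obtain M where M: "0 < M" "\<And>\<theta>. \<bar>F \<theta>\<bar> \<le> M" using torus_periodic_continuous_bounded[OF per cont] by blast
  have "?J \<le> (\<integral>\<^sup>+\<theta>. ennreal M * indicator (torus :: (real^'d) set) \<theta> \<partial>lborel)"
    using M by (intro nn_integral_mono mult_right_mono ennreal_leI) (auto intro: order_trans[OF abs_ge_self])
  also have "\<dots> = ennreal M * ennreal ?V" by (simp add: nn_integral_cmult_indicator emeasure_torus)
  also have "\<dots> < top" by (simp add: ennreal_mult_less_top)
  finally obtain I where I: "?J = ennreal I" "0 \<le> I" by (cases ?J) auto
  have contl: "continuous_on A (\<lambda>x. F (\<theta> + x *\<^sub>R \<omega>))" for A \<theta>
    by (rule continuous_on_compose2[OF cont]) (auto intro!: continuous_intros)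
  have int: "(\<lambda>x. F (\<theta> + x *\<^sub>R \<omega>)) integrable_on {a..b}" for \<theta> a b
    by (rule integrable_continuous_real[OF contl])
  have mean: "(\<integral>\<^sup>+\<theta>. ennreal (?G T \<theta>) * indicator torus \<theta> \<partial>lborel) = ennreal (T * I)" if T: "0 \<le> T" for T
    using nn_integral_torus_flow_integral[OF per cont F0 T, of \<omega>] I T by (simp add: ennreal_mult)
  have key: "\<bar>T * I - ?G T 0 * ?V\<bar> \<le> (\<epsilon> * T + B) * ?V"
    if B: "\<And>\<theta>. \<theta> \<in> torus \<Longrightarrow> \<bar>?G T \<theta> - ?G T 0\<bar> \<le> \<epsilon> * T + B" and T: "0 \<le> T" for T \<epsilon> B
  proof -
    let ?e = "\<epsilon> * T + B"
    have G0: "0 \<le> ?G T \<theta>" for \<theta> using F0 by (intro integral_nonneg int)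
    have "0 \<in> (torus :: (real^'d) set)" by (simp add: torus_def)
    then have e0: "0 \<le> ?e" using B[of 0] by simp
    have nn: "0 \<le> ?G T 0 + ?e" using G0[of 0] e0 by (rule add_nonneg_nonneg)
    have "ennreal (T * I) \<le> (\<integral>\<^sup>+\<theta>. ennreal (?G T 0 + ?e) * indicator (torus :: (real^'d) set) \<theta> \<partial>lborel)"
      unfolding mean[OF T, symmetric]
    proof (rule nn_integral_mono)
      fix \<theta> :: "real^'d"
      show "ennreal (?G T \<theta>) * indicator torus \<theta> \<le> ennreal (?G T 0 + ?e) * indicator torus \<theta>"
        using B[of \<theta>] by (cases "\<theta> \<in> torus") (auto intro!: ennreal_leI simp: abs_le_iff)
    qed
    also have "\<dots> = ennreal ((?G T 0 + ?e) * ?V)"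
      using nn by (simp add: nn_integral_cmult_indicator emeasure_torus ennreal_mult[symmetric])
    finally have 1: "T * I \<le> (?G T 0 + ?e) * ?V"
      using nn by (subst (asm) ennreal_le_iff) auto
    have "(?G T 0 - ?e) * ?V \<le> T * I"
    proof (cases "0 \<le> ?G T 0 - ?e")
      case True
      have "ennreal ((?G T 0 - ?e) * ?V) = (\<integral>\<^sup>+\<theta>. ennreal (?G T 0 - ?e) * indicator (torus :: (real^'d) set) \<theta> \<partial>lborel)"
        using True by (simp add: nn_integral_cmult_indicator emeasure_torus ennreal_mult[symmetric])
      also have "\<dots> \<le> ennreal (T * I)"
        unfolding mean[OF T, symmetric]
      proof (rule nn_integral_mono)
        fix \<theta> :: "real^'d"
        show "ennreal (?G T 0 - ?e) * indicator torus \<theta> \<le> ennreal (?G T \<theta>) * indicator torus \<theta>"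
          using B[of \<theta>] by (cases "\<theta> \<in> torus") (auto intro!: ennreal_leI simp: abs_le_iff)
      qed
      finally show ?thesis using T I by (subst (asm) ennreal_le_iff) auto
    next
      case False
      then have "(?G T 0 - ?e) * ?V \<le> 0" by (intro mult_nonpos_nonneg) auto
      also have "0 \<le> T * I" using T I by simp
      finally show ?thesis .
    qed
    then show ?thesis using 1 by (simp add: abs_le_iff algebra_simps)
  qed
  have "((\<lambda>T. ?G T 0 / T) \<longlongrightarrow> I / ?V) at_top"
  proof (rule tendstoI)
    fix e :: real assume e: "e > 0"
    obtain B where B: "0 < B" "\<And>\<theta> T. \<theta> \<in> torus \<Longrightarrow> 0 \<le> T \<Longrightarrow> \<bar>?G T \<theta> - ?G T 0\<bar> \<le> (e/2) * T + B"
      using flow_average_almost_constant[OF \<omega> per cont, of "e/2"] e by auto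
    show "\<forall>\<^sub>F T in at_top. dist (?G T 0 / T) (I / ?V) < e"
      unfolding eventually_at_top_linorder
    proof (intro exI allI impI)
      \<comment> \<open>Beyond this bound \<open>B / T < e / 2\<close>, the other half of
        \<open>e\<close> being spent on the uniform error.\<close>
      fix T assume T: "2 * B / e + 1 \<le> T"
      have T0: "T > 0" using T B(1) e by (meson add_pos_nonneg divide_pos_pos less_le_trans mult_pos_pos zero_less_numeral zero_le_one)
      have "\<bar>T * I - ?G T 0 * ?V\<bar> \<le> ((e/2) * T + B) * ?V"
        by (rule key) (use B(2) T0 in auto)
      moreover have "\<bar>?G T 0 / T - I / ?V\<bar> * (T * ?V) = \<bar>T * I - ?G T 0 * ?V\<bar>"
      proof -
        have "\<bar>?G T 0 / T - I / ?V\<bar> * (T * ?V) = \<bar>(?G T 0 / T - I / ?V) * (T * ?V)\<bar>"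
          using T0 V by (simp add: abs_mult)
        also have "(?G T 0 / T - I / ?V) * (T * ?V) = ?G T 0 * ?V - T * I"
          using T0 V by (simp add: left_diff_distrib)
        finally show ?thesis by (simp add: abs_minus_commute)
      qed
      moreover have "((e/2) * T + B) * ?V < e * (T * ?V)"
      proof -
        have "2 * B / e < T" using T by linarith
        then have "2 * B < T * e" using e by (simp add: pos_divide_less_eq)
        then have "(e/2) * T + B < e * T" by (simp add: mult.commute)
        then have "((e/2) * T + B) * ?V < (e * T) * ?V" using V by (rule mult_strict_right_mono)
        then show ?thesis by (simp only: mult.assoc)
      qed
      ultimately have "\<bar>?G T 0 / T - I / ?V\<bar> * (T * ?V) < e * (T * ?V)" by linarith
      then have "\<bar>?G T 0 / T - I / ?V\<bar> < e" by (rule mult_right_less_imp_less) (use T0 in simp)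
      then show "dist (?G T 0 / T) (I / ?V) < e" by (simp add: dist_real_def)
    qed
  qed
  then show ?thesis using I by simp
qed

section \<open>Flux through a level set\<close>

text \<open>A type with one element less than \<open>'d\<close>, so that a hyperplane of \<open>real^'d\<close> is isometric to the
  Euclidean space indexed by it.  A singleton type \<open>'d\<close> is left unchanged, since types are nonempty.\<close>

typedef ('d::finite) punctured = "{x :: 'd. CARD('d) = 1 \<or> x \<noteq> undefined}"
proof (cases "CARD('d) = 1")
  case False
  then have "\<exists>x::'d. x \<noteq> undefined"
    by (metis (full_types) UNIV_eq_I card_1_singleton_iff singletonI One_nat_def)
  then show ?thesis by auto
qed auto

instance punctured :: (finite) finite
proof
  have "(UNIV :: 'a punctured set) = Abs_punctured ` {x. CARD('a) = 1 \<or> x \<noteq> undefined}"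
    using type_definition.Abs_image[OF type_definition_punctured] by metis
  then show "finite (UNIV :: 'a punctured set)" by (metis finite finite_imageI)
qed

lemma card_punctured:
  assumes "CARD('d::finite) \<noteq> 1"
  shows "Suc CARD('d punctured) = CARD('d)"
proof -
  have "CARD('d punctured) = card {x :: 'd. CARD('d) = 1 \<or> x \<noteq> undefined}"
    by (rule type_definition.card[OF type_definition_punctured])
  also have "{x :: 'd. CARD('d) = 1 \<or> x \<noteq> undefined} = UNIV - {undefined}" using assms by auto
  also have "card \<dots> = CARD('d) - 1" by (simp add: card_Diff_singleton)
  finally show ?thesis using zero_less_card_finite[where 'a='d] by simp
qed

text \<open>Covers the case \<open>d = 1\<close>, where the zero set consists of points and the
  surface measure counts them.\<close>

lemma hausdorff_outer_0_singleton: "hausdorff_outer 0 {a} = 1"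
proof (rule antisym)
  have g: "hausdorff_gauge 0 A = (if A = {} then 0 else 1)" for A :: "'a set"
    by (simp add: hausdorff_gauge_def unit_ball_vol_0)
  show "hausdorff_outer 0 {a} \<le> 1"
  proof (rule hausdorff_outer_leI)
    fix \<delta> :: real assume "\<delta> > 0"
    let ?A = "\<lambda>i::nat. if i = 0 then {a} else {}"
    have "hausdorff_content 0 \<delta> {a} \<le> (\<Sum>i. hausdorff_gauge 0 (?A i))"
      by (rule hausdorff_content_le) (use \<open>\<delta> > 0\<close> in auto)
    also have "\<dots> = (\<Sum>i\<in>{0::nat}. hausdorff_gauge 0 (?A i))" by (rule suminf_finite) auto
    also have "\<dots> = 1" by (simp add: g)
    finally show "hausdorff_content 0 \<delta> {a} \<le> 1" .
  qed
  have "1 \<le> hausdorff_content 0 1 {a}"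
    unfolding hausdorff_content_def
  proof (rule INF_greatest, clarsimp)
    fix A :: "nat \<Rightarrow> 'a set" and i assume "a \<in> A i"
    then have "1 = (\<Sum>j\<in>{i}. hausdorff_gauge 0 (A j))" by (auto simp: g)
    also have "\<dots> \<le> (\<Sum>j. hausdorff_gauge 0 (A j))" by (rule sum_le_suminf) auto
    finally show "1 \<le> (\<Sum>j. hausdorff_gauge 0 (A j))" .
  qed
  also have "\<dots> \<le> hausdorff_outer 0 {a}" by (rule hausdorff_content_le_outer) simp
  finally show "1 \<le> hausdorff_outer 0 {a}" .
qed

lemma flow_strip_singleton_dim_1:
  fixes n \<omega> a :: "real^'d"
  assumes dim: "CARD('d) = 1" and n: "norm n = 1" and h: "0 \<le> h"
  shows "emeasure lborel (flow_strip \<omega> h {a}) = ennreal (h * \<bar>\<omega> \<bullet> n\<bar>)"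
proof -
  have dim': "DIM(real) = CARD('d)" using dim by simp
  obtain J :: "real \<Rightarrow> real^'d" where J: "linear J" "\<And>u v. J u \<bullet> J v = u \<bullet> v" "surj J" "J 1 = n"
    "distr lborel borel J = lborel"
    using isometric_coordinates[OF dim' _ n, of 1] by auto
  obtain \<alpha> w where aw: "a = J \<alpha>" "\<omega> = J w" using J(3) by (metis surj_def)
  have c: "\<omega> \<bullet> n = w" using J(2)[of w 1] J(4) aw by simp
  have inj: "u = v" if "J u = J v" for u v
    using J(2)[of "u - v" "u - v"] linear_diff[OF J(1), of u v] that by simp
  have Jx: "a - x *\<^sub>R \<omega> = J (\<alpha> - x * w)" for x
    using linear_diff[OF J(1)] linear_scale[OF J(1), of x w] by (simp add: aw)
  let ?W = "flow_strip \<omega> h {a}"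
  have "sigma_compact {a}" unfolding sigma_compact_def by (intro exI[of _ "\<lambda>_. {a}"]) auto
  then have W: "?W \<in> sets borel" by (rule flow_strip_measurable)
  have "J -` ?W = (\<lambda>x. \<alpha> - x * w) ` {0..h}"
  proof (intro set_eqI iffI)
    fix u assume "u \<in> J -` ?W"
    then obtain x where x: "x \<in> {0..h}" "J u = J (\<alpha> - x * w)" by (auto simp: flow_strip_def Jx)
    then show "u \<in> (\<lambda>x. \<alpha> - x * w) ` {0..h}" using inj[OF x(2)] by blast
  next
    fix u assume "u \<in> (\<lambda>x. \<alpha> - x * w) ` {0..h}"
    then obtain x where x: "x \<in> {0..h}" "u = \<alpha> - x * w" by blast
    then have "J u = a - x *\<^sub>R \<omega>" by (simp add: Jx)
    then show "u \<in> J -` ?W" using x(1) unfolding flow_strip_def by blast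
  qed
  also have "\<dots> = {min \<alpha> (\<alpha> - h * w) .. max \<alpha> (\<alpha> - h * w)}"
  proof (cases "w = 0")
    case True then show ?thesis using h by (auto simp: image_iff)
  next
    case False
    show ?thesis
    proof (intro set_eqI iffI)
      fix t assume "t \<in> (\<lambda>x. \<alpha> - x * w) ` {0..h}"
      then obtain x where x': "t = \<alpha> - x * w" "x \<in> {0..h}" by (rule imageE)
      then have x: "t = \<alpha> - x * w" "0 \<le> x" "x \<le> h" by simp_all
      show "t \<in> {min \<alpha> (\<alpha> - h * w) .. max \<alpha> (\<alpha> - h * w)}"
      proof (cases "0 \<le> w")
        case True
        then have "0 \<le> x * w" "x * w \<le> h * w" using x by (auto intro: mult_right_mono)
        then show ?thesis using x by auto
      next
        case False
        then have "x * w \<le> 0" "h * w \<le> x * w" using x by (auto intro: mult_right_mono_neg mult_nonneg_nonpos)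
        then show ?thesis using x by auto
      qed
    next
      fix t assume t: "t \<in> {min \<alpha> (\<alpha> - h * w) .. max \<alpha> (\<alpha> - h * w)}"
      define x where "x = (\<alpha> - t) / w"
      have xw: "x * w = \<alpha> - t" using False by (simp add: x_def)
      have "0 \<le> x \<and> x \<le> h"
      proof (cases "0 < w")
        case True
        then have "0 \<le> h * w" using h by simp
        then have "0 \<le> x * w" "x * w \<le> h * w" using t unfolding xw by auto
        then show ?thesis using True by (simp add: zero_le_mult_iff)
      next
        case w: False
        then have "w < 0" using False by simp
        then have "h * w \<le> 0" using h by (simp add: mult_nonneg_nonpos)
        then have "x * w \<le> 0" "h * w \<le> x * w" using t unfolding xw by auto
        then show ?thesis using \<open>w < 0\<close> by (simp add: mult_le_0_iff)
      qed
      then show "t \<in> (\<lambda>x. \<alpha> - x * w) ` {0..h}" using xw by (intro image_eqI[of _ _ x]) auto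
    qed
  qed
  finally have pre: "J -` ?W = {min \<alpha> (\<alpha> - h * w) .. max \<alpha> (\<alpha> - h * w)}" .
  have "emeasure lborel ?W = emeasure (distr lborel borel J) ?W" by (simp add: J(5))
  also have "\<dots> = emeasure lborel (J -` ?W)"
    using W linear_borel_measurable[OF J(1)] by (subst emeasure_distr) auto
  also have "\<dots> = ennreal (max \<alpha> (\<alpha> - h * w) - min \<alpha> (\<alpha> - h * w))"
    unfolding pre by simp
  also have "max \<alpha> (\<alpha> - h * w) - min \<alpha> (\<alpha> - h * w) = h * \<bar>\<omega> \<bullet> n\<bar>"
    unfolding c using h by (cases "0 \<le> w") (auto simp: max_def min_def mult_le_0_iff zero_le_mult_iff not_le)
  finally show ?thesis .
qed

text \<open>For \<open>d \<ge> 2\<close> the hyperplane is modelled on the punctured index type. For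
  \<open>d = 1\<close> the normal component is the whole vector, so flatness with
  \<open>k < 1\<close> leaves at most one point in \<open>A\<close>, and its strip is an interval of
  length \<open>h * \<bar>\<omega> \<bullet> n\<bar>\<close>.\<close>

lemma flat_strip_hausdorff:
  fixes n \<omega> :: "real^'d" and A :: "(real^'d) set"
  assumes n: "norm n = 1" and c: "\<omega> \<bullet> n \<noteq> 0"
    and A: "sigma_compact A" "bounded A" and h: "0 \<le> h"
    and flat: "\<And>a a'. a \<in> A \<Longrightarrow> a' \<in> A \<Longrightarrow> \<bar>(a - a') \<bullet> n\<bar> * norm \<omega> \<le> k * \<bar>\<omega> \<bullet> n\<bar> * dist a a'"
    and k: "0 \<le> k" "k < 1"
  shows "emeasure lborel (flow_strip \<omega> h A)
      \<le> ennreal (h * \<bar>\<omega> \<bullet> n\<bar> * (1 + k) ^ (CARD('d) - 1)) * hausdorff_outer (CARD('d) - 1) A" (is ?U)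
    and "ennreal (h * \<bar>\<omega> \<bullet> n\<bar>) * hausdorff_outer (CARD('d) - 1) A
      \<le> ennreal ((1 / (1 - k)) ^ (CARD('d) - 1)) * emeasure lborel (flow_strip \<omega> h A)" (is ?L)
proof -
  have "?U \<and> ?L"
  proof (cases "CARD('d) = 1")
    case False
    have d: "Suc DIM(real^('d punctured)) = CARD('d)" using card_punctured[OF False] by simp
    then have e: "DIM(real^('d punctured)) = CARD('d) - 1" by simp
    show ?thesis
      using flat_strip_measure[OF d n c A h flat k] unfolding e by blast
  next
    case True
    have single: "a = a'" if "a \<in> A" "a' \<in> A" for a a'
    proof -
      have dim': "DIM(real) = CARD('d)" using True by simp
      obtain J :: "real \<Rightarrow> real^'d" where J: "\<And>u v. J u \<bullet> J v = u \<bullet> v" "surj J" "J 1 = n"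
        using isometric_coordinates[OF dim' _ n, of 1] by auto
      have full: "\<bar>v \<bullet> n\<bar> = norm v" for v
      proof -
        obtain u where "v = J u" using J(2) by (metis surj_def)
        then show ?thesis using J(1)[of u 1] J(1)[of u u] J(3) by (simp add: norm_eq_sqrt_inner)
      qed
      have "norm (a - a') * norm \<omega> \<le> k * (norm (a - a') * norm \<omega>)"
        using flat[OF that] unfolding full by (simp add: dist_norm mult_ac)
      moreover have "0 < norm \<omega>" using c by auto
      moreover have "\<not> y \<le> k * y" if "y > 0" for y :: real
        using k that by (simp add: not_le)
      ultimately have "\<not> 0 < norm (a - a') * norm \<omega>" by blast
      then show ?thesis using \<open>0 < norm \<omega>\<close> by (simp add: zero_less_mult_iff)
    qed
    show ?thesis
    proof (cases "A = {}")
      case True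
      then show ?thesis by (simp add: flow_strip_def)
    next
      case False
      then obtain a where "A = {a}" using single by blast
      then show ?thesis
        using flow_strip_singleton_dim_1[OF True n h, of \<omega> a] True by (simp add: hausdorff_outer_0_singleton)
    qed
  qed
  then show ?U ?L by auto
qed

lemma ennreal_mult_assoc: "0 \<le> a \<Longrightarrow> 0 \<le> b \<Longrightarrow> ennreal a * (ennreal b * x) = ennreal (a * b) * x"
  by (simp add: ennreal_mult mult.assoc)

definition surface_flux :: "real^'d \<Rightarrow> (real^'d \<Rightarrow> real) \<Rightarrow> (real^'d) set \<Rightarrow> ennreal" where
  "surface_flux \<omega> S A = (\<integral>\<^sup>+a\<in>A. ennreal (\<bar>dir_deriv \<omega> S a\<bar> / norm (gradient S a)) \<partial>hausdorff_measure (CARD('d) - 1))"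

text \<open>The first clause makes strips over subsets of \<open>U\<close> record each crossing
  once. The second is required of all sigma-compact pieces of the zero set in \<open>U\<close>,
  because overlapping boxes are later cut into disjoint pieces.\<close>

definition flow_box :: "real^'d \<Rightarrow> (real^'d \<Rightarrow> real) \<Rightarrow> real \<Rightarrow> (real^'d) set \<Rightarrow> bool" where
  "flow_box \<omega> S K U \<longleftrightarrow>
     (\<forall>a\<in>U. \<forall>a'\<in>U. \<forall>x. S a = 0 \<longrightarrow> S a' = 0 \<longrightarrow> a - a' = x *\<^sub>R \<omega> \<longrightarrow> a = a') \<and>
     (\<forall>A h. sigma_compact A \<longrightarrow> 0 \<le> h \<longrightarrow> A \<subseteq> U \<longrightarrow> (\<forall>a\<in>A. S a = 0) \<longrightarrow>
        emeasure lborel (flow_strip \<omega> h A) \<le> ennreal (K * h) * surface_flux \<omega> S A \<and>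
        ennreal h * surface_flux \<omega> S A \<le> ennreal K * emeasure lborel (flow_strip \<omega> h A))"

text \<open>Near \<open>p\<close> the gradient is almost constant, so by the mean value theorem
  chords of the zero set are almost orthogonal to \<open>n\<close>; this is the flatness that
  \<open>flat_strip_hausdorff\<close> requires. The flux density is \<open>\<bar>c\<bar>\<close> up
  to a factor \<open>1 + k\<close> there, so Hausdorff measure can be exchanged for flux.\<close>

lemma flow_box_exists:
  fixes S :: "real^'d \<Rightarrow> real"
  assumes S: "smooth S" and g: "dir_deriv \<omega> S p \<noteq> 0" and K: "1 < K"
  obtains r where "0 < r" "flow_box \<omega> S K (ball p r)"
proof -
  let ?m = "CARD('d) - 1"
  define N where "N = gradient S p"
  define n where "n = N /\<^sub>R norm N"
  have N0: "N \<noteq> 0" using g by (auto simp: N_def dir_deriv_def)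
  have n: "norm n = 1" using N0 by (simp add: n_def)
  define c where "c = \<omega> \<bullet> n"
  have cN: "c * norm N = dir_deriv \<omega> S p" using N0 by (simp add: c_def n_def dir_deriv_def N_def)
  have c0: "c \<noteq> 0" using g cN by auto
  have w0: "norm \<omega> > 0" using c0 by (auto simp: c_def)
  \<comment> \<open>Each product combines the distortion of the projection with the factor
    \<open>1 + k\<close> for the variation of the flux density, one for each inequality of
    \<open>flow_box\<close>.\<close>
  have "\<exists>k. 0 < k \<and> k < 1 \<and> (1 + k) ^ ?m * (1 + k) < K \<and> (1 + k) * (1 / (1 - k)) ^ ?m < K"
  proof -
    have "((\<lambda>k::real. (1 + k) ^ ?m * (1 + k)) \<longlongrightarrow> (1 + 0) ^ ?m * (1 + 0)) (at_right 0)"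
      "((\<lambda>k::real. (1 + k) * (1 / (1 - k)) ^ ?m) \<longlongrightarrow> (1 + 0) * (1 / (1 - 0)) ^ ?m) (at_right 0)"
      by (intro tendsto_intros; simp)+
    then have "\<forall>\<^sub>F k in at_right (0::real). (1 + k) ^ ?m * (1 + k) < K"
      "\<forall>\<^sub>F k in at_right (0::real). (1 + k) * (1 / (1 - k)) ^ ?m < K"
      using K by (auto elim!: order_tendstoD)
    moreover have "\<forall>\<^sub>F k in at_right (0::real). 0 < k \<and> k < 1"
      by (auto simp: eventually_at_right[of 0 1] intro: exI[of _ 1])
    ultimately have "\<forall>\<^sub>F k in at_right (0::real). (0 < k \<and> k < 1) \<and> (1 + k) ^ ?m * (1 + k) < K \<and> (1 + k) * (1 / (1 - k)) ^ ?m < K"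
      by eventually_elim auto
    then show ?thesis using eventually_happens[of _ "at_right (0::real)"] by (auto simp: trivial_limit_at_right_real)
  qed
  then obtain k where k: "0 < k" "k < 1" "(1 + k) ^ ?m * (1 + k) < K" "(1 + k) * (1 / (1 - k)) ^ ?m < K" by blast
  define \<rho> where "\<rho> a = \<bar>dir_deriv \<omega> S a\<bar> / norm (gradient S a)" for a
  have gradc: "isCont (gradient S) p"
    using continuous_gradient[OF S, of UNIV] by (simp add: continuous_on_eq_continuous_at)
  have \<rho>p: "\<rho> p = \<bar>c\<bar>"
    using N0 by (simp add: \<rho>_def cN[symmetric] N_def[symmetric] abs_mult)
  have \<rho>c: "isCont \<rho> p"
    unfolding \<rho>_def dir_deriv_def using gradc N0
    by (intro continuous_intros) (auto simp: N_def)
  \<comment> \<open>The threshold is the gradient error that, multiplied by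
    \<open>norm \<omega>\<close> and divided by \<open>norm N\<close>, becomes the factor
    \<open>k * \<bar>c\<bar>\<close> of the flatness condition.\<close>
  have "\<forall>\<^sub>F a in nhds p. norm (gradient S a - N) < k * \<bar>c\<bar> * norm N / norm \<omega>"
  proof -
    have "\<forall>\<^sub>F a in nhds p. dist (gradient S a) (gradient S p) < k * \<bar>c\<bar> * norm N / norm \<omega>"
      using gradc k c0 N0 w0 by (intro tendstoD) (auto simp: isCont_def tendsto_at_iff_tendsto_nhds)
    then show ?thesis by (simp add: dist_norm N_def)
  qed
  moreover have "\<forall>\<^sub>F a in nhds p. \<bar>c\<bar> / (1 + k) < \<rho> a" "\<forall>\<^sub>F a in nhds p. \<rho> a < (1 + k) * \<bar>c\<bar>"
  proof -
    have "(\<rho> \<longlongrightarrow> \<rho> p) (nhds p)" using \<rho>c by (simp add: isCont_def tendsto_at_iff_tendsto_nhds)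
    then have "(\<rho> \<longlongrightarrow> \<bar>c\<bar>) (nhds p)" unfolding \<rho>p .
    moreover have "\<bar>c\<bar> / (1 + k) < \<bar>c\<bar>" using k c0 by (simp add: field_simps)
    moreover have "\<bar>c\<bar> < (1 + k) * \<bar>c\<bar>" using k c0 by (simp add: field_simps)
    ultimately show "\<forall>\<^sub>F a in nhds p. \<bar>c\<bar> / (1 + k) < \<rho> a" "\<forall>\<^sub>F a in nhds p. \<rho> a < (1 + k) * \<bar>c\<bar>"
      by (auto elim!: order_tendstoD)
  qed
  ultimately have "\<forall>\<^sub>F a in nhds p. norm (gradient S a - N) < k * \<bar>c\<bar> * norm N / norm \<omega> \<and> \<bar>c\<bar> / (1 + k) < \<rho> a \<and> \<rho> a < (1 + k) * \<bar>c\<bar>"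
    by (intro eventually_conj)
  then obtain r where r: "r > 0" "\<And>a. dist a p < r \<Longrightarrow> norm (gradient S a - N) < k * \<bar>c\<bar> * norm N / norm \<omega> \<and> \<bar>c\<bar> / (1 + k) < \<rho> a \<and> \<rho> a < (1 + k) * \<bar>c\<bar>"
    unfolding eventually_nhds_metric by blast
  have flat: "\<bar>(a - a') \<bullet> n\<bar> * norm \<omega> \<le> k * \<bar>\<omega> \<bullet> n\<bar> * dist a a'"
    if a: "a \<in> ball p r" "a' \<in> ball p r" "S a = 0" "S a' = 0" for a a'
  proof -
    obtain \<xi> where \<xi>: "\<xi> \<in> closed_segment a' a" "S a - S a' = (a - a') \<bullet> gradient S \<xi>"
      using smooth_mean_value[OF S] by blast
    have "\<xi> \<in> ball p r" using \<xi>(1) a closed_segment_subset[OF _ _ convex_ball] by blast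
    then have "norm (gradient S \<xi> - N) < k * \<bar>c\<bar> * norm N / norm \<omega>" using r(2)[of \<xi>] by (simp add: dist_commute)
    then have le: "norm (gradient S \<xi> - N) * norm \<omega> \<le> k * \<bar>c\<bar> * norm N" using w0 by (simp add: pos_less_divide_eq less_imp_le)
    have "(a - a') \<bullet> N = - ((a - a') \<bullet> (gradient S \<xi> - N))" using \<xi>(2) a by (simp add: inner_diff_right)
    then have "\<bar>(a - a') \<bullet> N\<bar> \<le> norm (a - a') * norm (gradient S \<xi> - N)"
      using Cauchy_Schwarz_ineq2[of "a - a'" "gradient S \<xi> - N"] by simp
    then have "\<bar>(a - a') \<bullet> N\<bar> * norm \<omega> \<le> norm (a - a') * (norm (gradient S \<xi> - N) * norm \<omega>)"
      using w0 by (simp add: mult.assoc[symmetric])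
    also have "\<dots> \<le> norm (a - a') * (k * \<bar>c\<bar> * norm N)" by (intro mult_left_mono le) simp
    finally have *: "\<bar>(a - a') \<bullet> N\<bar> * norm \<omega> \<le> norm (a - a') * (k * \<bar>c\<bar> * norm N)" .
    have "(a - a') \<bullet> N = ((a - a') \<bullet> n) * norm N" using N0 by (simp add: n_def)
    then have "(\<bar>(a - a') \<bullet> n\<bar> * norm \<omega>) * norm N \<le> (k * \<bar>c\<bar> * dist a a') * norm N"
      using * by (simp add: abs_mult dist_norm mult_ac)
    then show ?thesis using N0 by (simp add: c_def)
  qed
  have "flow_box \<omega> S K (ball p r)"
    unfolding flow_box_def
  proof (intro conjI ballI allI impI)
    fix a a' x assume a: "a \<in> ball p r" "a' \<in> ball p r" "S a = 0" "S a' = 0" "a - a' = x *\<^sub>R \<omega>"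
    show "a = a'"
    proof (rule ccontr)
      assume "a \<noteq> a'"
      then have "0 < \<bar>x\<bar>" using a(5) by auto
      \<comment> \<open>A chord \<open>x *\<^sub>R \<omega>\<close> has normal component
        \<open>x * c\<close>, so flatness would make a positive number at most \<open>k\<close>
        times itself.\<close>
      moreover have "\<bar>x\<bar> * (\<bar>c\<bar> * norm \<omega>) \<le> k * (\<bar>x\<bar> * (\<bar>c\<bar> * norm \<omega>))"
        using flat[OF a(1-4)] unfolding dist_norm a(5) by (simp add: abs_mult c_def mult_ac)
      moreover have "\<not> y \<le> k * y" if "y > 0" for y :: real using k(2) that by (simp add: not_le)
      ultimately show False using c0 w0 by (metis mult_pos_pos zero_less_abs_iff)
    qed
  next
    fix A h assume A: "sigma_compact A" "A \<subseteq> ball p r" "\<forall>a\<in>A. S a = 0" and h: "0 \<le> (h::real)"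
    have Ab: "A \<in> sets borel" by (rule sigma_compact_borel[OF A(1)])
    have bd: "bounded A" using A(2) bounded_ball bounded_subset by blast
    let ?H = "hausdorff_outer ?m A" and ?\<mu> = "hausdorff_measure ?m :: (real^'d) measure"
    have H: "emeasure ?\<mu> A = ?H" by (rule emeasure_hausdorff_measure[OF Ab])
    have \<rho>b: "\<bar>c\<bar> / (1 + k) \<le> \<rho> a" "\<rho> a \<le> (1 + k) * \<bar>c\<bar>" if "a \<in> A" for a
      using r(2)[of a] that A(2) by (auto simp: dist_commute less_imp_le)
    have fluxle: "surface_flux \<omega> S A \<le> ennreal ((1 + k) * \<bar>c\<bar>) * ?H"
    proof -
      have "surface_flux \<omega> S A \<le> (\<integral>\<^sup>+a. ennreal ((1 + k) * \<bar>c\<bar>) * indicator A a \<partial>?\<mu>)"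
        unfolding surface_flux_def \<rho>_def[symmetric]
        by (intro nn_integral_mono) (auto simp: indicator_def intro!: ennreal_leI \<rho>b)
      also have "\<dots> = ennreal ((1 + k) * \<bar>c\<bar>) * ?H" using Ab H by (simp add: nn_integral_cmult_indicator)
      finally show ?thesis .
    qed
    have fluxge: "ennreal \<bar>c\<bar> * ?H \<le> ennreal (1 + k) * surface_flux \<omega> S A"
    proof -
      have "ennreal (\<bar>c\<bar> / (1 + k)) * ?H = (\<integral>\<^sup>+a. ennreal (\<bar>c\<bar> / (1 + k)) * indicator A a \<partial>?\<mu>)"
        using Ab H by (simp add: nn_integral_cmult_indicator)
      also have "\<dots> \<le> surface_flux \<omega> S A"
        unfolding surface_flux_def \<rho>_def[symmetric]
        by (intro nn_integral_mono) (auto simp: indicator_def intro!: ennreal_leI \<rho>b)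
      finally have "ennreal (1 + k) * (ennreal (\<bar>c\<bar> / (1 + k)) * ?H) \<le> ennreal (1 + k) * surface_flux \<omega> S A"
        by (rule mult_left_mono) simp
      moreover have "ennreal (1 + k) * (ennreal (\<bar>c\<bar> / (1 + k)) * ?H) = ennreal \<bar>c\<bar> * ?H"
      proof -
        have "(1 + k) * (\<bar>c\<bar> / (1 + k)) = \<bar>c\<bar>" using k by simp
        then show ?thesis using k by (subst ennreal_mult_assoc) simp_all
      qed
      ultimately show ?thesis by simp
    qed
    have c0': "\<omega> \<bullet> n \<noteq> 0" using c0 by (simp add: c_def)
    have flatA: "\<bar>(a - a') \<bullet> n\<bar> * norm \<omega> \<le> k * \<bar>\<omega> \<bullet> n\<bar> * dist a a'" if "a \<in> A" "a' \<in> A" for a a'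
      using flat A that by blast
    note strip = flat_strip_hausdorff[OF n c0' A(1) bd h flatA less_imp_le[OF k(1)] k(2), folded c_def]
    have "emeasure lborel (flow_strip \<omega> h A) \<le> ennreal (h * (1 + k) ^ ?m) * (ennreal \<bar>c\<bar> * ?H)"
    proof -
      have "ennreal (h * (1 + k) ^ ?m) * (ennreal \<bar>c\<bar> * ?H) = ennreal (h * (1 + k) ^ ?m * \<bar>c\<bar>) * ?H"
        by (rule ennreal_mult_assoc) (use h k in auto)
      also have "h * (1 + k) ^ ?m * \<bar>c\<bar> = h * \<bar>c\<bar> * (1 + k) ^ ?m" by simp
      finally show ?thesis using strip(1) by (simp only:)
    qed
    also have "\<dots> \<le> ennreal (h * (1 + k) ^ ?m) * (ennreal (1 + k) * surface_flux \<omega> S A)"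
      by (intro mult_left_mono fluxge) simp
    also have "\<dots> = ennreal (h * (1 + k) ^ ?m * (1 + k)) * surface_flux \<omega> S A"
      by (rule ennreal_mult_assoc) (use h k in auto)
    also have "h * (1 + k) ^ ?m * (1 + k) = ((1 + k) ^ ?m * (1 + k)) * h" by simp
    also have "ennreal \<dots> * surface_flux \<omega> S A \<le> ennreal (K * h) * surface_flux \<omega> S A"
      using k h by (intro mult_right_mono ennreal_leI) auto
    finally show "emeasure lborel (flow_strip \<omega> h A) \<le> ennreal (K * h) * surface_flux \<omega> S A" .
    have "ennreal h * surface_flux \<omega> S A \<le> ennreal h * (ennreal ((1 + k) * \<bar>c\<bar>) * ?H)"
      by (intro mult_left_mono fluxle) simp
    also have "\<dots> = ennreal (h * ((1 + k) * \<bar>c\<bar>)) * ?H"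
      by (rule ennreal_mult_assoc) (use h k in auto)
    also have "h * ((1 + k) * \<bar>c\<bar>) = (1 + k) * (h * \<bar>c\<bar>)" by simp
    also have "ennreal \<dots> * ?H = ennreal (1 + k) * (ennreal (h * \<bar>c\<bar>) * ?H)"
      by (rule ennreal_mult_assoc[symmetric]) (use h k in auto)
    also have "\<dots> \<le> ennreal (1 + k) * (ennreal ((1 / (1 - k)) ^ ?m) * emeasure lborel (flow_strip \<omega> h A))"
      by (intro mult_left_mono strip(2) zero_le)
    also have "\<dots> = ennreal ((1 + k) * (1 / (1 - k)) ^ ?m) * emeasure lborel (flow_strip \<omega> h A)"
      by (rule ennreal_mult_assoc) (use k in auto)
    also have "\<dots> \<le> ennreal K * emeasure lborel (flow_strip \<omega> h A)"
      using k by (intro mult_right_mono ennreal_leI) auto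
    finally show "ennreal h * surface_flux \<omega> S A \<le> ennreal K * emeasure lborel (flow_strip \<omega> h A)" .
  qed
  then show ?thesis using that r(1) by blast
qed

section \<open>Crossings of orbit segments\<close>

lemma vec_dim_1_inner_eq_0:
  fixes v w :: "real^'d"
  assumes "CARD('d) = 1" "v \<bullet> w = 0"
  shows "v = 0 \<or> w = 0"
proof -
  obtain i :: 'd where i: "UNIV = {i}" using assms(1) by (rule card_1_singletonE)
  have all: "j = i" for j :: 'd using i by blast
  have "v \<bullet> w = v $ i * w $ i" by (simp add: inner_vec_def i)
  then have "v $ i = 0 \<or> w $ i = 0" using assms(2) by simp
  then show ?thesis using all by (metis vec_eq_iff zero_index)
qed

text \<open>Both alternatives of the theorem take this form: under (a) the tangency set is empty,
  under (b) the order of contact is the witness.\<close>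

locale torus_crossing =
  fixes \<omega> :: "real^'d" and S :: "real^'d \<Rightarrow> real"
  assumes nonres: "nonresonant \<omega>"
    and per: "torus_periodic S"
    and smooth_S: "smooth S"
    and nonempty: "zero_surface S \<noteq> {}"
    and regular: "\<And>\<theta>. \<theta> \<in> zero_surface S \<Longrightarrow> gradient S \<theta> \<noteq> 0"
    and finite_tangency: "finite (tangency_set \<omega> S)"
    and finite_order: "\<And>\<theta>. \<theta> \<in> tangency_set \<omega> S \<Longrightarrow> \<exists>r\<ge>1. (dir_deriv \<omega> ^^ r) S \<theta> \<noteq> 0"
begin

abbreviation g :: "real^'d \<Rightarrow> real" where "g \<equiv> dir_deriv \<omega> S"

abbreviation Dl :: "nat \<Rightarrow> real^'d \<Rightarrow> real" where "Dl l \<equiv> (dir_deriv \<omega> ^^ l) S"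

lemma omega_nonzero: "\<omega> \<noteq> 0"
proof -
  have "(axis undefined 1 :: int^'d) \<noteq> 0" by (simp add: axis_eq_0_iff)
  then have "\<omega> \<bullet> int_vec (axis undefined 1 :: int^'d) \<noteq> 0"
    using nonres unfolding nonresonant_def by blast
  then show ?thesis by auto
qed

lemma S_continuous: "continuous_on A S" by (rule smooth_continuous[OF smooth_S])
lemma g_continuous: "continuous_on A g" by (rule smooth_continuous[OF smooth_dir_deriv[OF smooth_S]])
lemma g_per: "torus_periodic g" by (rule torus_periodic_dir_deriv[OF smooth_S per])

lemma C1_line: "C1_deriv (\<lambda>t. S (\<theta> + t *\<^sub>R \<omega>)) (\<lambda>t. g (\<theta> + t *\<^sub>R \<omega>))"
  by (rule C1_deriv_line[OF smooth_S])

lemma C1_line_iter: "C1_deriv (\<lambda>t. Dl l (\<theta> + t *\<^sub>R \<omega>)) (\<lambda>t. Dl (Suc l) (\<theta> + t *\<^sub>R \<omega>))"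
  using C1_deriv_line[OF smooth_dir_deriv_iter[OF smooth_S]] by simp

lemma zero_lattice_rep:
  assumes "S \<theta> = 0"
  obtains k where "\<theta> + lattice_point k \<in> zero_surface S"
proof -
  obtain k where "\<theta> + lattice_point k \<in> torus" using ex1_lattice_point by blast
  then show ?thesis using that[of k] assms torus_periodic_lattice_point[OF per] by (simp add: zero_surface_def)
qed

lemma gradient_nonzero: "S \<theta> = 0 \<Longrightarrow> gradient S \<theta> \<noteq> 0"
  using torus_periodic_lattice_point[OF torus_periodic_gradient[OF smooth_S per]] regular
  by (elim zero_lattice_rep) metis

lemma zero_finite_order:
  assumes "S \<theta> = 0"
  shows "\<exists>r\<ge>1. Dl r \<theta> \<noteq> 0"
proof (cases "g \<theta> = 0")
  case True
  obtain k where k: "\<theta> + lattice_point k \<in> zero_surface S" using zero_lattice_rep[OF assms] .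
  have "g (\<theta> + lattice_point k) = 0" using True torus_periodic_lattice_point[OF g_per] by simp
  then have "\<theta> + lattice_point k \<in> tangency_set \<omega> S" using k by (simp add: tangency_set_def)
  then obtain r where "r \<ge> 1" "Dl r (\<theta> + lattice_point k) \<noteq> 0" using finite_order by blast
  then show ?thesis
    using torus_periodic_lattice_point[OF torus_periodic_dir_deriv_iter[OF smooth_S per]] by metis
next
  case False
  then show ?thesis by (intro exI[of _ 1]) simp
qed

text \<open>Compactness: finitely many balls cover the cell such that on each doubled ball either
  \<open>\<bar>S\<bar>\<close> has a positive lower bound or one iterated derivative does not
  vanish. A short orbit segment starting in a ball stays in its double.\<close>

lemma uniform_finite_order:
  obtains h \<eta>0 R where "0 < h" "0 < \<eta>0"
    "\<And>\<theta>. (\<forall>x\<in>{0..h}. \<eta>0 \<le> \<bar>S (\<theta> + x *\<^sub>R \<omega>)\<bar>) \<or> (\<exists>r. 1 \<le> r \<and> r \<le> R \<and> (\<forall>x\<in>{0..h}. Dl r (\<theta> + x *\<^sub>R \<omega>) \<noteq> 0))"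
proof -
  let ?K = "cbox 0 (\<chi> i. 2 * pi) :: (real^'d) set"
  have "\<exists>\<rho> \<eta> r. 0 < \<rho> \<and> 0 < \<eta> \<and> 1 \<le> r \<and> ((\<forall>y. dist y p < 2 * \<rho> \<longrightarrow> \<eta> \<le> \<bar>S y\<bar>) \<or> (\<forall>y. dist y p < 2 * \<rho> \<longrightarrow> Dl r y \<noteq> 0))" for p
  proof (cases "S p = 0")
    case True
    then obtain r where r: "r \<ge> 1" "Dl r p \<noteq> 0" using zero_finite_order by blast
    have "open {y. Dl r y \<noteq> 0}"
      by (intro open_Collect_neq smooth_continuous smooth_dir_deriv_iter[OF smooth_S] continuous_on_const)
    then obtain e where "e > 0" "\<forall>y. dist y p < e \<longrightarrow> y \<in> {y. Dl r y \<noteq> 0}"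
      using r(2) unfolding open_dist by blast
    then show ?thesis using r(1) by (intro exI[of _ "e/2"] exI[of _ 1] exI[of _ r]) auto
  next
    case False
    have "open {y. \<bar>S p\<bar> / 2 < \<bar>S y\<bar>}"
      by (intro open_Collect_less continuous_intros S_continuous)
    then obtain e where "e > 0" "\<forall>y. dist y p < e \<longrightarrow> y \<in> {y. \<bar>S p\<bar> / 2 < \<bar>S y\<bar>}"
      using False unfolding open_dist by (metis half_gt_zero_iff linorder_not_le mem_Collect_eq field_sum_of_halves less_add_same_cancel1 zero_less_abs_iff)
    then show ?thesis using False by (intro exI[of _ "e/2"] exI[of _ "\<bar>S p\<bar> / 2"] exI[of _ 1]) (auto intro: less_imp_le)
  qed
  then obtain \<rho> \<eta> r where loc: "\<And>p. 0 < \<rho> p" "\<And>p. 0 < \<eta> p" "\<And>p. (1::nat) \<le> r p"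
    "\<And>p. (\<forall>y. dist y p < 2 * \<rho> p \<longrightarrow> \<eta> p \<le> \<bar>S y\<bar>) \<or> (\<forall>y. dist y p < 2 * \<rho> p \<longrightarrow> Dl (r p) y \<noteq> 0)"
    by metis
  have cover: "?K \<subseteq> (\<Union>p\<in>?K. ball p (\<rho> p))"
  proof
    fix p assume "p \<in> ?K"
    then show "p \<in> (\<Union>p\<in>?K. ball p (\<rho> p))" using loc(1)[of p] by (intro UN_I[of p]) auto
  qed
  obtain N where N: "finite N" "?K \<subseteq> (\<Union>p\<in>N. ball p (\<rho> p))"
    by (rule compactE_image[OF compact_cbox open_ball cover])
  have Nne: "N \<noteq> {}"
  proof
    assume "N = {}"
    then have "?K \<subseteq> {}" using N(2) by simp
    moreover have "0 \<in> (torus :: (real^'d) set)" by (simp add: torus_def)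
    ultimately show False using torus_subset_cbox by blast
  qed
  define \<rho>m where "\<rho>m = Min (\<rho> ` N)"
  define \<eta>m where "\<eta>m = Min (\<eta> ` N)"
  define R where "R = Max (r ` N)"
  have pos: "\<rho>m > 0" "\<eta>m > 0" using N(1) Nne loc by (auto simp: \<rho>m_def \<eta>m_def)
  have bd: "\<rho>m \<le> \<rho> p" "\<eta>m \<le> \<eta> p" "r p \<le> R" if "p \<in> N" for p
    using N(1) that by (auto simp: \<rho>m_def \<eta>m_def R_def)
  \<comment> \<open>A segment of this duration moves by at most \<open>\<rho>m\<close>, the smallest
    radius of the finite cover.\<close>
  define h where "h = \<rho>m / (norm \<omega> + 1)"
  have w1: "0 < norm \<omega> + 1" by (simp add: add_nonneg_pos)
  have h: "h > 0" using pos w1 by (simp add: h_def)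
  have hw: "x * norm \<omega> \<le> \<rho>m" if "0 \<le> x" "x \<le> h" for x
  proof -
    have "x * norm \<omega> \<le> h * (norm \<omega> + 1)" using that h by (intro mult_mono) auto
    also have "\<dots> = \<rho>m" using w1 by (simp add: h_def)
    finally show ?thesis .
  qed
  have tor: "(\<forall>x\<in>{0..h}. \<eta>m \<le> \<bar>S (\<theta> + x *\<^sub>R \<omega>)\<bar>) \<or> (\<exists>r. 1 \<le> r \<and> r \<le> R \<and> (\<forall>x\<in>{0..h}. Dl r (\<theta> + x *\<^sub>R \<omega>) \<noteq> 0))"
    if \<theta>: "\<theta> \<in> torus" for \<theta>
  proof -
    obtain p where p: "p \<in> N" "dist p \<theta> < \<rho> p" using \<theta> N(2) torus_subset_cbox by fastforce
    have near: "dist (\<theta> + x *\<^sub>R \<omega>) p < 2 * \<rho> p" if "x \<in> {0..h}" for x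
    proof -
      have "dist (\<theta> + x *\<^sub>R \<omega>) p \<le> dist (\<theta> + x *\<^sub>R \<omega>) \<theta> + dist \<theta> p" by (rule dist_triangle)
      also have "dist (\<theta> + x *\<^sub>R \<omega>) \<theta> = x * norm \<omega>" using that by (simp add: dist_norm)
      finally show ?thesis using hw[of x] that p bd(1)[OF p(1)] by (simp add: dist_commute)
    qed
    show ?thesis
    proof (rule disjE[OF loc(4)[of p]])
      assume 1: "\<forall>y. dist y p < 2 * \<rho> p \<longrightarrow> \<eta> p \<le> \<bar>S y\<bar>"
      have "\<eta>m \<le> \<bar>S (\<theta> + x *\<^sub>R \<omega>)\<bar>" if "x \<in> {0..h}" for x
        using 1[rule_format, OF near[OF that]] bd(2)[OF p(1)] by (rule order_trans[rotated])
      then show ?thesis by blast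
    next
      assume 2: "\<forall>y. dist y p < 2 * \<rho> p \<longrightarrow> Dl (r p) y \<noteq> 0"
      have "Dl (r p) (\<theta> + x *\<^sub>R \<omega>) \<noteq> 0" if "x \<in> {0..h}" for x
        using 2[rule_format, OF near[OF that]] .
      then show ?thesis using loc(3)[of p] bd(3)[OF p(1)] by blast
    qed
  qed
  have "(\<forall>x\<in>{0..h}. \<eta>m \<le> \<bar>S (\<theta> + x *\<^sub>R \<omega>)\<bar>) \<or> (\<exists>r. 1 \<le> r \<and> r \<le> R \<and> (\<forall>x\<in>{0..h}. Dl r (\<theta> + x *\<^sub>R \<omega>) \<noteq> 0))" for \<theta>
  proof -
    obtain k where k: "\<theta> + lattice_point k \<in> torus" using ex1_lattice_point by blast
    have sh: "\<theta> + lattice_point k + x *\<^sub>R \<omega> = (\<theta> + x *\<^sub>R \<omega>) + lattice_point k" for x by simp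
    show ?thesis
      using tor[OF k] unfolding sh torus_periodic_lattice_point[OF per]
        torus_periodic_lattice_point[OF torus_periodic_dir_deriv_iter[OF smooth_S per]] .
  qed
  then show ?thesis using that[OF h pos(2)] by blast
qed

end

locale torus_crossing_step = torus_crossing \<omega> S for \<omega> :: "real^'d" and S :: "real^'d \<Rightarrow> real" +
  fixes h \<eta>0 :: real and R :: nat
  assumes h_pos: "0 < h" and \<eta>0_pos: "0 < \<eta>0"
    and step: "\<And>\<theta>. (\<forall>x\<in>{0..h}. \<eta>0 \<le> \<bar>S (\<theta> + x *\<^sub>R \<omega>)\<bar>) \<or>
      (\<exists>r. 1 \<le> r \<and> r \<le> R \<and> (\<forall>x\<in>{0..h}. (dir_deriv \<omega> ^^ r) S (\<theta> + x *\<^sub>R \<omega>) \<noteq> 0))"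
begin

section \<open>Zeros and mollified counts on one orbit segment\<close>

definition crossings :: "real^'d \<Rightarrow> real set" where
  "crossings \<theta> = {x\<in>{0..h}. S (\<theta> + x *\<^sub>R \<omega>) = 0}"

lemma crossings_bound: "finite (crossings \<theta>) \<and> card (crossings \<theta>) \<le> R"
proof (rule disjE[OF step[of \<theta>]])
  assume 1: "\<forall>x\<in>{0..h}. \<eta>0 \<le> \<bar>S (\<theta> + x *\<^sub>R \<omega>)\<bar>"
  have "x \<notin> crossings \<theta>" for x
  proof
    assume "x \<in> crossings \<theta>"
    then have "x \<in> {0..h}" "S (\<theta> + x *\<^sub>R \<omega>) = 0" by (simp_all add: crossings_def)
    then show False using bspec[OF 1, of x] \<eta>0_pos by simp
  qed
  then have "crossings \<theta> = {}" by blast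
  then show ?thesis by simp
next
  assume "\<exists>r. 1 \<le> r \<and> r \<le> R \<and> (\<forall>x\<in>{0..h}. Dl r (\<theta> + x *\<^sub>R \<omega>) \<noteq> 0)"
  then obtain r where r: "1 \<le> r" "r \<le> R" "\<And>x. x \<in> {0..h} \<Longrightarrow> Dl r (\<theta> + x *\<^sub>R \<omega>) \<noteq> 0" by blast
  have "finite {x\<in>{0..h}. Dl 0 (\<theta> + x *\<^sub>R \<omega>) = 0} \<and> card {x\<in>{0..h}. Dl 0 (\<theta> + x *\<^sub>R \<omega>) = 0} \<le> r - 0"
    by (rule finite_order_zero_count[of "\<lambda>l x. Dl l (\<theta> + x *\<^sub>R \<omega>)", OF C1_line_iter _ r(3)]) (use h_pos in auto)
  then show ?thesis using r(2) by (simp add: crossings_def)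
qed

lemma finite_line_zeros: "finite {x\<in>{a..b}. S (\<theta> + x *\<^sub>R \<omega>) = 0}"
proof (cases "a \<le> b")
  case True
  define m where "m = nat \<lceil>(b - a) / h\<rceil>"
  have "{x\<in>{a..b}. S (\<theta> + x *\<^sub>R \<omega>) = 0} \<subseteq> (\<Union>i\<in>{..m}. (+) (a + real i * h) ` crossings (\<theta> + (a + real i * h) *\<^sub>R \<omega>))"
  proof
    fix x assume x: "x \<in> {x\<in>{a..b}. S (\<theta> + x *\<^sub>R \<omega>) = 0}"
    define i where "i = nat \<lfloor>(x - a) / h\<rfloor>"
    have q0: "0 \<le> (x - a) / h" using x h_pos by simp
    have "(x - a) / h \<le> (b - a) / h" using x h_pos by (simp add: divide_right_mono)
    then have "i \<le> m" using q0 unfolding i_def m_def by linarith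
    have "real i \<le> (x - a) / h" "(x - a) / h < real i + 1" using q0 unfolding i_def by linarith+
    then have 1: "real i * h \<le> x - a" "x - a < (real i + 1) * h"
      using h_pos by (simp_all add: pos_le_divide_eq pos_divide_less_eq)
    define y where "y = x - (a + real i * h)"
    have "y \<in> {0..h}" using 1 by (auto simp: y_def algebra_simps)
    moreover have e: "\<theta> + (a + real i * h) *\<^sub>R \<omega> + y *\<^sub>R \<omega> = \<theta> + x *\<^sub>R \<omega>"
      by (simp add: y_def algebra_simps)
    have "S (\<theta> + (a + real i * h) *\<^sub>R \<omega> + y *\<^sub>R \<omega>) = 0" unfolding e using x by blast
    ultimately have "y \<in> crossings (\<theta> + (a + real i * h) *\<^sub>R \<omega>)" unfolding crossings_def by blast
    moreover have "x = (a + real i * h) + y" by (simp add: y_def)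
    ultimately show "x \<in> (\<Union>i\<in>{..m}. (+) (a + real i * h) ` crossings (\<theta> + (a + real i * h) *\<^sub>R \<omega>))"
      using \<open>i \<le> m\<close> by blast
  qed
  then show ?thesis by (rule finite_subset) (use crossings_bound in auto)
qed simp

lemma countable_line_zeros: "countable {x. S (\<theta> + x *\<^sub>R \<omega>) = 0}"
proof -
  have "{x. S (\<theta> + x *\<^sub>R \<omega>) = 0} = (\<Union>n::nat. {x\<in>{- real n..real n}. S (\<theta> + x *\<^sub>R \<omega>) = 0})"
  proof (intro set_eqI iffI)
    fix x assume x: "x \<in> {x. S (\<theta> + x *\<^sub>R \<omega>) = 0}"
    obtain n where "\<bar>x\<bar> \<le> real n" using real_arch_simple by blast
    then have "x \<in> {- real n..real n}" by auto
    then show "x \<in> (\<Union>n::nat. {x\<in>{- real n..real n}. S (\<theta> + x *\<^sub>R \<omega>) = 0})" using x by blast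
  qed blast
  also have "countable \<dots>" by (rule countable_UN) (simp, rule countable_finite[OF finite_line_zeros])
  finally show ?thesis .
qed

definition mollified_crossings :: "(real \<Rightarrow> real) \<Rightarrow> real^'d \<Rightarrow> real" where
  "mollified_crossings k \<theta> = integral {0..h} (\<lambda>x. k (S (\<theta> + x *\<^sub>R \<omega>)) * \<bar>g (\<theta> + x *\<^sub>R \<omega>)\<bar>)"

text \<open>The bound must not depend on the kernel, since \<open>R\<close> dominates the limit
  \<open>\<eta> \<rightarrow> 0\<close>. Where \<open>D\<^sub>\<omega>^r S\<close> does not vanish,
  \<open>g\<close> has at most \<open>r - 1\<close> zeros on the segment, which leaves at most
  \<open>r\<close> monotone pieces contributing at most 1 each. Otherwise the segment avoids the
  support of the kernel because \<open>\<eta> \<le> \<eta>0\<close>.\<close>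

lemma mollified_crossings_bound:
  assumes k: "bump \<eta> k" and "\<eta> \<le> \<eta>0"
  shows "mollified_crossings k \<theta> \<le> real R"
proof (rule disjE[OF step[of \<theta>]])
  assume 1: "\<forall>x\<in>{0..h}. \<eta>0 \<le> \<bar>S (\<theta> + x *\<^sub>R \<omega>)\<bar>"
  have "mollified_crossings k \<theta> = integral {0..h} (\<lambda>x. 0)"
    unfolding mollified_crossings_def
  proof (rule Henstock_Kurzweil_Integration.integral_cong)
    fix x assume "x \<in> {0..h}"
    then have "\<eta> \<le> \<bar>S (\<theta> + x *\<^sub>R \<omega>)\<bar>" using 1 \<open>\<eta> \<le> \<eta>0\<close> by force
    then show "k (S (\<theta> + x *\<^sub>R \<omega>)) * \<bar>g (\<theta> + x *\<^sub>R \<omega>)\<bar> = 0" using k by (simp add: bump_def)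
  qed
  then show ?thesis by simp
next
  assume "\<exists>r. 1 \<le> r \<and> r \<le> R \<and> (\<forall>x\<in>{0..h}. Dl r (\<theta> + x *\<^sub>R \<omega>) \<noteq> 0)"
  then obtain r where r: "1 \<le> r" "r \<le> R" "\<And>x. x \<in> {0..h} \<Longrightarrow> Dl r (\<theta> + x *\<^sub>R \<omega>) \<noteq> 0" by blast
  have c: "finite {x\<in>{0..h}. Dl 1 (\<theta> + x *\<^sub>R \<omega>) = 0} \<and> card {x\<in>{0..h}. Dl 1 (\<theta> + x *\<^sub>R \<omega>) = 0} \<le> r - 1"
    by (rule finite_order_zero_count[of "\<lambda>l x. Dl l (\<theta> + x *\<^sub>R \<omega>)", OF C1_line_iter _ r(3)]) (use h_pos r in auto)
  have "mollified_crossings k \<theta> \<le> real (card {x\<in>{0..h}. g (\<theta> + x *\<^sub>R \<omega>) = 0} + 1)"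
    unfolding mollified_crossings_def
    by (rule integral_bump_le(2)[OF C1_line _ k]) (use c h_pos in auto)
  also have "\<dots> \<le> real R"
  proof -
    have "card {x\<in>{0..h}. g (\<theta> + x *\<^sub>R \<omega>) = 0} \<le> r - 1" using c by simp
    then have "card {x\<in>{0..h}. g (\<theta> + x *\<^sub>R \<omega>) = 0} + 1 \<le> R" using r(1,2) by linarith
    then show ?thesis by (simp only: of_nat_le_iff)
  qed
  finally show ?thesis .
qed

end

lemma torus_periodic_iff_lattice_point: "torus_periodic f \<longleftrightarrow> (\<forall>\<theta> k. f (\<theta> + lattice_point k) = f \<theta>)"
proof
  assume "\<forall>\<theta> k. f (\<theta> + lattice_point k) = f \<theta>"
  then show "torus_periodic f" unfolding torus_periodic_def by (metis lattice_point_exists)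
qed (simp add: torus_periodic_lattice_point)

lemma infdist_translation:
  fixes A :: "'a::real_normed_vector set"
  assumes "\<And>x. x + c \<in> A \<longleftrightarrow> x \<in> A"
  shows "infdist (x + c) A = infdist x A"
proof -
  have img: "A = (\<lambda>a. a + c) ` A"
  proof (intro set_eqI iffI)
    fix a assume "a \<in> A"
    then have "a - c \<in> A" using assms[of "a - c"] by simp
    then show "a \<in> (\<lambda>a. a + c) ` A" by (intro image_eqI[of _ _ "a - c"]) auto
  next
    fix a assume "a \<in> (\<lambda>a. a + c) ` A"
    then show "a \<in> A" using assms by blast
  qed
  have d: "dist (x + c) ` (\<lambda>a. a + c) ` A = dist x ` A" by (simp add: image_image)
  show ?thesis
  proof (cases "A = {}")
    case False
    have "infdist (x + c) A = Inf (dist (x + c) ` A)" using False by (simp add: infdist_def)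
    also have "dist (x + c) ` A = dist x ` A" by (subst img) (rule d)
    finally show ?thesis using False by (simp add: infdist_def)
  qed (simp add: infdist_def)
qed

context torus_crossing_step
begin

section \<open>The exceptional set of starting points\<close>

definition tangency :: "(real^'d) set" where
  "tangency = {\<theta>. S \<theta> = 0 \<and> g \<theta> = 0}"

text \<open>The exceptional starting points: outside this closed null set, the crossings of the orbit
  segment of length \<open>h\<close> are transversal and avoid its end points, so their number is locally
  constant.\<close>

definition bad :: "(real^'d) set" where
  "bad = {\<theta>. S \<theta> = 0} \<union> {\<theta>. S (\<theta> + h *\<^sub>R \<omega>) = 0} \<union> flow_strip \<omega> h tangency"

lemma bad_iff: "\<theta> \<in> bad \<longleftrightarrow> S \<theta> = 0 \<or> S (\<theta> + h *\<^sub>R \<omega>) = 0 \<or>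
    (\<exists>x\<in>{0..h}. S (\<theta> + x *\<^sub>R \<omega>) = 0 \<and> g (\<theta> + x *\<^sub>R \<omega>) = 0)"
proof -
  have "\<theta> \<in> flow_strip \<omega> h tangency \<longleftrightarrow> (\<exists>x\<in>{0..h}. \<theta> + x *\<^sub>R \<omega> \<in> tangency)"
  proof
    assume "\<theta> \<in> flow_strip \<omega> h tangency"
    then obtain a x where "\<theta> = a - x *\<^sub>R \<omega>" "a \<in> tangency" "x \<in> {0..h}" unfolding flow_strip_def by blast
    then show "\<exists>x\<in>{0..h}. \<theta> + x *\<^sub>R \<omega> \<in> tangency" by (intro bexI[of _ x]) auto
  next
    assume "\<exists>x\<in>{0..h}. \<theta> + x *\<^sub>R \<omega> \<in> tangency"
    then obtain x where x: "x \<in> {0..h}" "\<theta> + x *\<^sub>R \<omega> \<in> tangency" by blast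
    then have "\<theta> = (\<theta> + x *\<^sub>R \<omega>) - x *\<^sub>R \<omega>" by simp
    then show "\<theta> \<in> flow_strip \<omega> h tangency" using x unfolding flow_strip_def by blast
  qed
  then show ?thesis by (simp add: bad_def tangency_def)
qed

lemma closed_tangency: "closed tangency"
  unfolding tangency_def by (intro closed_Collect_conj closed_Collect_eq S_continuous g_continuous continuous_on_const)

lemma closed_bad: "closed bad"
proof -
  have "closed {\<theta>. S (\<theta> + h *\<^sub>R \<omega>) = 0}"
    by (intro closed_Collect_eq continuous_on_compose2[OF S_continuous[of UNIV]] continuous_intros) auto
  moreover have "closed {\<theta>. S \<theta> = 0}" by (intro closed_Collect_eq S_continuous continuous_on_const)
  moreover have "closed (flow_strip \<omega> h tangency)"
  proof -
    have "compact ((\<lambda>x. x *\<^sub>R \<omega>) ` {0..h})"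
      by (intro compact_continuous_image continuous_intros compact_Icc)
    from closed_compact_differences[OF closed_tangency this]
    have "closed (\<Union>x\<in>tangency. \<Union>y\<in>(\<lambda>x. x *\<^sub>R \<omega>) ` {0..h}. {x - y})" .
    moreover have "(\<Union>x\<in>tangency. \<Union>y\<in>(\<lambda>x. x *\<^sub>R \<omega>) ` {0..h}. {x - y}) = flow_strip \<omega> h tangency"
      unfolding flow_strip_def by blast
    ultimately show ?thesis by simp
  qed
  ultimately show ?thesis unfolding bad_def by (intro closed_Un)
qed

lemma bad_lattice: "\<theta> + lattice_point k \<in> bad \<longleftrightarrow> \<theta> \<in> bad"
proof -
  have sh: "\<theta> + lattice_point k + x *\<^sub>R \<omega> = (\<theta> + x *\<^sub>R \<omega>) + lattice_point k" for x by simp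
  show ?thesis
    unfolding bad_iff sh torus_periodic_lattice_point[OF per] torus_periodic_lattice_point[OF g_per] ..
qed

lemma bad_nonempty: "bad \<noteq> {}"
  using nonempty by (auto simp: bad_def zero_surface_def)

text \<open>Every line parallel to \<open>\<omega>\<close> meets the zero set in a countable set, by
  the finite order of the zeros along it.\<close>

lemma null_translated_zeros: "emeasure lborel {\<theta>. S (\<theta> + v) = 0} = 0"
proof (rule line_null_imp_null[where v=\<omega>])
  have "closed {\<theta>. S (\<theta> + v) = 0}"
    by (intro closed_Collect_eq continuous_on_compose2[OF S_continuous[of UNIV]] continuous_intros) auto
  then show "{\<theta>. S (\<theta> + v) = 0} \<in> sets borel" by (rule borel_closed)
  fix y
  have "{t. y + t *\<^sub>R \<omega> \<in> {\<theta>. S (\<theta> + v) = 0}} = {t. S ((y + v) + t *\<^sub>R \<omega>) = 0}"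
    by (simp add: algebra_simps)
  then have "{t. y + t *\<^sub>R \<omega> \<in> {\<theta>. S (\<theta> + v) = 0}} \<in> null_sets lborel"
    using countable_imp_null_set_lborel[OF countable_line_zeros[of "y + v"]] by simp
  then show "emeasure lborel {t. y + t *\<^sub>R \<omega> \<in> {\<theta>. S (\<theta> + v) = 0}} = 0" by (rule null_setsD1)
qed

lemma countable_tangency: "countable tangency"
proof -
  have "tangency \<subseteq> (\<Union>k. (\<lambda>c. c - lattice_point k) ` tangency_set \<omega> S)"
  proof
    fix \<theta> assume \<theta>: "\<theta> \<in> tangency"
    then obtain k where k: "\<theta> + lattice_point k \<in> zero_surface S"
      using zero_lattice_rep[of \<theta>] by (auto simp: tangency_def)
    then have "\<theta> + lattice_point k \<in> tangency_set \<omega> S"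
      using \<theta> torus_periodic_lattice_point[OF g_per] by (simp add: tangency_set_def tangency_def)
    then have "\<theta> \<in> (\<lambda>c. c - lattice_point k) ` tangency_set \<omega> S"
      by (intro image_eqI[of _ _ "\<theta> + lattice_point k"]) simp_all
    then show "\<theta> \<in> (\<Union>k. (\<lambda>c. c - lattice_point k) ` tangency_set \<omega> S)" by blast
  qed
  moreover have "countable (\<Union>k. (\<lambda>c. c - lattice_point k) ` tangency_set \<omega> S)"
    by (rule countable_UN) (simp, rule countable_finite[OF finite_imageI[OF finite_tangency]])
  ultimately show ?thesis by (rule countable_subset)
qed

text \<open>For \<open>d \<ge> 2\<close> the strip is a countable union of segments, which are null.
  For \<open>d = 1\<close> there are no tangencies, since
  \<open>\<omega> \<bullet> gradient S \<theta> = 0\<close> with \<open>\<omega> \<noteq> 0\<close>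
  would make the gradient vanish.\<close>

lemma null_tangency_strip: "flow_strip \<omega> h tangency \<in> null_sets lebesgue"
proof (cases "CARD('d) = 1")
  case True
  have "tangency = {}"
    using vec_dim_1_inner_eq_0[OF True, of \<omega>] omega_nonzero gradient_nonzero
    by (auto simp: tangency_def dir_deriv_def)
  then show ?thesis by (simp add: flow_strip_def)
next
  case False
  have "negligible (flow_strip \<omega> h {a})" for a
  proof -
    have "dim (span {\<omega>}) \<le> card {\<omega>}" by (simp only: dim_span) (rule dim_le_card', simp)
    also have "\<dots> < DIM(real^'d)" using False zero_less_card_finite[where 'a='d]
      by (simp add: nat_neq_iff[of "CARD('d)" "Suc 0"])
    finally have "negligible (span {\<omega>})" by (rule negligible_lowdim)
    then have "negligible ((+) a ` span {\<omega>})" by (rule negligible_translation)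
    moreover have "flow_strip \<omega> h {a} \<subseteq> (+) a ` span {\<omega>}"
    proof
      fix z assume "z \<in> flow_strip \<omega> h {a}"
      then obtain x where "z = a - x *\<^sub>R \<omega>" unfolding flow_strip_def by blast
      then have "z = a + (- x) *\<^sub>R \<omega>" by simp
      moreover have "(- x) *\<^sub>R \<omega> \<in> span {\<omega>}" by (intro span_scale span_base) simp
      ultimately show "z \<in> (+) a ` span {\<omega>}" by blast
    qed
    ultimately show ?thesis by (rule negligible_subset)
  qed
  then have "(\<Union>a\<in>tangency. flow_strip \<omega> h {a}) \<in> null_sets lebesgue"
    using countable_tangency by (intro null_sets_UN') (auto simp: negligible_iff_null_sets)
  moreover have "(\<Union>a\<in>tangency. flow_strip \<omega> h {a}) = flow_strip \<omega> h tangency"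
    unfolding flow_strip_def by blast
  ultimately show ?thesis by simp
qed

lemma bad_borel [measurable]: "bad \<in> sets borel"
  by (rule borel_closed[OF closed_bad])

lemma null_bad: "bad \<in> null_sets lborel"
proof -
  have 1: "{\<theta>. S (\<theta> + v) = 0} \<in> null_sets lebesgue" for v
  proof -
    have "closed {\<theta>. S (\<theta> + v) = 0}"
      by (intro closed_Collect_eq continuous_on_compose2[OF S_continuous[of UNIV]] continuous_intros) auto
    then have b: "{\<theta>. S (\<theta> + v) = 0} \<in> sets borel" by (rule borel_closed)
    then have "{\<theta>. S (\<theta> + v) = 0} \<in> null_sets lborel" using null_translated_zeros[of v] by (intro null_setsI) simp_all
    then show ?thesis by (rule null_sets_completionI)
  qed
  have "bad \<in> null_sets lebesgue"
    unfolding bad_def using 1[of 0] 1[of "h *\<^sub>R \<omega>"] null_tangency_strip by (intro null_sets.Un) simp_all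
  then have "emeasure lebesgue bad = 0" by (rule null_setsD1)
  then show ?thesis by (intro null_setsI) simp_all
qed

lemma AE_not_bad: "AE \<theta> in lborel. \<theta> \<notin> bad"
  by (rule AE_not_in[OF null_bad])

lemma crossings_lattice: "crossings (\<theta> + lattice_point k) = crossings \<theta>"
proof -
  have sh: "\<theta> + lattice_point k + x *\<^sub>R \<omega> = (\<theta> + x *\<^sub>R \<omega>) + lattice_point k" for x by simp
  show ?thesis unfolding crossings_def sh torus_periodic_lattice_point[OF per] ..
qed

text \<open>Outside \<open>bad\<close> the restriction of \<open>S\<close> to the segment has simple
  zeros and nonzero end values, so \<open>stable_count_transversal\<close> applies. Uniform
  continuity of \<open>S\<close> and \<open>g\<close> turns nearby starting points into
  perturbations that are small along the whole segment.\<close>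

lemma crossings_locally_stable:
  assumes \<theta>: "\<theta> \<notin> bad"
  obtains \<delta> c where "0 < \<delta>" "0 < c" "\<And>\<theta>'. dist \<theta>' \<theta> < \<delta> \<Longrightarrow> card (crossings \<theta>') = card (crossings \<theta>)"
    "\<And>\<eta> k. bump \<eta> k \<Longrightarrow> \<eta> < c \<Longrightarrow> mollified_crossings k \<theta> = real (card (crossings \<theta>))"
proof -
  let ?f = "\<lambda>\<theta> t. S (\<theta> + t *\<^sub>R \<omega>)" and ?f' = "\<lambda>\<theta> t. g (\<theta> + t *\<^sub>R \<omega>)"
  have "stable_count (?f \<theta>) (?f' \<theta>) 0 h"
  proof (rule stable_count_transversal[OF C1_line])
    show "0 \<le> h" using h_pos by simp
    show "finite {x \<in> {0..h}. S (\<theta> + x *\<^sub>R \<omega>) = 0}" by (rule finite_line_zeros)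
    show "S (\<theta> + 0 *\<^sub>R \<omega>) \<noteq> 0" "S (\<theta> + h *\<^sub>R \<omega>) \<noteq> 0" using \<theta> unfolding bad_iff by simp_all
    show "g (\<theta> + x *\<^sub>R \<omega>) \<noteq> 0" if "x \<in> {0..h}" "S (\<theta> + x *\<^sub>R \<omega>) = 0" for x
      using \<theta> that unfolding bad_iff by blast
  qed
  then obtain c where c: "0 < c" "stable_within (?f \<theta>) (?f' \<theta>) 0 h c" unfolding stable_count_def by blast
  obtain \<delta>1 where \<delta>1: "0 < \<delta>1" "\<And>x y. dist x y < \<delta>1 \<Longrightarrow> \<bar>S x - S y\<bar> < c"
    using torus_periodic_uniformly_continuous[OF per S_continuous c(1)] by blast
  obtain \<delta>2 where \<delta>2: "0 < \<delta>2" "\<And>x y. dist x y < \<delta>2 \<Longrightarrow> \<bar>g x - g y\<bar> < c"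
    using torus_periodic_uniformly_continuous[OF g_per g_continuous c(1)] by blast
  have near: "\<forall>x\<in>{0..h}. \<bar>?f \<theta>' x - ?f \<theta> x\<bar> < c \<and> \<bar>?f' \<theta>' x - ?f' \<theta> x\<bar> < c"
    if "dist \<theta>' \<theta> < min \<delta>1 \<delta>2" for \<theta>'
  proof
    fix x
    have "dist (\<theta>' + x *\<^sub>R \<omega>) (\<theta> + x *\<^sub>R \<omega>) = dist \<theta>' \<theta>" by (simp add: dist_norm)
    then show "\<bar>?f \<theta>' x - ?f \<theta> x\<bar> < c \<and> \<bar>?f' \<theta>' x - ?f' \<theta> x\<bar> < c"
      using that \<delta>1(2)[of "\<theta>' + x *\<^sub>R \<omega>" "\<theta> + x *\<^sub>R \<omega>"] \<delta>2(2)[of "\<theta>' + x *\<^sub>R \<omega>" "\<theta> + x *\<^sub>R \<omega>"] by simp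
  qed
  show ?thesis
  proof (rule that[of "min \<delta>1 \<delta>2" c])
    show "0 < min \<delta>1 \<delta>2" "0 < c" using \<delta>1(1) \<delta>2(1) c(1) by simp_all
    show "card (crossings \<theta>') = card (crossings \<theta>)" if "dist \<theta>' \<theta> < min \<delta>1 \<delta>2" for \<theta>'
      unfolding crossings_def by (rule stable_withinD(2)[OF c(2) C1_line near[OF that]])
    fix \<eta> k assume k: "bump \<eta> k" "\<eta> < c"
    have self: "\<forall>x\<in>{0..h}. \<bar>?f \<theta> x - ?f \<theta> x\<bar> < c \<and> \<bar>?f' \<theta> x - ?f' \<theta> x\<bar> < c" using c(1) by simp
    have "((\<lambda>x. k (?f \<theta> x) * \<bar>?f' \<theta> x\<bar>) has_integral real (card (crossings \<theta>))) {0..h}"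
      unfolding crossings_def by (rule stable_withinD(3)[OF c(2) C1_line self k])
    then show "mollified_crossings k \<theta> = real (card (crossings \<theta>))"
      unfolding mollified_crossings_def by (rule integral_unique)
  qed
qed

text \<open>A continuous periodic majorant of the indicator of \<open>bad\<close>, supported within
  distance \<open>\<delta>\<close>. Its mean tends to 0 with \<open>\<delta>\<close> because
  \<open>bad\<close> is closed and null.\<close>

definition cut :: "real \<Rightarrow> real^'d \<Rightarrow> real" where
  "cut \<delta> \<theta> = max 0 (1 - infdist \<theta> bad / \<delta>)"

lemma cut_continuous: "0 < \<delta> \<Longrightarrow> continuous_on A (cut \<delta>)"
  unfolding cut_def by (intro continuous_intros) auto

lemma cut_periodic: "torus_periodic (cut \<delta>)"
  unfolding torus_periodic_iff_lattice_point cut_def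
  using infdist_translation[OF bad_lattice] by simp

lemma cut_bounds: "0 < \<delta> \<Longrightarrow> 0 \<le> cut \<delta> \<theta>" "0 < \<delta> \<Longrightarrow> cut \<delta> \<theta> \<le> 1"
  by (simp_all add: cut_def infdist_nonneg)

lemma cut_bad: "\<theta> \<in> bad \<Longrightarrow> cut \<delta> \<theta> = 1"
  by (simp add: cut_def)

lemma cut_tendsto_0:
  assumes "\<theta> \<notin> bad"
  shows "(\<lambda>i. cut (1 / real (Suc i)) \<theta>) \<longlonglongrightarrow> 0"
proof -
  have d: "0 < infdist \<theta> bad"
    using assms in_closed_iff_infdist_zero[OF closed_bad bad_nonempty, of \<theta>] infdist_nonneg[of \<theta> bad] by linarith
  obtain N where N: "1 / infdist \<theta> bad \<le> real N" using real_arch_simple by blast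
  have "cut (1 / real (Suc i)) \<theta> = 0" if "N \<le> i" for i
  proof -
    have "1 / infdist \<theta> bad \<le> real (Suc i)" using N that by linarith
    then have "1 \<le> real (Suc i) * infdist \<theta> bad" using d by (simp add: pos_divide_le_eq)
    then show ?thesis by (simp add: cut_def mult.commute)
  qed
  then have "\<forall>\<^sub>F i in sequentially. cut (1 / real (Suc i)) \<theta> = 0"
    unfolding eventually_sequentially by blast
  then show ?thesis by (rule tendsto_eventually)
qed

definition good_count :: "real \<Rightarrow> real^'d \<Rightarrow> real" where
  "good_count \<delta> \<theta> = real (card (crossings \<theta>)) * (1 - cut \<delta> \<theta>)"

lemma good_count_periodic: "torus_periodic (good_count \<delta>)"
  unfolding torus_periodic_iff_lattice_point good_count_def
  using crossings_lattice torus_periodic_lattice_point[OF cut_periodic] by simp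

lemma good_count_bounds:
  assumes "0 < \<delta>"
  shows "0 \<le> good_count \<delta> \<theta>" "good_count \<delta> \<theta> \<le> real (card (crossings \<theta>))"
    "real (card (crossings \<theta>)) \<le> good_count \<delta> \<theta> + real R * cut \<delta> \<theta>"
proof -
  note c = cut_bounds[OF assms, of \<theta>]
  show "0 \<le> good_count \<delta> \<theta>" using c by (simp add: good_count_def)
  show "good_count \<delta> \<theta> \<le> real (card (crossings \<theta>))"
    unfolding good_count_def using c by (intro mult_left_le) simp_all
  have "real (card (crossings \<theta>)) * cut \<delta> \<theta> \<le> real R * cut \<delta> \<theta>"
    using crossings_bound c by (intro mult_right_mono) simp_all
  then show "real (card (crossings \<theta>)) \<le> good_count \<delta> \<theta> + real R * cut \<delta> \<theta>"
    by (simp add: good_count_def algebra_simps)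
qed

text \<open>The factor \<open>1 - cut\<close> removes the jumps: at a point of \<open>bad\<close>
  the product is squeezed to 0 by \<open>R * (1 - cut)\<close>, elsewhere the count is locally
  constant.\<close>

lemma good_count_continuous:
  assumes \<delta>: "0 < \<delta>"
  shows "continuous_on UNIV (good_count \<delta>)"
proof (rule continuous_at_imp_continuous_on, rule ballI)
  fix \<theta>
  have cc: "cut \<delta> \<midarrow>\<theta>\<rightarrow> cut \<delta> \<theta>"
    using cut_continuous[OF \<delta>, of UNIV] by (simp add: continuous_on_eq_continuous_at isCont_def)
  have "good_count \<delta> \<midarrow>\<theta>\<rightarrow> good_count \<delta> \<theta>"
  proof (cases "\<theta> \<in> bad")
    case True
    have "(\<lambda>y. real R * (1 - cut \<delta> y)) \<midarrow>\<theta>\<rightarrow> real R * (1 - cut \<delta> \<theta>)" by (intro tendsto_intros cc)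
    then have lim: "(\<lambda>y. real R * (1 - cut \<delta> y)) \<midarrow>\<theta>\<rightarrow> 0" by (simp add: cut_bad[OF True])
    have le: "norm (good_count \<delta> y) \<le> real R * (1 - cut \<delta> y)" for y
      unfolding good_count_def using crossings_bound[of y] cut_bounds[OF \<delta>, of y]
      by (simp add: abs_mult mult_right_mono)
    have "good_count \<delta> \<midarrow>\<theta>\<rightarrow> 0"
      by (rule Lim_null_comparison[OF _ lim]) (rule always_eventually, rule allI, rule le)
    then show ?thesis by (simp add: good_count_def cut_bad[OF True])
  next
    case False
    obtain e where e: "0 < e" "\<And>\<theta>'. dist \<theta>' \<theta> < e \<Longrightarrow> card (crossings \<theta>') = card (crossings \<theta>)"
      using crossings_locally_stable[OF False] by metis
    have "(\<lambda>y. real (card (crossings \<theta>)) * (1 - cut \<delta> y)) \<midarrow>\<theta>\<rightarrow> real (card (crossings \<theta>)) * (1 - cut \<delta> \<theta>)"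
      by (intro tendsto_intros cc)
    moreover have "\<forall>\<^sub>F y in at \<theta>. real (card (crossings \<theta>)) * (1 - cut \<delta> y) = good_count \<delta> y"
      unfolding eventually_at
    proof (intro exI[of _ e] conjI ballI impI)
      fix y assume "y \<noteq> \<theta> \<and> dist y \<theta> < e"
      then have "card (crossings y) = card (crossings \<theta>)" by (intro e(2)) simp
      then show "real (card (crossings \<theta>)) * (1 - cut \<delta> y) = good_count \<delta> y"
        by (simp only: good_count_def)
    qed (rule e(1))
    ultimately have "good_count \<delta> \<midarrow>\<theta>\<rightarrow> real (card (crossings \<theta>)) * (1 - cut \<delta> \<theta>)"
      by (rule Lim_transform_eventually)
    then show ?thesis by (simp only: good_count_def)
  qed
  then show "isCont (good_count \<delta>) \<theta>" by (simp add: isCont_def)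
qed

text \<open>Setting the crossing number to \<open>0\<close> on the exceptional set makes it Borel measurable.\<close>

definition crossing_number :: "real^'d \<Rightarrow> ennreal" where
  "crossing_number \<theta> = (if \<theta> \<in> bad then 0 else ennreal (real (card (crossings \<theta>))))"

lemma good_count_tendsto:
  assumes "\<theta> \<notin> bad"
  shows "(\<lambda>i. ennreal (good_count (1 / real (Suc i)) \<theta>)) \<longlonglongrightarrow> crossing_number \<theta>"
proof -
  have "(\<lambda>i. good_count (1 / real (Suc i)) \<theta>) \<longlonglongrightarrow> real (card (crossings \<theta>)) * (1 - 0)"
    unfolding good_count_def by (intro tendsto_intros cut_tendsto_0[OF assms])
  then show ?thesis using assms by (simp add: crossing_number_def tendsto_ennrealI)
qed

lemma crossing_number_measurable [measurable]: "crossing_number \<in> borel_measurable borel"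
proof (rule borel_measurable_LIMSEQ_order)
  let ?u = "\<lambda>i \<theta>. ennreal (good_count (1 / real (Suc i)) \<theta>) * indicator (- bad) \<theta>"
  show "(\<lambda>i. ?u i \<theta>) \<longlonglongrightarrow> crossing_number \<theta>" if "\<theta> \<in> space borel" for \<theta>
    using good_count_tendsto[of \<theta>] by (cases "\<theta> \<in> bad") (simp_all add: crossing_number_def)
  fix i
  have [measurable]: "good_count (1 / real (Suc i)) \<in> borel_measurable borel"
    by (rule borel_measurable_continuous_onI[OF good_count_continuous]) simp
  show "?u i \<in> borel_measurable borel" by measurable
qed

end

section \<open>Mean crossing number and flux\<close>

lemma sigma_compact_closed_Int_open:
  fixes C U :: "'a::euclidean_space set"
  assumes "closed C" "open U"
  shows "sigma_compact (C \<inter> U)"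
proof (rule open_Union_compact_subsets[OF assms(2)])
  fix D :: "nat \<Rightarrow> 'a set" assume D: "\<And>n. compact (D n)" "\<Union>(range D) = U"
  show ?thesis
    unfolding sigma_compact_def
  proof (intro exI[of _ "\<lambda>n. C \<inter> D n"] conjI allI)
    show "compact (C \<inter> D n)" for n by (rule closed_Int_compact[OF assms(1) D(1)])
    show "C \<inter> U = (\<Union>n. C \<inter> D n)" unfolding D(2)[symmetric] by blast
  qed
qed

lemma ennreal_le_by_factors:
  assumes "\<And>K::real. 1 < K \<Longrightarrow> x \<le> ennreal K * y"
  shows "x \<le> y"
proof (rule ennreal_le_epsilon)
  fix e :: real assume e: "0 < e" and y: "y < top"
  obtain b where b: "y = ennreal b" "0 \<le> b" using y by (cases y) auto
  \<comment> \<open>With this factor the excess \<open>e * b / (b + 1)\<close> is at most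
    \<open>e\<close>, also when \<open>b = 0\<close>.\<close>
  have "x \<le> ennreal (1 + e / (b + 1)) * y" by (rule assms) (use e b in simp)
  also have "\<dots> = ennreal ((1 + e / (b + 1)) * b)" unfolding b(1) by (rule ennreal_mult[symmetric]) (use e b in simp_all)
  also have "\<dots> \<le> ennreal (b + e)"
  proof (rule ennreal_leI)
    have "e / (b + 1) * b \<le> e"
      using e b by (simp add: pos_divide_le_eq)
    then show "(1 + e / (b + 1)) * b \<le> b + e" by (simp add: distrib_right)
  qed
  also have "\<dots> = y + ennreal e" unfolding b(1) by (rule ennreal_plus) (use e b in simp_all)
  finally show "x \<le> y + ennreal e" .
qed

lemma flow_box_empty: "flow_box \<omega> S K {}"
  by (simp add: flow_box_def flow_strip_def surface_flux_def)

context torus_crossing_step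
begin

definition transversal_part :: "(real^'d) set" where
  "transversal_part = {\<theta>\<in>zero_surface S. g \<theta> \<noteq> 0}"

definition flow_boxes :: "real \<Rightarrow> (nat \<Rightarrow> (real^'d) set) \<Rightarrow> bool" where
  "flow_boxes K A \<longleftrightarrow> disjoint_family A \<and> (\<Union>k. A k) = transversal_part \<and> (\<forall>k. sigma_compact (A k)) \<and>
     (\<forall>k a a' x. a \<in> A k \<longrightarrow> a' \<in> A k \<longrightarrow> a - a' = x *\<^sub>R \<omega> \<longrightarrow> a = a') \<and>
     (\<forall>k. emeasure lborel (flow_strip \<omega> h (A k)) \<le> ennreal (K * h) * surface_flux \<omega> S (A k) \<and>
          ennreal h * surface_flux \<omega> S (A k) \<le> ennreal K * emeasure lborel (flow_strip \<omega> h (A k)))"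

text \<open>The Lindelof property reduces the boxes around transversal points to a sequence, and
  subtracting the earlier boxes makes the pieces disjoint. Each piece is the intersection of a
  closed and an open set, hence sigma-compact, although neither the cell nor the transversal part
  need be closed or open.\<close>

lemma flow_boxes_exist:
  assumes K: "1 < K"
  obtains A where "flow_boxes K A"
proof -
  have "\<exists>r>0. flow_box \<omega> S K (ball p r)" if "p \<in> transversal_part" for p
  proof -
    have "g p \<noteq> 0" using that by (simp add: transversal_part_def)
    from flow_box_exists[OF smooth_S this K] show ?thesis by blast
  qed
  then obtain r where r: "\<And>p. p \<in> transversal_part \<Longrightarrow> 0 < r p" "\<And>p. p \<in> transversal_part \<Longrightarrow> flow_box \<omega> S K (ball p (r p))"
    by metis
  let ?F = "(\<lambda>p. ball p (r p)) ` transversal_part"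
  have "\<And>U. U \<in> ?F \<Longrightarrow> open U" by blast
  then obtain F' where F': "F' \<subseteq> ?F" "countable F'" "\<Union>F' = \<Union>?F" by (rule Lindelof)
  \<comment> \<open>The empty box makes the family nonempty, so that it can be enumerated by all
    natural numbers.\<close>
  define U where "U = from_nat_into (insert {} F')"
  have rangeU: "range U = insert {} F'" unfolding U_def by (rule range_from_nat_into) (use F'(2) in simp_all)
  have Uopen: "open (U k)" and Ubox: "flow_box \<omega> S K (U k)" for k
  proof -
    have "U k \<in> insert {} F'" using rangeU by blast
    then have "U k = {} \<or> (\<exists>p\<in>transversal_part. U k = ball p (r p))" using F'(1) by blast
    then show "open (U k)" "flow_box \<omega> S K (U k)" using flow_box_empty r(2) by auto
  qed
  have cover: "transversal_part \<subseteq> (\<Union>k. U k)"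
  proof
    fix p assume p: "p \<in> transversal_part"
    then have "p \<in> ball p (r p)" using r(1) by simp
    then have "p \<in> \<Union>?F" using p by blast
    then have "p \<in> \<Union>(insert {} F')" using F'(3) by simp
    then show "p \<in> (\<Union>k. U k)" unfolding rangeU[symmetric] .
  qed
  define A where "A k = transversal_part \<inter> U k - (\<Union>j<k. U j)" for k
  have AU: "A k \<subseteq> U k" "\<forall>a\<in>A k. S a = 0" for k
    by (auto simp: A_def transversal_part_def zero_surface_def)
  have sig: "sigma_compact (A k)" for k
  proof -
    have "A k = (({\<theta>. S \<theta> = 0} \<inter> (\<Inter>i. {\<theta>. 0 \<le> \<theta> $ i})) \<inter> (- (\<Union>j<k. U j))) \<inter>
       ((\<Inter>i. {\<theta>. \<theta> $ i < 2 * pi}) \<inter> {\<theta>. g \<theta> \<noteq> 0} \<inter> U k)"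
      unfolding A_def transversal_part_def zero_surface_def torus_def by blast
    moreover have "closed (({\<theta>. S \<theta> = 0} \<inter> (\<Inter>i. {\<theta>. 0 \<le> \<theta> $ i})) \<inter> (- (\<Union>j<k. U j)))"
    proof (intro closed_Int)
      show "closed {\<theta>. S \<theta> = 0}" by (intro closed_Collect_eq S_continuous continuous_on_const)
      show "closed (\<Inter>i. {\<theta>::real^'d. 0 \<le> \<theta> $ i})"
        by (intro closed_INT ballI closed_Collect_le continuous_intros)
      show "closed (- (\<Union>j<k. U j))" by (intro closed_Compl open_UN ballI Uopen)
    qed
    moreover have "open ((\<Inter>i. {\<theta>::real^'d. \<theta> $ i < 2 * pi}) \<inter> {\<theta>. g \<theta> \<noteq> 0} \<inter> U k)"
    proof (intro open_Int Uopen)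
      show "open (\<Inter>i. {\<theta>::real^'d. \<theta> $ i < 2 * pi})"
        by (intro open_INT ballI open_Collect_less continuous_intros) simp
      show "open {\<theta>. g \<theta> \<noteq> 0}" by (intro open_Collect_neq g_continuous continuous_on_const)
    qed
    ultimately show ?thesis using sigma_compact_closed_Int_open by simp
  qed
  have "flow_boxes K A"
    unfolding flow_boxes_def
  proof (intro conjI allI impI)
    show "disjoint_family A"
      unfolding disjoint_family_on_def
    proof (intro ballI impI)
      fix m n :: nat assume "m \<noteq> n"
      then consider "m < n" | "n < m" by linarith
      then show "A m \<inter> A n = {}" by cases (auto simp: A_def)
    qed
    show "(\<Union>k. A k) = transversal_part"
    proof
      show "(\<Union>k. A k) \<subseteq> transversal_part" by (auto simp: A_def)
      show "transversal_part \<subseteq> (\<Union>k. A k)"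
      proof
        fix p assume p: "p \<in> transversal_part"
        then have ex: "\<exists>k. p \<in> U k" using cover by blast
        define k where "k = (LEAST k. p \<in> U k)"
        have "p \<in> U k" unfolding k_def by (rule LeastI_ex[OF ex])
        moreover have "p \<notin> U j" if "j < k" for j using that unfolding k_def by (rule not_less_Least)
        ultimately have "p \<in> A k" using p unfolding A_def by blast
        then show "p \<in> (\<Union>k. A k)" by blast
      qed
    qed
    show "sigma_compact (A k)" for k by (rule sig)
    show "a = a'" if "a \<in> A k" "a' \<in> A k" "a - a' = x *\<^sub>R \<omega>" for k a a' x
      using Ubox[of k] AU[of k] that unfolding flow_box_def by blast
    show "emeasure lborel (flow_strip \<omega> h (A k)) \<le> ennreal (K * h) * surface_flux \<omega> S (A k)"
      "ennreal h * surface_flux \<omega> S (A k) \<le> ennreal K * emeasure lborel (flow_strip \<omega> h (A k))" for k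
      using Ubox[of k] sig[of k] AU[of k] h_pos unfolding flow_box_def by (simp_all add: less_imp_le)
  qed
  then show ?thesis by (rule that)
qed

lemma flux_density_measurable: "(\<lambda>a. ennreal (\<bar>g a\<bar> / norm (gradient S a))) \<in> borel_measurable borel"
proof -
  have [measurable]: "g \<in> borel_measurable borel" by (rule borel_measurable_continuous_onI[OF g_continuous])
  have [measurable]: "gradient S \<in> borel_measurable borel"
    by (rule borel_measurable_continuous_onI[OF continuous_gradient[OF smooth_S]])
  show ?thesis by measurable
qed

text \<open>Points of tangency are not in any piece, but the flux density vanishes there.\<close>

lemma surface_flux_sum:
  assumes A: "flow_boxes K A"
  shows "surface_flux \<omega> S (zero_surface S) = (\<Sum>k. surface_flux \<omega> S (A k))"
proof -
  let ?\<mu> = "hausdorff_measure (CARD('d) - 1) :: (real^'d) measure"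
  let ?\<rho> = "\<lambda>a. ennreal (\<bar>g a\<bar> / norm (gradient S a))"
  have dis: "disjoint_family A" and un: "(\<Union>k. A k) = transversal_part" and sc: "\<And>k. sigma_compact (A k)"
    using A by (simp_all add: flow_boxes_def)
  have m: "(\<lambda>a. ?\<rho> a * indicator (A k) a) \<in> borel_measurable ?\<mu>" for k
  proof -
    have "(\<lambda>a. ?\<rho> a * indicator (A k) a) \<in> borel_measurable borel"
      by (intro borel_measurable_times_ennreal flux_density_measurable borel_measurable_indicator sigma_compact_borel sc)
    then show ?thesis by (simp add: measurable_cong_sets[OF sets_hausdorff_measure refl])
  qed
  have eq: "?\<rho> a * indicator (zero_surface S) a = (\<Sum>k. ?\<rho> a * indicator (A k) a)" for a
  proof -
    have "?\<rho> a * indicator (zero_surface S) a = ?\<rho> a * indicator (\<Union>k. A k) a"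
      unfolding un by (auto simp: transversal_part_def indicator_def)
    also have "indicator (\<Union>k. A k) a = (\<Sum>k. indicator (A k) a :: ennreal)"
      by (rule suminf_indicator[OF dis, symmetric])
    finally show ?thesis by simp
  qed
  show ?thesis unfolding surface_flux_def eq by (rule nn_integral_suminf[OF m])
qed

text \<open>Each crossing of the segment has exactly one representative in the cell, which lies in
  exactly one piece \<open>A k\<close>. Conversely a pair of piece and lattice translate determines
  the crossing, because a piece contains no two points that differ by a multiple of
  \<open>\<omega>\<close>.\<close>

lemma crossing_number_eq_sum:
  assumes A: "flow_boxes K A" and \<theta>: "\<theta> \<notin> bad"
  shows "(\<Sum>k. \<Sum>l. indicator (flow_strip \<omega> h (A k)) (\<theta> + lattice_point l)) = crossing_number \<theta>"
proof -
  have dis: "disjoint_family A" and un: "(\<Union>k. A k) = transversal_part"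
    and inj: "\<And>k a a' x. a \<in> A k \<Longrightarrow> a' \<in> A k \<Longrightarrow> a - a' = x *\<^sub>R \<omega> \<Longrightarrow> a = a'"
    using A unfolding flow_boxes_def by blast+
  define P where "P = {(k, l). \<theta> + lattice_point l \<in> flow_strip \<omega> h (A k)}"
  have ex: "\<exists>k l. \<theta> + x *\<^sub>R \<omega> + lattice_point l \<in> A k" if x: "x \<in> crossings \<theta>" for x
  proof -
    have z: "x \<in> {0..h}" "S (\<theta> + x *\<^sub>R \<omega>) = 0" using x by (simp_all add: crossings_def)
    then have "g (\<theta> + x *\<^sub>R \<omega>) \<noteq> 0" using \<theta> unfolding bad_iff by blast
    moreover obtain l where l: "\<theta> + x *\<^sub>R \<omega> + lattice_point l \<in> zero_surface S" using zero_lattice_rep[OF z(2)] .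
    ultimately have "\<theta> + x *\<^sub>R \<omega> + lattice_point l \<in> transversal_part"
      by (simp add: transversal_part_def torus_periodic_lattice_point[OF g_per])
    then show ?thesis using un by blast
  qed
  then obtain \<kappa> \<nu> where kl: "\<And>x. x \<in> crossings \<theta> \<Longrightarrow> \<theta> + x *\<^sub>R \<omega> + lattice_point (\<nu> x) \<in> A (\<kappa> x)" by metis
  have At: "A k \<subseteq> torus" "\<And>a. a \<in> A k \<Longrightarrow> S a = 0" for k
    using un unfolding transversal_part_def zero_surface_def by blast+
  have bij: "bij_betw (\<lambda>x. (\<kappa> x, \<nu> x)) (crossings \<theta>) P"
  proof (rule bij_betw_imageI)
    show "inj_on (\<lambda>x. (\<kappa> x, \<nu> x)) (crossings \<theta>)"
    proof (rule inj_onI)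
      fix x x' assume x: "x \<in> crossings \<theta>" "x' \<in> crossings \<theta>" "(\<kappa> x, \<nu> x) = (\<kappa> x', \<nu> x')"
      have "\<theta> + x *\<^sub>R \<omega> + lattice_point (\<nu> x) = \<theta> + x' *\<^sub>R \<omega> + lattice_point (\<nu> x')"
        by (rule inj[of _ "\<kappa> x" _ "x - x'"]) (use kl[OF x(1)] kl[OF x(2)] x(3) in \<open>auto simp: algebra_simps\<close>)
      then have "(x - x') *\<^sub>R \<omega> = 0" using x(3) by (simp add: algebra_simps)
      then show "x = x'" using omega_nonzero by simp
    qed
    show "(\<lambda>x. (\<kappa> x, \<nu> x)) ` crossings \<theta> = P"
    proof (intro set_eqI iffI)
      fix p assume "p \<in> (\<lambda>x. (\<kappa> x, \<nu> x)) ` crossings \<theta>"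
      then obtain x where x: "p = (\<kappa> x, \<nu> x)" "x \<in> crossings \<theta>" by blast
      have "\<theta> + lattice_point (\<nu> x) = (\<theta> + x *\<^sub>R \<omega> + lattice_point (\<nu> x)) - x *\<^sub>R \<omega>" by simp
      then have "\<theta> + lattice_point (\<nu> x) \<in> flow_strip \<omega> h (A (\<kappa> x))"
        using kl[OF x(2)] x(2) unfolding flow_strip_def crossings_def by blast
      then show "p \<in> P" using x(1) by (simp add: P_def)
    next
      fix p assume "p \<in> P"
      then obtain k l where p: "p = (k, l)" "\<theta> + lattice_point l \<in> flow_strip \<omega> h (A k)" unfolding P_def by blast
      then obtain a x where ax: "\<theta> + lattice_point l = a - x *\<^sub>R \<omega>" "a \<in> A k" "x \<in> {0..h}" unfolding flow_strip_def by blast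
      have a: "a = \<theta> + x *\<^sub>R \<omega> + lattice_point l" using ax(1) by (simp add: algebra_simps)
      have "S (\<theta> + x *\<^sub>R \<omega>) = 0" using At(2)[OF ax(2)] unfolding a torus_periodic_lattice_point[OF per] .
      then have x: "x \<in> crossings \<theta>" using ax(3) by (simp add: crossings_def)
      have "\<nu> x = l"
        using ex1_lattice_point[of "\<theta> + x *\<^sub>R \<omega>"] kl[OF x] ax(2) At(1) unfolding a by blast
      moreover from this have "\<kappa> x = k"
        using kl[OF x] ax(2) dis unfolding a disjoint_family_on_def by blast
      ultimately show "p \<in> (\<lambda>x. (\<kappa> x, \<nu> x)) ` crossings \<theta>" using p(1) x by blast
    qed
  qed
  have finP: "finite P" using bij crossings_bound bij_betw_finite by blast
  have cardP: "card P = card (crossings \<theta>)" using bij_betw_same_card[OF bij] by simp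
  have "(\<Sum>k. \<Sum>l. indicator (flow_strip \<omega> h (A k)) (\<theta> + lattice_point l)) = (\<Sum>k. \<Sum>l. indicator P (k, l) :: ennreal)"
    by (simp add: P_def indicator_def)
  also have "\<dots> = (\<Sum>i. indicator P (prod_decode i))"
    by (rule suminf_ennreal_2dimen[symmetric]) simp
  also have "\<dots> = (\<Sum>i\<in>prod_encode ` P. indicator P (prod_decode i))"
  proof (rule suminf_finite)
    show "finite (prod_encode ` P)" using finP by simp
    fix i assume "i \<notin> prod_encode ` P"
    then have "prod_decode i \<notin> P" by (metis image_eqI prod_decode_inverse)
    then show "indicator P (prod_decode i) = (0::ennreal)" by simp
  qed
  also have "\<dots> = (\<Sum>i\<in>prod_encode ` P. 1)" by (intro sum.cong) auto
  also have "\<dots> = ennreal (real (card (crossings \<theta>)))"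
    by (simp add: card_image inj_prod_encode cardP ennreal_of_nat_eq_real_of_nat)
  finally show ?thesis using \<theta> by (simp add: crossing_number_def)
qed

text \<open>Folding a strip into the cell along the lattice preserves its volume when overlaps are
  counted with multiplicity.\<close>

lemma integral_crossing_number:
  assumes A: "flow_boxes K A"
  shows "(\<integral>\<^sup>+\<theta>\<in>torus. crossing_number \<theta> \<partial>lborel) = (\<Sum>k. emeasure lborel (flow_strip \<omega> h (A k)))"
proof -
  have W[measurable]: "flow_strip \<omega> h (A k) \<in> sets borel" for k
    using A by (simp add: flow_boxes_def flow_strip_measurable)
  have "(\<integral>\<^sup>+\<theta>\<in>torus. crossing_number \<theta> \<partial>lborel)
      = (\<integral>\<^sup>+\<theta>\<in>torus. (\<Sum>k. \<Sum>l. indicator (flow_strip \<omega> h (A k)) (\<theta> + lattice_point l)) \<partial>lborel)"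
  proof (rule nn_integral_cong_AE)
    show "AE \<theta> in lborel. crossing_number \<theta> * indicator torus \<theta>
        = (\<Sum>k. \<Sum>l. indicator (flow_strip \<omega> h (A k)) (\<theta> + lattice_point l)) * indicator torus \<theta>"
      using AE_not_bad
    proof (rule AE_mp, intro AE_I2 impI)
      fix \<theta> assume "\<theta> \<notin> bad"
      show "crossing_number \<theta> * indicator torus \<theta>
          = (\<Sum>k. \<Sum>l. indicator (flow_strip \<omega> h (A k)) (\<theta> + lattice_point l)) * indicator torus \<theta>"
        unfolding crossing_number_eq_sum[OF A \<open>\<theta> \<notin> bad\<close>] ..
    qed
  qed
  also have "\<dots> = (\<integral>\<^sup>+\<theta>. (\<Sum>k. (\<Sum>l. indicator (flow_strip \<omega> h (A k)) (\<theta> + lattice_point l)) * indicator torus \<theta>) \<partial>lborel)"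
    by (intro nn_integral_cong) simp
  also have "\<dots> = (\<Sum>k. \<integral>\<^sup>+\<theta>\<in>torus. (\<Sum>l. indicator (flow_strip \<omega> h (A k)) (\<theta> + lattice_point l)) \<partial>lborel)"
    by (rule nn_integral_suminf) measurable
  also have "\<dots> = (\<Sum>k. emeasure lborel (flow_strip \<omega> h (A k)))"
  proof (rule suminf_cong)
    fix k
    have "(\<integral>\<^sup>+\<theta>. indicator (flow_strip \<omega> h (A k)) \<theta> \<partial>lborel)
        = (\<integral>\<^sup>+\<theta>\<in>torus. (\<Sum>l. indicator (flow_strip \<omega> h (A k)) (\<theta> + lattice_point l)) \<partial>lborel)"
      by (rule nn_integral_torus_tiling) measurable
    then show "(\<integral>\<^sup>+\<theta>\<in>torus. (\<Sum>l. indicator (flow_strip \<omega> h (A k)) (\<theta> + lattice_point l)) \<partial>lborel)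
        = emeasure lborel (flow_strip \<omega> h (A k))" using W[of k] by simp
  qed
  finally show ?thesis .
qed

text \<open>The partition into boxes depends on \<open>K\<close>, but the two sides do not. Both
  inequalities hold up to every factor \<open>K > 1\<close>, hence exactly.\<close>

theorem surface_flux_eq:
  "ennreal h * surface_flux \<omega> S (zero_surface S) = (\<integral>\<^sup>+\<theta>\<in>torus. crossing_number \<theta> \<partial>lborel)"
proof (rule antisym; rule ennreal_le_by_factors)
  fix K :: real assume K: "1 < K"
  obtain A where A: "flow_boxes K A" using flow_boxes_exist[OF K] .
  have b: "emeasure lborel (flow_strip \<omega> h (A k)) \<le> ennreal (K * h) * surface_flux \<omega> S (A k)"
    "ennreal h * surface_flux \<omega> S (A k) \<le> ennreal K * emeasure lborel (flow_strip \<omega> h (A k))" for k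
    using A by (simp_all add: flow_boxes_def)
  have "ennreal h * surface_flux \<omega> S (zero_surface S) = (\<Sum>k. ennreal h * surface_flux \<omega> S (A k))"
    by (simp add: surface_flux_sum[OF A])
  also have "\<dots> \<le> (\<Sum>k. ennreal K * emeasure lborel (flow_strip \<omega> h (A k)))"
    by (intro suminf_le summableI b)
  also have "\<dots> = ennreal K * (\<integral>\<^sup>+\<theta>\<in>torus. crossing_number \<theta> \<partial>lborel)"
    by (simp add: integral_crossing_number[OF A])
  finally show "ennreal h * surface_flux \<omega> S (zero_surface S) \<le> ennreal K * (\<integral>\<^sup>+\<theta>\<in>torus. crossing_number \<theta> \<partial>lborel)" .
  have "(\<integral>\<^sup>+\<theta>\<in>torus. crossing_number \<theta> \<partial>lborel) \<le> (\<Sum>k. ennreal (K * h) * surface_flux \<omega> S (A k))"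
    unfolding integral_crossing_number[OF A] by (intro suminf_le summableI b)
  also have "\<dots> = ennreal (K * h) * surface_flux \<omega> S (zero_surface S)"
    by (simp add: surface_flux_sum[OF A])
  also have "\<dots> = ennreal K * (ennreal h * surface_flux \<omega> S (zero_surface S))"
    by (rule ennreal_mult_assoc[symmetric]) (use K h_pos in simp_all)
  finally show "(\<integral>\<^sup>+\<theta>\<in>torus. crossing_number \<theta> \<partial>lborel) \<le> ennreal K * (ennreal h * surface_flux \<omega> S (zero_surface S))" .
qed

end

section \<open>Mollified integrals and the density of zeros\<close>

lemma bump_rescaled_profile:
  assumes \<phi>: "mollifier_profile \<phi>" and \<eta>: "0 < \<eta>"
  shows "bump \<eta> (\<lambda>s. 1 / \<eta> * \<phi> (s / \<eta>))"
proof -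
  have sm: "smooth \<phi>" and supp: "closure {s. \<phi> s \<noteq> 0} \<subseteq> {-1<..<1}" and nn: "\<And>s. 0 \<le> \<phi> s"
    and int1: "(LINT s|lborel. \<phi> s) = 1"
    using \<phi> by (simp_all add: mollifier_profile_def)
  have cont: "continuous_on A \<phi>" for A by (rule smooth_continuous[OF sm])
  have zero: "\<phi> s = 0" if "1 \<le> \<bar>s\<bar>" for s
  proof (rule ccontr)
    assume "\<phi> s \<noteq> 0"
    then have "s \<in> closure {s. \<phi> s \<noteq> 0}" by (intro subsetD[OF closure_subset]) simp
    then have "s \<in> {-1<..<1}" by (rule subsetD[OF supp])
    then show False using that by (simp add: abs_if split: if_splits)
  qed
  \<comment> \<open>The base point lies left of the support, and \<open>-2\<close> keeps every
    \<open>s \<ge> -1\<close> in the interior of the interval of integration used for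
    differentiating \<open>K\<close>.\<close>
  define K where "K s = integral {-2..s} \<phi>" for s
  have K0: "K s = 0" if "s \<le> -1" for s
  proof -
    have "K s = integral {-2..s} (\<lambda>x. 0)" unfolding K_def
    proof (rule Henstock_Kurzweil_Integration.integral_cong)
      fix x assume "x \<in> {-2..s}"
      then have "1 \<le> \<bar>x\<bar>" using that by (simp add: abs_if)
      then show "\<phi> x = 0" by (rule zero)
    qed
    then show ?thesis by simp
  qed
  have K1: "K s = 1" if "1 \<le> s" for s
  proof -
    \<comment> \<open>The integral of a non-integrable function is 0 by convention, so the value 1
      forces integrability.\<close>
    have "integrable lborel \<phi>"
    proof (rule ccontr)
      assume "\<not> integrable lborel \<phi>"
      then have "(LINT s|lborel. \<phi> s) = 0" by (rule not_integrable_integral_eq)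
      then show False using int1 by simp
    qed
    from has_integral_integral_lborel[OF this] have "(\<phi> has_integral 1) UNIV" unfolding int1 .
    moreover have "(\<lambda>x. if x \<in> {-2..s} then \<phi> x else 0) = \<phi>"
    proof
      fix x show "(if x \<in> {-2..s} then \<phi> x else 0) = \<phi> x"
        using zero[of x] that by (auto simp: abs_if)
    qed
    ultimately have "(\<phi> has_integral 1) {-2..s}" using has_integral_restrict_UNIV[of "{-2..s}" \<phi> 1] by simp
    then show ?thesis unfolding K_def by (rule integral_unique)
  qed
  have dK: "(K has_real_derivative \<phi> s) (at s)" for s
  proof (cases "s < -1")
    \<comment> \<open>Left of \<open>-1\<close>, also beyond the base point, \<open>K\<close> is
      locally 0.\<close>
    case True
    have "\<forall>\<^sub>F t in nhds s. K t = 0"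
      using eventually_nhds_in_open[of "{..<-1}" s] True by (auto elim!: eventually_mono intro: K0)
    moreover have "((\<lambda>t. 0) has_real_derivative 0) (at s)" by simp
    ultimately have "(K has_real_derivative 0) (at s)"
      using DERIV_cong_ev[OF refl, of K "\<lambda>t. 0" s 0 0] by simp
    then show ?thesis using zero[of s] True by (simp add: abs_if)
  next
    case False
    have "(K has_real_derivative \<phi> s) (at s within {-2..s+1})"
      unfolding K_def by (rule integral_has_real_derivative[OF cont]) (use False in simp)
    moreover have "at s within {-2..s+1} = at s"
      by (rule at_within_interior) (use False in simp)
    ultimately show ?thesis by simp
  qed
  show ?thesis
    unfolding bump_def
  proof (intro conjI allI impI exI[of _ "\<lambda>s. K (s / \<eta>)"])
    show "continuous_on UNIV (\<lambda>s. 1 / \<eta> * \<phi> (s / \<eta>))"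
      by (intro continuous_intros continuous_on_compose2[OF cont[of UNIV]]) (use \<eta> in auto)
    show "0 \<le> 1 / \<eta> * \<phi> (s / \<eta>)" for s using nn \<eta> by simp
    show "1 / \<eta> * \<phi> (s / \<eta>) = 0" if "\<eta> \<le> \<bar>s\<bar>" for s
    proof -
      have "1 \<le> \<bar>s / \<eta>\<bar>" using that \<eta> by (simp add: pos_le_divide_eq)
      then show ?thesis using zero by simp
    qed
    show "((\<lambda>s. K (s / \<eta>)) has_real_derivative 1 / \<eta> * \<phi> (s / \<eta>)) (at s)" for s
    proof -
      have "((\<lambda>s. s / \<eta>) has_real_derivative 1 / \<eta>) (at s)"
        using \<eta> by (auto intro!: derivative_eq_intros)
      from DERIV_chain2[OF dK this] show ?thesis by (simp add: mult.commute)
    qed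
    show "K (s / \<eta>) = 0" if "s \<le> - \<eta>" for s
      by (rule K0) (use that \<eta> in \<open>simp add: pos_divide_le_eq\<close>)
    show "K (s / \<eta>) = 1" if "\<eta> \<le> s" for s
      by (rule K1) (use that \<eta> in \<open>simp add: pos_le_divide_eq\<close>)
  qed
qed

lemma nn_integral_torus_finite:
  fixes f :: "real^'d \<Rightarrow> ennreal"
  assumes "\<And>\<theta>. f \<theta> \<le> ennreal c"
  shows "(\<integral>\<^sup>+\<theta>\<in>torus. f \<theta> \<partial>lborel) < top"
proof -
  have "(\<integral>\<^sup>+\<theta>\<in>torus. f \<theta> \<partial>lborel) \<le> (\<integral>\<^sup>+\<theta>. ennreal c * indicator (torus :: (real^'d) set) \<theta> \<partial>lborel)"
    by (intro nn_integral_mono mult_right_mono assms) simp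
  also have "\<dots> < top" by (simp add: nn_integral_cmult_indicator emeasure_torus ennreal_mult_less_top del: power_mult_distrib)
  finally show ?thesis .
qed

context torus_crossing_step
begin

definition mean_crossings :: real where
  "mean_crossings = enn2real (\<integral>\<^sup>+\<theta>\<in>torus. crossing_number \<theta> \<partial>lborel)"

lemma crossing_number_le: "crossing_number \<theta> \<le> ennreal (real R)"
  using crossings_bound[of \<theta>] by (simp add: crossing_number_def)

lemma mean_crossings: "(\<integral>\<^sup>+\<theta>\<in>torus. crossing_number \<theta> \<partial>lborel) = ennreal mean_crossings" "0 \<le> mean_crossings"
  using nn_integral_torus_finite[of crossing_number, OF crossing_number_le] by (simp_all add: mean_crossings_def)

lemma flux_mean: "surface_flux \<omega> S (zero_surface S) = ennreal (mean_crossings / h)"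
proof -
  have e: "ennreal h * surface_flux \<omega> S (zero_surface S) = ennreal mean_crossings"
    using surface_flux_eq mean_crossings by simp
  have "surface_flux \<omega> S (zero_surface S) = ennreal (1 / h) * (ennreal h * surface_flux \<omega> S (zero_surface S))"
    using h_pos by (subst ennreal_mult_assoc) simp_all
  also have "\<dots> = ennreal (mean_crossings / h)"
    unfolding e using h_pos mean_crossings(2) by (subst ennreal_mult[symmetric]) simp_all
  finally show ?thesis .
qed

text \<open>By invariance under the flow the mollified torus integral is the mean of
  \<open>mollified_crossings\<close> divided by \<open>h\<close>. Off the null set
  \<open>bad\<close> the integrand eventually equals the crossing number, and \<open>R\<close>
  dominates it once \<open>\<eta> < \<eta>0\<close>.\<close>

lemma delta_limit:
  assumes \<phi>: "mollifier_profile \<phi>"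
  shows "((\<lambda>\<eta>. LINT \<theta>:torus|lborel. (1 / \<eta>) * \<phi> (S \<theta> / \<eta>) * \<bar>g \<theta>\<bar>) \<longlongrightarrow> mean_crossings / h) (at_right 0)"
proof (rule tendsto_at_right_sequentially[OF \<eta>0_pos])
  fix e :: "nat \<Rightarrow> real" assume e: "\<And>i. 0 < e i" "\<And>i. e i < \<eta>0" "e \<longlonglongrightarrow> 0"
  define k where "k i s = 1 / e i * \<phi> (s / e i)" for i s
  have bump: "bump (e i) (k i)" for i unfolding k_def[abs_def] by (rule bump_rescaled_profile[OF \<phi> e(1)])
  define F where "F i \<theta> = k i (S \<theta>) * \<bar>g \<theta>\<bar>" for i \<theta>
  have kc: "continuous_on UNIV (k i)" and k0: "0 \<le> k i s" for i s using bump[of i] by (simp_all add: bump_def)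
  have Fc: "continuous_on UNIV (F i)" for i
    unfolding F_def[abs_def] by (intro continuous_intros continuous_on_compose2[OF kc] S_continuous g_continuous) auto
  have F0: "0 \<le> F i \<theta>" for i \<theta> using k0 by (simp add: F_def)
  have Fper: "torus_periodic (F i)" for i
    unfolding torus_periodic_iff_lattice_point F_def
    by (simp add: torus_periodic_lattice_point[OF per] torus_periodic_lattice_point[OF g_per])
  have Fm[measurable]: "F i \<in> borel_measurable borel" for i by (rule borel_measurable_continuous_onI[OF Fc])
  have moll: "mollified_crossings (k i) \<theta> = integral {0..h} (\<lambda>x. F i (\<theta> + x *\<^sub>R \<omega>))" for i \<theta>
    by (simp add: mollified_crossings_def F_def)
  have int: "(\<lambda>x. F i (\<theta> + x *\<^sub>R \<omega>)) integrable_on {0..h}" for i \<theta>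
    by (intro integrable_continuous_real continuous_on_compose2[OF Fc] continuous_intros) auto
  have moll': "ennreal (mollified_crossings (k i) \<theta>) = (\<integral>\<^sup>+x. ennreal (F i (\<theta> + x *\<^sub>R \<omega>)) * indicator {0..h} x \<partial>lborel)" for i \<theta>
    unfolding moll by (rule nn_integral_has_integral_lebesgue'[OF F0 integrable_integral[OF int], symmetric])
  have mm[measurable]: "(\<lambda>\<theta>. ennreal (mollified_crossings (k i) \<theta>)) \<in> borel_measurable borel" for i
  proof -
    have "(\<lambda>\<theta>. \<integral>\<^sup>+x. ennreal (F i (\<theta> + x *\<^sub>R \<omega>)) * indicator {0..h} x \<partial>lborel) \<in> borel_measurable (lborel :: (real^'d) measure)"
      by measurable
    then show ?thesis unfolding moll' by simp
  qed
  have "(\<lambda>i. \<integral>\<^sup>+\<theta>\<in>torus. ennreal (mollified_crossings (k i) \<theta>) \<partial>lborel) \<longlonglongrightarrow> (\<integral>\<^sup>+\<theta>\<in>torus. crossing_number \<theta> \<partial>lborel)"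
  proof (rule nn_integral_dominated_convergence[where w="\<lambda>\<theta>. ennreal (real R) * indicator torus \<theta>"])
    show "(\<lambda>\<theta>. ennreal (mollified_crossings (k i) \<theta>) * indicator torus \<theta>) \<in> borel_measurable lborel" for i by measurable
    show "(\<lambda>\<theta>. crossing_number \<theta> * indicator torus \<theta>) \<in> borel_measurable lborel" by measurable
    show "(\<lambda>\<theta>. ennreal (real R) * indicator torus \<theta>) \<in> borel_measurable (lborel :: (real^'d) measure)" by measurable
    show "AE \<theta> in lborel. ennreal (mollified_crossings (k i) \<theta>) * indicator torus \<theta> \<le> ennreal (real R) * indicator torus \<theta>" for i
      by (intro AE_I2 mult_right_mono ennreal_leI mollified_crossings_bound[OF bump] less_imp_le[OF e(2)]) simp
    show "(\<integral>\<^sup>+\<theta>. ennreal (real R) * indicator torus \<theta> \<partial>(lborel :: (real^'d) measure)) < \<infinity>"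
      using nn_integral_torus_finite[of "\<lambda>_. ennreal (real R)" "real R"] by simp
    show "AE \<theta> in lborel. (\<lambda>i. ennreal (mollified_crossings (k i) \<theta>) * indicator torus \<theta>) \<longlonglongrightarrow> crossing_number \<theta> * indicator torus \<theta>"
      using AE_not_bad
    proof (rule AE_mp, intro AE_I2 impI)
      fix \<theta> assume \<theta>: "\<theta> \<notin> bad"
      obtain c where c: "0 < c" "\<And>\<eta> k. bump \<eta> k \<Longrightarrow> \<eta> < c \<Longrightarrow> mollified_crossings k \<theta> = real (card (crossings \<theta>))"
        using crossings_locally_stable[OF \<theta>] by metis
      have "\<forall>\<^sub>F i in sequentially. e i < c" using order_tendstoD(2)[OF e(3) c(1)] .
      then have "\<forall>\<^sub>F i in sequentially. ennreal (mollified_crossings (k i) \<theta>) * indicator torus \<theta> = crossing_number \<theta> * indicator torus \<theta>"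
      proof (rule eventually_mono)
        fix i assume "e i < c"
        from c(2)[OF bump this] show "ennreal (mollified_crossings (k i) \<theta>) * indicator torus \<theta> = crossing_number \<theta> * indicator torus \<theta>"
          using \<theta> by (simp add: crossing_number_def)
      qed
      then show "(\<lambda>i. ennreal (mollified_crossings (k i) \<theta>) * indicator torus \<theta>) \<longlonglongrightarrow> crossing_number \<theta> * indicator torus \<theta>"
        by (rule tendsto_eventually)
    qed
  qed
  then have "(\<lambda>i. enn2real (\<integral>\<^sup>+\<theta>\<in>torus. ennreal (mollified_crossings (k i) \<theta>) \<partial>lborel)) \<longlonglongrightarrow> mean_crossings"
    unfolding mean_crossings(1) by (rule tendsto_enn2real) (rule mean_crossings(2))
  then have "(\<lambda>i. enn2real (\<integral>\<^sup>+\<theta>\<in>torus. ennreal (mollified_crossings (k i) \<theta>) \<partial>lborel) / h) \<longlonglongrightarrow> mean_crossings / h"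
    by (intro tendsto_divide tendsto_const) (use h_pos in simp_all)
  moreover have "(LINT \<theta>:torus|lborel. (1 / e i) * \<phi> (S \<theta> / e i) * \<bar>g \<theta>\<bar>)
      = enn2real (\<integral>\<^sup>+\<theta>\<in>torus. ennreal (mollified_crossings (k i) \<theta>) \<partial>lborel) / h" for i
  proof -
    have "(\<integral>\<^sup>+\<theta>\<in>torus. ennreal (mollified_crossings (k i) \<theta>) \<partial>lborel) = ennreal h * (\<integral>\<^sup>+\<theta>\<in>torus. ennreal (F i \<theta>) \<partial>lborel)"
      unfolding moll by (rule nn_integral_torus_flow_integral[OF Fper Fc F0]) (use h_pos in simp)
    then have "enn2real (\<integral>\<^sup>+\<theta>\<in>torus. ennreal (mollified_crossings (k i) \<theta>) \<partial>lborel) = h * enn2real (\<integral>\<^sup>+\<theta>\<in>torus. ennreal (F i \<theta>) \<partial>lborel)"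
      using h_pos by (simp add: enn2real_mult)
    moreover have "(LINT \<theta>:torus|lborel. F i \<theta>) = enn2real (\<integral>\<^sup>+\<theta>\<in>torus. ennreal (F i \<theta>) \<partial>lborel)"
    proof -
      have "(LINT \<theta>:torus|lborel. F i \<theta>) = enn2real (\<integral>\<^sup>+\<theta>. ennreal (indicator torus \<theta> *\<^sub>R F i \<theta>) \<partial>lborel)"
        unfolding set_lebesgue_integral_def by (rule integral_eq_nn_integral) (measurable, simp add: F0)
      also have "(\<integral>\<^sup>+\<theta>. ennreal (indicator torus \<theta> *\<^sub>R F i \<theta>) \<partial>lborel) = (\<integral>\<^sup>+\<theta>\<in>torus. ennreal (F i \<theta>) \<partial>lborel)"
        by (intro nn_integral_cong) (simp add: indicator_def)
      finally show ?thesis .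
    qed
    ultimately show ?thesis using h_pos unfolding F_def k_def by simp
  qed
  ultimately show "(\<lambda>i. LINT \<theta>:torus|lborel. (1 / e i) * \<phi> (S \<theta> / e i) * \<bar>g \<theta>\<bar>) \<longlonglongrightarrow> mean_crossings / h" by simp
qed

section \<open>Counting zeros along the orbit of 0\<close>

lemma finite_orbit_zeros: "finite (orbit_zeros S \<omega> L)"
  using finite_line_zeros[of 0 L 0] by (simp add: orbit_zeros_def)

lemma crossings_on_orbit: "crossings (x *\<^sub>R \<omega>) = (\<lambda>z. z - x) ` {z\<in>{x..x + h}. S (z *\<^sub>R \<omega>) = 0}"
proof (intro set_eqI iffI)
  fix y assume "y \<in> crossings (x *\<^sub>R \<omega>)"
  then have "0 \<le> y" "y \<le> h" "S ((x + y) *\<^sub>R \<omega>) = 0" by (simp_all add: crossings_def scaleR_add_left)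
  then show "y \<in> (\<lambda>z. z - x) ` {z\<in>{x..x + h}. S (z *\<^sub>R \<omega>) = 0}"
    by (intro image_eqI[of _ _ "x + y"]) simp_all
next
  fix y assume "y \<in> (\<lambda>z. z - x) ` {z\<in>{x..x + h}. S (z *\<^sub>R \<omega>) = 0}"
  then obtain z where z: "y = z - x" "z \<in> {x..x + h}" "S (z *\<^sub>R \<omega>) = 0" by blast
  have "x *\<^sub>R \<omega> + y *\<^sub>R \<omega> = z *\<^sub>R \<omega>" by (simp add: z(1) scaleR_diff_left)
  then show "y \<in> crossings (x *\<^sub>R \<omega>)" using z by (simp add: crossings_def)
qed

lemma card_crossings_on_orbit:
  "card {z\<in>{x..x + h}. S (z *\<^sub>R \<omega>) = 0} = card (crossings (x *\<^sub>R \<omega>))"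
  unfolding crossings_on_orbit by (rule card_image[symmetric]) (simp add: inj_on_def)

lemma card_window_le: "card {z\<in>{x..x + h}. S (z *\<^sub>R \<omega>) = 0} \<le> R"
  using card_crossings_on_orbit[of x] crossings_bound[of "x *\<^sub>R \<omega>"] by simp

text \<open>Double counting: each zero in \<open>{h..T}\<close> is seen by the starting points of an interval of length \<open>h\<close>.\<close>

lemma nn_integral_crossings_bounds:
  assumes T: "0 \<le> T"
  defines "I \<equiv> (\<integral>\<^sup>+x. ennreal (real (card (crossings (x *\<^sub>R \<omega>)))) * indicator {0..T} x \<partial>lborel)"
  shows "I \<le> ennreal (h * (real (card (orbit_zeros S \<omega> T)) + real R))"
    and "ennreal (h * (real (card (orbit_zeros S \<omega> T)) - real R)) \<le> I"
proof -
  \<comment> \<open>Windows starting in \<open>{0..T}\<close> see zeros up to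
    \<open>T + h\<close>.\<close>
  define Z where "Z = {z\<in>{0..T + h}. S (z *\<^sub>R \<omega>) = 0}"
  have finZ: "finite Z" using finite_line_zeros[of 0 "T + h" 0] by (simp add: Z_def)
  have cnt: "ennreal (real (card (crossings (x *\<^sub>R \<omega>)))) * indicator {0..T} x
      = (\<Sum>z\<in>Z. indicator ({z - h..z} \<inter> {0..T}) x)" for x
  proof (cases "x \<in> {0..T}")
    case True
    have eq: "{z\<in>{x..x + h}. S (z *\<^sub>R \<omega>) = 0} = {z\<in>Z. x \<in> {z - h..z}}"
      using True by (auto simp: Z_def)
    have "(\<Sum>z\<in>Z. indicator ({z - h..z} \<inter> {0..T}) x) = (\<Sum>z\<in>Z. if x \<in> {z - h..z} then 1 else 0 :: ennreal)"
      using True by (intro sum.cong) (simp_all add: indicator_def)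
    also have "\<dots> = (\<Sum>z\<in>{z\<in>Z. x \<in> {z - h..z}}. 1)"
      using sum.inter_filter[OF finZ, of "\<lambda>_. 1 :: ennreal" "\<lambda>z. x \<in> {z - h..z}"] by simp
    also have "\<dots> = ennreal (real (card (crossings (x *\<^sub>R \<omega>))))"
      unfolding eq[symmetric] by (simp add: card_crossings_on_orbit ennreal_of_nat_eq_real_of_nat del: atLeastAtMost_iff)
    finally show ?thesis using True by simp
  qed simp
  have I: "I = (\<Sum>z\<in>Z. emeasure lborel ({z - h..z} \<inter> {0..T}))"
    unfolding I_def cnt by (subst nn_integral_sum) simp_all
  have "I \<le> (\<Sum>z\<in>Z. ennreal h)"
    unfolding I
  proof (rule sum_mono)
    fix z
    have "emeasure lborel ({z - h..z} \<inter> {0..T}) \<le> emeasure lborel {z - h..z}" by (intro emeasure_mono) auto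
    then show "emeasure lborel ({z - h..z} \<inter> {0..T}) \<le> ennreal h" using h_pos by simp
  qed
  also have "\<dots> = ennreal (h * real (card Z))"
    using h_pos by (simp add: ennreal_mult ennreal_of_nat_eq_real_of_nat mult.commute)
  also have "\<dots> \<le> ennreal (h * (real (card (orbit_zeros S \<omega> T)) + real R))"
  proof (intro ennreal_leI mult_left_mono)
    \<comment> \<open>All surplus zeros lie in one window of length \<open>h\<close>, which holds at
      most \<open>R\<close> of them.\<close>
    have "Z \<subseteq> orbit_zeros S \<omega> T \<union> {z\<in>{T..T + h}. S (z *\<^sub>R \<omega>) = 0}" by (auto simp: Z_def orbit_zeros_def)
    moreover have "finite {z\<in>{T..T + h}. S (z *\<^sub>R \<omega>) = 0}" using finite_line_zeros[of T "T + h" 0] by simp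
    ultimately have "card Z \<le> card (orbit_zeros S \<omega> T \<union> {z\<in>{T..T + h}. S (z *\<^sub>R \<omega>) = 0})"
      using finite_orbit_zeros by (intro card_mono) simp_all
    also have "\<dots> \<le> card (orbit_zeros S \<omega> T) + card {z\<in>{T..T + h}. S (z *\<^sub>R \<omega>) = 0}" by (rule card_Un_le)
    also have "\<dots> \<le> card (orbit_zeros S \<omega> T) + R" using card_window_le[of T] by simp
    finally show "real (card Z) \<le> real (card (orbit_zeros S \<omega> T)) + real R" by linarith
  qed (use h_pos in simp)
  finally show "I \<le> ennreal (h * (real (card (orbit_zeros S \<omega> T)) + real R))" .
  \<comment> \<open>For these zeros the whole interval \<open>{z - h..z}\<close> of starting points
    lies in \<open>{0..T}\<close>, so each contributes exactly \<open>h\<close>; the zeros dropped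
    lie in the first window.\<close>
  define Z' where "Z' = {z\<in>{h..T}. S (z *\<^sub>R \<omega>) = 0}"
  have Z': "Z' \<subseteq> Z" using h_pos by (auto simp: Z_def Z'_def)
  have "real (card (orbit_zeros S \<omega> T)) - real R \<le> real (card Z')"
  proof -
    have "orbit_zeros S \<omega> T \<subseteq> Z' \<union> {z\<in>{0..0 + h}. S (z *\<^sub>R \<omega>) = 0}" by (auto simp: Z'_def orbit_zeros_def)
    moreover have "finite {z\<in>{0..0 + h}. S (z *\<^sub>R \<omega>) = 0}" using finite_line_zeros[of 0 "0 + h" 0] by simp
    ultimately have "card (orbit_zeros S \<omega> T) \<le> card (Z' \<union> {z\<in>{0..0 + h}. S (z *\<^sub>R \<omega>) = 0})"
      using finite_subset[OF Z' finZ] by (intro card_mono) simp_all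
    also have "\<dots> \<le> card Z' + card {z\<in>{0..0 + h}. S (z *\<^sub>R \<omega>) = 0}" by (rule card_Un_le)
    also have "\<dots> \<le> card Z' + R" using card_window_le[of 0] by simp
    finally show ?thesis by linarith
  qed
  then have "ennreal (h * (real (card (orbit_zeros S \<omega> T)) - real R)) \<le> ennreal (h * real (card Z'))"
    using h_pos by (intro ennreal_leI mult_left_mono) simp_all
  also have "\<dots> = (\<Sum>z\<in>Z'. ennreal h)"
    using h_pos by (simp add: ennreal_mult ennreal_of_nat_eq_real_of_nat mult.commute)
  also have "\<dots> = (\<Sum>z\<in>Z'. emeasure lborel ({z - h..z} \<inter> {0..T}))"
  proof (rule sum.cong[OF refl])
    fix z assume "z \<in> Z'"
    then have "{z - h..z} \<inter> {0..T} = {z - h..z}" by (auto simp: Z'_def)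
    then show "ennreal h = emeasure lborel ({z - h..z} \<inter> {0..T})" using h_pos by simp
  qed
  also have "\<dots> \<le> I" unfolding I by (rule sum_mono2[OF finZ Z']) simp
  finally show "ennreal (h * (real (card (orbit_zeros S \<omega> T)) - real R)) \<le> I" .
qed

text \<open>The crossing number lies between \<open>good_count\<close> and
  \<open>good_count + R * cut\<close>, which are continuous and periodic. Integrating this bracket
  along the orbit makes equidistribution applicable to a discontinuous count.\<close>

lemma orbit_integrals:
  assumes T: "0 \<le> T" and \<delta>: "0 < \<delta>"
  shows "integral {0..T} (\<lambda>x. good_count \<delta> (x *\<^sub>R \<omega>)) \<le> h * (real (card (orbit_zeros S \<omega> T)) + real R)"
    and "h * (real (card (orbit_zeros S \<omega> T)) - real R)
      \<le> integral {0..T} (\<lambda>x. good_count \<delta> (x *\<^sub>R \<omega>)) + real R * integral {0..T} (\<lambda>x. cut \<delta> (x *\<^sub>R \<omega>))"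
proof -
  let ?N = "real (card (orbit_zeros S \<omega> T))"
  let ?G = "integral {0..T} (\<lambda>x. good_count \<delta> (x *\<^sub>R \<omega>))" and ?C = "integral {0..T} (\<lambda>x. cut \<delta> (x *\<^sub>R \<omega>))"
  let ?I = "\<integral>\<^sup>+x. ennreal (real (card (crossings (x *\<^sub>R \<omega>)))) * indicator {0..T} x \<partial>lborel"
  have cg: "continuous_on A (\<lambda>x. good_count \<delta> (x *\<^sub>R \<omega>))" for A
    by (intro continuous_on_compose2[OF good_count_continuous[OF \<delta>]] continuous_intros) auto
  have cc: "continuous_on A (\<lambda>x. cut \<delta> (x *\<^sub>R \<omega>))" for A
    by (intro continuous_on_compose2[OF cut_continuous[OF \<delta>, of UNIV]] continuous_intros) auto
  have ig: "(\<lambda>x. good_count \<delta> (x *\<^sub>R \<omega>)) integrable_on {0..T}" and ic: "(\<lambda>x. cut \<delta> (x *\<^sub>R \<omega>)) integrable_on {0..T}"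
    by (rule integrable_continuous_real[OF cg], rule integrable_continuous_real[OF cc])
  have [measurable]: "(\<lambda>x. good_count \<delta> (x *\<^sub>R \<omega>)) \<in> borel_measurable borel" "(\<lambda>x. cut \<delta> (x *\<^sub>R \<omega>)) \<in> borel_measurable borel"
    by (rule borel_measurable_continuous_onI[OF cg], rule borel_measurable_continuous_onI[OF cc])
  have G: "(\<integral>\<^sup>+x. ennreal (good_count \<delta> (x *\<^sub>R \<omega>)) * indicator {0..T} x \<partial>lborel) = ennreal ?G"
    by (rule nn_integral_has_integral_lebesgue'[OF good_count_bounds(1)[OF \<delta>] integrable_integral[OF ig]])
  have C: "(\<integral>\<^sup>+x. ennreal (cut \<delta> (x *\<^sub>R \<omega>)) * indicator {0..T} x \<partial>lborel) = ennreal ?C"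
    by (rule nn_integral_has_integral_lebesgue'[OF cut_bounds(1)[OF \<delta>] integrable_integral[OF ic]])
  have G0: "0 \<le> ?G" using good_count_bounds(1)[OF \<delta>] by (intro integral_nonneg ig)
  have C0: "0 \<le> ?C" using cut_bounds(1)[OF \<delta>] by (intro integral_nonneg ic)
  have "ennreal ?G \<le> ?I"
    unfolding G[symmetric] by (intro nn_integral_mono mult_right_mono ennreal_leI good_count_bounds[OF \<delta>]) simp
  also have "\<dots> \<le> ennreal (h * (?N + real R))" by (rule nn_integral_crossings_bounds(1)[OF T])
  finally show "?G \<le> h * (?N + real R)" using h_pos by (subst (asm) ennreal_le_iff) simp_all
  have "ennreal (h * (?N - real R)) \<le> ?I" by (rule nn_integral_crossings_bounds(2)[OF T])
  also have "\<dots> \<le> (\<integral>\<^sup>+x. ennreal (good_count \<delta> (x *\<^sub>R \<omega>)) * indicator {0..T} x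
      + ennreal (real R) * (ennreal (cut \<delta> (x *\<^sub>R \<omega>)) * indicator {0..T} x) \<partial>lborel)"
  proof (rule nn_integral_mono)
    fix x
    have "ennreal (real (card (crossings (x *\<^sub>R \<omega>)))) \<le> ennreal (good_count \<delta> (x *\<^sub>R \<omega>) + real R * cut \<delta> (x *\<^sub>R \<omega>))"
      by (rule ennreal_leI[OF good_count_bounds(3)[OF \<delta>]])
    also have "\<dots> = ennreal (good_count \<delta> (x *\<^sub>R \<omega>)) + ennreal (real R) * ennreal (cut \<delta> (x *\<^sub>R \<omega>))"
      using good_count_bounds(1)[OF \<delta>] cut_bounds(1)[OF \<delta>] by (simp add: ennreal_plus ennreal_mult)
    finally show "ennreal (real (card (crossings (x *\<^sub>R \<omega>)))) * indicator {0..T} x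
        \<le> ennreal (good_count \<delta> (x *\<^sub>R \<omega>)) * indicator {0..T} x + ennreal (real R) * (ennreal (cut \<delta> (x *\<^sub>R \<omega>)) * indicator {0..T} x)"
      by (cases "x \<in> {0..T}") simp_all
  qed
  also have "\<dots> = ennreal ?G + ennreal (real R) * ennreal ?C"
    by (subst nn_integral_add) (simp_all add: nn_integral_cmult G C)
  also have "\<dots> = ennreal (?G + real R * ?C)" using G0 C0 by (simp add: ennreal_plus ennreal_mult)
  finally show "h * (?N - real R) \<le> ?G + real R * ?C"
    using G0 C0 by (subst (asm) ennreal_le_iff) simp_all
qed

definition good_mean :: "real \<Rightarrow> real" where
  "good_mean \<delta> = enn2real (\<integral>\<^sup>+\<theta>\<in>torus. ennreal (good_count \<delta> \<theta>) \<partial>lborel)"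

definition cut_mean :: "real \<Rightarrow> real" where
  "cut_mean \<delta> = enn2real (\<integral>\<^sup>+\<theta>\<in>torus. ennreal (cut \<delta> \<theta>) \<partial>lborel)"

lemma mean_bounds:
  assumes \<delta>: "0 < \<delta>"
  shows "good_mean \<delta> \<le> mean_crossings" "mean_crossings \<le> good_mean \<delta> + real R * cut_mean \<delta>"
proof -
  have [measurable]: "good_count \<delta> \<in> borel_measurable borel" "cut \<delta> \<in> borel_measurable borel"
    by (rule borel_measurable_continuous_onI[OF good_count_continuous[OF \<delta>]],
        rule borel_measurable_continuous_onI[OF cut_continuous[OF \<delta>]])
  have gfin: "ennreal (good_count \<delta> \<theta>) \<le> ennreal (real R)" for \<theta>
    using good_count_bounds(2)[OF \<delta>, of \<theta>] crossings_bound[of \<theta>] by (intro ennreal_leI) linarith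
  have cfin: "ennreal (cut \<delta> \<theta>) \<le> ennreal 1" for \<theta> using cut_bounds(2)[OF \<delta>] by (rule ennreal_leI)
  have G: "(\<integral>\<^sup>+\<theta>\<in>torus. ennreal (good_count \<delta> \<theta>) \<partial>lborel) = ennreal (good_mean \<delta>)" "0 \<le> good_mean \<delta>"
    using nn_integral_torus_finite[of "\<lambda>\<theta>. ennreal (good_count \<delta> \<theta>)", OF gfin] by (simp_all add: good_mean_def)
  have C: "(\<integral>\<^sup>+\<theta>\<in>torus. ennreal (cut \<delta> \<theta>) \<partial>lborel) = ennreal (cut_mean \<delta>)" "0 \<le> cut_mean \<delta>"
    using nn_integral_torus_finite[of "\<lambda>\<theta>. ennreal (cut \<delta> \<theta>)", OF cfin] by (simp_all add: cut_mean_def)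
  have "ennreal (good_mean \<delta>) \<le> ennreal mean_crossings"
    unfolding G(1)[symmetric] mean_crossings(1)[symmetric]
  proof (intro nn_integral_mono mult_right_mono)
    fix \<theta>
    \<comment> \<open>On \<open>bad\<close> both sides are 0, because the cutoff is 1 there.\<close>
    show "ennreal (good_count \<delta> \<theta>) \<le> crossing_number \<theta>"
      using good_count_bounds(2)[OF \<delta>, of \<theta>]
      by (simp add: crossing_number_def good_count_def cut_bad ennreal_leI)
  qed simp
  then show "good_mean \<delta> \<le> mean_crossings" using mean_crossings(2) by (subst (asm) ennreal_le_iff) simp_all
  have "ennreal mean_crossings \<le> (\<integral>\<^sup>+\<theta>. ennreal (good_count \<delta> \<theta>) * indicator torus \<theta>
      + ennreal (real R) * (ennreal (cut \<delta> \<theta>) * indicator torus \<theta>) \<partial>lborel)"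
    unfolding mean_crossings(1)[symmetric]
  proof (rule nn_integral_mono)
    fix \<theta>
    have "crossing_number \<theta> \<le> ennreal (real (card (crossings \<theta>)))" by (simp add: crossing_number_def)
    also have "\<dots> \<le> ennreal (good_count \<delta> \<theta> + real R * cut \<delta> \<theta>)"
      by (rule ennreal_leI[OF good_count_bounds(3)[OF \<delta>]])
    also have "\<dots> = ennreal (good_count \<delta> \<theta>) + ennreal (real R) * ennreal (cut \<delta> \<theta>)"
      using good_count_bounds(1)[OF \<delta>] cut_bounds(1)[OF \<delta>] by (simp add: ennreal_plus ennreal_mult)
    finally show "crossing_number \<theta> * indicator torus \<theta>
        \<le> ennreal (good_count \<delta> \<theta>) * indicator torus \<theta> + ennreal (real R) * (ennreal (cut \<delta> \<theta>) * indicator torus \<theta>)"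
      by (cases "\<theta> \<in> torus") simp_all
  qed
  also have "\<dots> = ennreal (good_mean \<delta>) + ennreal (real R) * ennreal (cut_mean \<delta>)"
    by (subst nn_integral_add) (simp_all add: nn_integral_cmult G C)
  also have "\<dots> = ennreal (good_mean \<delta> + real R * cut_mean \<delta>)" using G C by (simp add: ennreal_plus ennreal_mult)
  finally show "mean_crossings \<le> good_mean \<delta> + real R * cut_mean \<delta>"
    using G C by (subst (asm) ennreal_le_iff) simp_all
qed

lemma cut_mean_tendsto_0: "(\<lambda>i. cut_mean (1 / real (Suc i))) \<longlonglongrightarrow> 0"
proof -
  have [measurable]: "cut (1 / real (Suc i)) \<in> borel_measurable borel" for i
    by (rule borel_measurable_continuous_onI[OF cut_continuous]) simp
  have "(\<lambda>i. \<integral>\<^sup>+\<theta>\<in>torus. ennreal (cut (1 / real (Suc i)) \<theta>) \<partial>lborel) \<longlonglongrightarrow> (\<integral>\<^sup>+\<theta>. 0 \<partial>(lborel :: (real^'d) measure))"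
  proof (rule nn_integral_dominated_convergence[where w="\<lambda>\<theta>. ennreal 1 * indicator torus \<theta>"])
    show "(\<lambda>\<theta>. ennreal (cut (1 / real (Suc i)) \<theta>) * indicator torus \<theta>) \<in> borel_measurable lborel" for i by measurable
    show "(\<lambda>\<theta>. 0) \<in> borel_measurable (lborel :: (real^'d) measure)" by simp
    show "(\<lambda>\<theta>. ennreal 1 * indicator torus \<theta>) \<in> borel_measurable (lborel :: (real^'d) measure)" by measurable
    show "AE \<theta> in lborel. ennreal (cut (1 / real (Suc i)) \<theta>) * indicator torus \<theta> \<le> ennreal 1 * indicator torus \<theta>" for i
      by (intro AE_I2 mult_right_mono ennreal_leI cut_bounds) simp_all
    show "(\<integral>\<^sup>+\<theta>. ennreal 1 * indicator torus \<theta> \<partial>(lborel :: (real^'d) measure)) < \<infinity>"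
      using nn_integral_torus_finite[of "\<lambda>_. ennreal 1" 1] by simp
    show "AE \<theta> in lborel. (\<lambda>i. ennreal (cut (1 / real (Suc i)) \<theta>) * indicator torus \<theta>) \<longlonglongrightarrow> 0"
      using AE_not_bad
    proof (rule AE_mp, intro AE_I2 impI)
      fix \<theta> assume "\<theta> \<notin> bad"
      from tendsto_ennrealI[OF cut_tendsto_0[OF this]]
      have "(\<lambda>i. ennreal (cut (1 / real (Suc i)) \<theta>)) \<longlonglongrightarrow> 0" by simp
      then show "(\<lambda>i. ennreal (cut (1 / real (Suc i)) \<theta>) * indicator torus \<theta>) \<longlonglongrightarrow> 0"
        by (cases "\<theta> \<in> torus") simp_all
    qed
  qed
  then have "(\<lambda>i. \<integral>\<^sup>+\<theta>\<in>torus. ennreal (cut (1 / real (Suc i)) \<theta>) \<partial>lborel) \<longlonglongrightarrow> ennreal 0" by simp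
  then show ?thesis unfolding cut_mean_def by (rule tendsto_enn2real) simp
qed

text \<open>For fixed \<open>\<delta>\<close> the bounds of the zero count converge as
  \<open>L\<close> grows, and their limits enclose the claimed value with a gap of
  \<open>R * cut_mean \<delta> / (h * V)\<close>. Only afterwards does \<open>\<delta>\<close> tend
  to 0, so no uniformity of equidistribution in \<open>\<delta>\<close> is required.\<close>

theorem zero_density:
  "((\<lambda>L. real (card (orbit_zeros S \<omega> L)) / L) \<longlongrightarrow> mean_crossings / (h * (2 * pi) ^ CARD('d))) at_top"
proof -
  let ?V = "(2 * pi) ^ CARD('d) :: real"
  define V where "V = ?V"
  have V: "0 < V" by (simp add: V_def)
  let ?N = "\<lambda>L. real (card (orbit_zeros S \<omega> L))"
  let ?G = "\<lambda>\<delta> L. integral {0..L} (\<lambda>x. good_count \<delta> (x *\<^sub>R \<omega>)) / L" and ?C = "\<lambda>\<delta> L. integral {0..L} (\<lambda>x. cut \<delta> (x *\<^sub>R \<omega>)) / L"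
  have limG: "(?G \<delta> \<longlongrightarrow> good_mean \<delta> / V) at_top" and limC: "(?C \<delta> \<longlongrightarrow> cut_mean \<delta> / V) at_top" if \<delta>: "0 < \<delta>" for \<delta>
    unfolding good_mean_def cut_mean_def V_def
    by (rule flow_equidistribution[OF nonres good_count_periodic good_count_continuous[OF \<delta>] good_count_bounds(1)[OF \<delta>]],
        rule flow_equidistribution[OF nonres cut_periodic cut_continuous[OF \<delta>] cut_bounds(1)[OF \<delta>]])
  have lim0: "((\<lambda>L. real R / L) \<longlongrightarrow> 0) at_top"
    by (rule tendsto_divide_0[OF tendsto_const filterlim_at_top_imp_at_infinity[OF filterlim_ident]])
  have lower: "((\<lambda>L. ?G \<delta> L / h - real R / L) \<longlongrightarrow> good_mean \<delta> / V / h - 0) at_top" if "0 < \<delta>" for \<delta>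
    by (intro tendsto_diff tendsto_divide limG[OF that] tendsto_const lim0) (use h_pos in simp)
  have upper: "((\<lambda>L. (?G \<delta> L + real R * ?C \<delta> L) / h + real R / L) \<longlongrightarrow> (good_mean \<delta> / V + real R * (cut_mean \<delta> / V)) / h + 0) at_top"
    if "0 < \<delta>" for \<delta>
    by (intro tendsto_add tendsto_divide tendsto_mult limG[OF that] limC[OF that] tendsto_const lim0) (use h_pos in simp)
  have low: "?G \<delta> L / h - real R / L \<le> ?N L / L" and upp: "?N L / L \<le> (?G \<delta> L + real R * ?C \<delta> L) / h + real R / L"
    if \<delta>: "0 < \<delta>" and L: "0 < L" for \<delta> L
  proof -
    note b = orbit_integrals[OF less_imp_le[OF L] \<delta>]
    have "integral {0..L} (\<lambda>x. good_count \<delta> (x *\<^sub>R \<omega>)) / h \<le> ?N L + real R"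
      using b(1) h_pos by (simp add: pos_divide_le_eq mult.commute)
    then have "integral {0..L} (\<lambda>x. good_count \<delta> (x *\<^sub>R \<omega>)) / h / L \<le> (?N L + real R) / L"
      by (rule divide_right_mono) (use L in simp)
    then show "?G \<delta> L / h - real R / L \<le> ?N L / L" by (simp add: add_divide_distrib mult.commute)
    have "?N L - real R \<le> (integral {0..L} (\<lambda>x. good_count \<delta> (x *\<^sub>R \<omega>)) + real R * integral {0..L} (\<lambda>x. cut \<delta> (x *\<^sub>R \<omega>))) / h"
      using b(2) h_pos by (simp add: pos_le_divide_eq mult.commute)
    then have "(?N L - real R) / L \<le> (integral {0..L} (\<lambda>x. good_count \<delta> (x *\<^sub>R \<omega>)) + real R * integral {0..L} (\<lambda>x. cut \<delta> (x *\<^sub>R \<omega>))) / h / L"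
      by (rule divide_right_mono) (use L in simp)
    then show "?N L / L \<le> (?G \<delta> L + real R * ?C \<delta> L) / h + real R / L"
      by (simp add: add_divide_distrib diff_divide_distrib mult.commute)
  qed
  define D where "D i = 1 / real (Suc i)" for i
  have D: "0 < D i" for i by (simp add: D_def)
  let ?M = "mean_crossings / V / h"
  have err: "(\<lambda>i. real R * cut_mean (D i) / V / h) \<longlonglongrightarrow> 0"
  proof -
    have "(\<lambda>i. real R * cut_mean (D i) / V / h) \<longlonglongrightarrow> real R * 0 / V / h"
      unfolding D_def by (intro tendsto_divide tendsto_mult tendsto_const cut_mean_tendsto_0) (use V h_pos in simp_all)
    then show ?thesis by simp
  qed
  have sc: "a / V / h \<le> b / V / h" if "a \<le> b" for a b
    by (intro divide_right_mono that) (use V h_pos in simp_all)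
  have "((\<lambda>L. ?N L / L) \<longlongrightarrow> ?M) at_top"
  proof (rule order_tendstoI)
    fix a assume "a < ?M"
    then have "\<forall>\<^sub>F i in sequentially. real R * cut_mean (D i) / V / h < ?M - a"
      by (intro order_tendstoD(2)[OF err]) simp
    then obtain i where i: "real R * cut_mean (D i) / V / h < ?M - a" using eventually_happens'[OF sequentially_bot] by blast
    have "?M \<le> (good_mean (D i) + real R * cut_mean (D i)) / V / h" by (rule sc[OF mean_bounds(2)[OF D]])
    then have "a < good_mean (D i) / V / h - 0" using i by (simp add: add_divide_distrib)
    from order_tendstoD(1)[OF lower[OF D] this] eventually_gt_at_top[of 0]
    show "\<forall>\<^sub>F L in at_top. a < ?N L / L"
    proof eventually_elim
      case (elim L)
      then show ?case using low[OF D, of L i] by linarith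
    qed
  next
    fix a assume "?M < a"
    then have "\<forall>\<^sub>F i in sequentially. real R * cut_mean (D i) / V / h < a - ?M"
      by (intro order_tendstoD(2)[OF err]) simp
    then obtain i where i: "real R * cut_mean (D i) / V / h < a - ?M" using eventually_happens'[OF sequentially_bot] by blast
    have "good_mean (D i) / V / h \<le> ?M" by (rule sc[OF mean_bounds(1)[OF D]])
    then have "(good_mean (D i) / V + real R * (cut_mean (D i) / V)) / h + 0 < a" using i by (simp add: add_divide_distrib)
    from order_tendstoD(2)[OF upper[OF D] this] eventually_gt_at_top[of 0]
    show "\<forall>\<^sub>F L in at_top. ?N L / L < a"
    proof eventually_elim
      case (elim L)
      then show ?case using upp[OF D, of L i] by linarith
    qed
  qed
  moreover have "?M = mean_crossings / (h * ?V)" unfolding V_def by (simp only: divide_divide_eq_left mult.commute)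
  ultimately show ?thesis by (simp only:)
qed

lemma flux_integral:
  defines "\<mu> \<equiv> hausdorff_measure (CARD('d) - 1) :: (real^'d) measure"
  shows "set_integrable \<mu> (zero_surface S) (\<lambda>\<theta>. \<bar>g \<theta>\<bar> / norm (gradient S \<theta>))"
    and "(LINT \<theta>:zero_surface S|\<mu>. \<bar>g \<theta>\<bar> / norm (gradient S \<theta>)) = mean_crossings / h"
proof -
  let ?\<rho> = "\<lambda>\<theta>. \<bar>g \<theta>\<bar> / norm (gradient S \<theta>)"
  let ?f = "\<lambda>\<theta>. indicator (zero_surface S) \<theta> *\<^sub>R ?\<rho> \<theta>"
  have [measurable]: "g \<in> borel_measurable borel" by (rule borel_measurable_continuous_onI[OF g_continuous])
  have [measurable]: "gradient S \<in> borel_measurable borel"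
    by (rule borel_measurable_continuous_onI[OF continuous_gradient[OF smooth_S]])
  have [measurable]: "zero_surface S \<in> sets borel"
  proof -
    have "closed {\<theta>. S \<theta> = 0}" by (intro closed_Collect_eq S_continuous continuous_on_const)
    then have "{\<theta>. S \<theta> = 0} \<inter> torus \<in> sets borel" by (intro sets.Int borel_closed torus_measurable)
    moreover have "zero_surface S = {\<theta>. S \<theta> = 0} \<inter> torus" by (auto simp: zero_surface_def)
    ultimately show ?thesis by simp
  qed
  have m: "?f \<in> borel_measurable \<mu>"
  proof -
    have "?f \<in> borel_measurable borel" by measurable
    then show ?thesis unfolding \<mu>_def by (simp add: measurable_cong_sets[OF sets_hausdorff_measure refl])
  qed
  have nn: "0 \<le> ?f \<theta>" for \<theta> by simp
  have eq: "(\<integral>\<^sup>+\<theta>. ennreal (?f \<theta>) \<partial>\<mu>) = ennreal (mean_crossings / h)"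
  proof -
    have "(\<integral>\<^sup>+\<theta>. ennreal (?f \<theta>) \<partial>\<mu>) = surface_flux \<omega> S (zero_surface S)"
      unfolding surface_flux_def \<mu>_def by (intro nn_integral_cong) (simp add: indicator_def)
    then show ?thesis by (simp add: flux_mean)
  qed
  show "set_integrable \<mu> (zero_surface S) ?\<rho>"
    unfolding set_integrable_def by (rule integrableI_nonneg[OF m]) (use nn eq in \<open>simp_all add: AE_I2\<close>)
  show "(LINT \<theta>:zero_surface S|\<mu>. ?\<rho> \<theta>) = mean_crossings / h"
    unfolding set_lebesgue_integral_def using integral_eq_nn_integral[OF m AE_I2[OF nn]] eq mean_crossings(2) h_pos by simp
qed

end

theorem theorem1p3:
  fixes \<omega> :: "real^'d" and S :: "real^'d \<Rightarrow> real"
  assumes "nonresonant \<omega>"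
    and "torus_periodic S"
    and "smooth S"
    and "zero_surface S \<noteq> {}"
    and "\<And>\<theta>. \<theta> \<in> zero_surface S \<Longrightarrow> gradient S \<theta> \<noteq> 0"
    and "(\<forall>\<theta>\<in>zero_surface S. dir_deriv \<omega> S \<theta> \<noteq> 0) \<or>
         (finite (tangency_set \<omega> S) \<and>
          (\<forall>\<theta>\<in>tangency_set \<omega> S. \<exists>r\<ge>2.
             (\<forall>l. 1 \<le> l \<and> l < r \<longrightarrow> (dir_deriv \<omega> ^^ l) S \<theta> = 0) \<and>
             (dir_deriv \<omega> ^^ r) S \<theta> \<noteq> 0))"
  shows "(\<forall>L. finite (orbit_zeros S \<omega> L)) \<and>
         (\<exists>\<rho> I.
            ((\<lambda>L. real (card (orbit_zeros S \<omega> L)) / L) \<longlongrightarrow> \<rho>) at_top \<and>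
            has_delta_integral S (\<lambda>\<theta>. \<bar>dir_deriv \<omega> S \<theta>\<bar>) I \<and>
            \<rho> = 1 / (2 * pi) ^ CARD('d) * I \<and>
            set_integrable (hausdorff_measure (CARD('d) - 1)) (zero_surface S)
              (\<lambda>\<theta>. \<bar>dir_deriv \<omega> S \<theta>\<bar> / norm (gradient S \<theta>)) \<and>
            \<rho> = 1 / (2 * pi) ^ CARD('d) *
                (LINT \<theta>:zero_surface S|hausdorff_measure (CARD('d) - 1).
                   \<bar>dir_deriv \<omega> S \<theta>\<bar> / norm (gradient S \<theta>)))"
proof -
  have "finite (tangency_set \<omega> S) \<and> (\<forall>\<theta>\<in>tangency_set \<omega> S. \<exists>r\<ge>1. (dir_deriv \<omega> ^^ r) S \<theta> \<noteq> 0)"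
  proof (rule disjE[OF assms(6)])
    assume "\<forall>\<theta>\<in>zero_surface S. dir_deriv \<omega> S \<theta> \<noteq> 0"
    then have "tangency_set \<omega> S = {}" unfolding tangency_set_def by blast
    then show ?thesis by simp
  next
    assume *: "finite (tangency_set \<omega> S) \<and> (\<forall>\<theta>\<in>tangency_set \<omega> S. \<exists>r\<ge>2.
       (\<forall>l. 1 \<le> l \<and> l < r \<longrightarrow> (dir_deriv \<omega> ^^ l) S \<theta> = 0) \<and> (dir_deriv \<omega> ^^ r) S \<theta> \<noteq> 0)"
    have "\<exists>r\<ge>1. (dir_deriv \<omega> ^^ r) S \<theta> \<noteq> 0" if \<theta>: "\<theta> \<in> tangency_set \<omega> S" for \<theta>
    proof -
      obtain r where "2 \<le> r" "(dir_deriv \<omega> ^^ r) S \<theta> \<noteq> 0"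
        using bspec[OF conjunct2[OF *] \<theta>] by (elim exE conjE)
      then show ?thesis by (intro exI[of _ r] conjI) simp_all
    qed
    with conjunct1[OF *] show ?thesis by (intro conjI ballI)
  qed
  then interpret torus_crossing \<omega> S
    by (intro torus_crossing.intro assms(1-5)) (auto elim: bspec)
  obtain h \<eta>0 R where "0 < h" "0 < \<eta>0"
    "\<And>\<theta>. (\<forall>x\<in>{0..h}. \<eta>0 \<le> \<bar>S (\<theta> + x *\<^sub>R \<omega>)\<bar>) \<or> (\<exists>r. 1 \<le> r \<and> r \<le> R \<and> (\<forall>x\<in>{0..h}. Dl r (\<theta> + x *\<^sub>R \<omega>) \<noteq> 0))"
    using uniform_finite_order by blast
  then interpret torus_crossing_step \<omega> S h \<eta>0 R
    by (intro torus_crossing_step.intro torus_crossing_axioms torus_crossing_step_axioms.intro)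
  \<comment> \<open>\<open>mean_crossings / h\<close> is both the integral with the Dirac mass, for
    every profile, and the flux through the zero surface; dividing it by the volume of the cell
    gives the density.\<close>
  show ?thesis
  proof (intro conjI allI exI)
    show "finite (orbit_zeros S \<omega> L)" for L by (rule finite_orbit_zeros)
    show "((\<lambda>L. real (card (orbit_zeros S \<omega> L)) / L) \<longlongrightarrow> mean_crossings / (h * (2 * pi) ^ CARD('d))) at_top"
      by (rule zero_density)
    show "has_delta_integral S (\<lambda>\<theta>. \<bar>dir_deriv \<omega> S \<theta>\<bar>) (mean_crossings / h)"
      unfolding has_delta_integral_def using delta_limit by blast
    show "mean_crossings / (h * (2 * pi) ^ CARD('d)) = 1 / (2 * pi) ^ CARD('d) * (mean_crossings / h)"
      by (simp add: mult.commute)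
    show "set_integrable (hausdorff_measure (CARD('d) - 1)) (zero_surface S)
        (\<lambda>\<theta>. \<bar>dir_deriv \<omega> S \<theta>\<bar> / norm (gradient S \<theta>))"
      by (rule flux_integral)
    show "mean_crossings / (h * (2 * pi) ^ CARD('d)) = 1 / (2 * pi) ^ CARD('d) *
        (LINT \<theta>:zero_surface S|hausdorff_measure (CARD('d) - 1). \<bar>dir_deriv \<omega> S \<theta>\<bar> / norm (gradient S \<theta>))"
      unfolding flux_integral(2) by (simp add: mult.commute)
  qed
qed

end
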